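(* Let $(\mu,\nu)\in\mathcal{M}_+^2$ and assume that $$W_1(\mu,\nu)<+\infty\quad\text{and}\quad\inf_{\pi\in\mathfrak{C}(\mu,\nu)}\mathrm{Ent}(\pi|\mu\otimes\nu)<+\infty.$$ Then $\mathcal{K}(\mu,\nu)=\lim_{\varepsilon\to0^+}\pi_\varepsilon$ (weak convergence).
   Context: Notation. $\mathcal{M}_+(E)$ and $\mathcal{M}_+^\sigma(E)$ are the finite, resp. $\sigma$-finite, positive Borel measures on $E$; $\mathcal{M}_+^2=\{(\mu,\nu)\in\mathcal{M}_+(\mathbb{R})^2:\mu(\mathbb{R})=\nu(\mathbb{R})>0\}$. $\gamma|_A$ is the restriction of $\gamma$ to $A$; $\gamma(x)=\gamma(\{x\})$; $F_\gamma^+(t)=\gamma((-\infty,t])$, $F_\gamma^-(t)=\gamma((-\infty,t))$; $\{F_\mu^+>F_\nu^+\}=\{x: F_\mu^+(x)>F_\nu^+(x)\}$, etc. $\mathrm{Marg}(\gamma_1,\gamma_2)$ is the set of $\pi\in\mathcal{M}_+(\mathbb{R}^2)$ with marginals $\gamma_1,\gamma_2$. $\mathrm F=\{(x,y)\in\mathbb{R}^2:x\le y\}$. $J(\pi)=\int|y-x|\,d\pi(x,y)$ and $W_1(\mu,\nu)=\min_{\mathrm{Marg}(\mu,\nu)}J$. $\mathrm{Ent}(\gamma_1|\gamma_2)=\int\log\big(\frac{d\gamma_1}{d\gamma_2}\big)\frac{d\gamma_1}{d\gamma_2}\,d\gamma_2$ if $\gamma_1\ll\gamma_2$, and $+\infty$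 otherwise. A set $\Gamma\subset\mathbb{R}^2$ is cyclically monotone if for all $n\ge1$ and $(x_1,y_1),\dots,(x_n,y_n)\in\Gamma$, $\sum_{i=1}^n|y_i-x_i|\le\sum_{i=1}^n|y_{i+1}-x_i|$ ($y_{n+1}=y_1$); $\mathfrak{C}(\mu,\nu)$ is the set of $\pi\in\mathrm{Marg}(\mu,\nu)$ concentrated on a cyclically monotone set. Entropic minimizers. For $\varepsilon>0$ let $J_\varepsilon(\pi)=\int|y-x|\,d\pi+\varepsilon\,\mathrm{Ent}(\pi|\mu\otimes\nu)$ on $\mathrm{Marg}(\mu,\nu)$. Under the assumptions of the claim $\inf J_\varepsilon<+\infty$, and $\pi_\varepsilon$ denotes the unique minimizer of $J_\varepsilon$ over $\mathrm{Marg}(\mu,\nu)$. Components of the real line. $E^+=\{F_\mu^+>F_\nu^+\}\cap\{F_\mu^->F_\nu^-\}$, $E^-=\{F_\mu^+<F_\nu^+\}\cap\{F_\mu^-<F_\nu^-\}$ (both open), $E^==\mathbb{R}\setminus(E^+\cup E^-)$. Let $(]a_k^+,b_k^+[)_{k\in\mathcal{K}^+}$ and $(]a_k^-,b_k^-[)_{k\in\mathcal{K}^-}$ be the countable families of connected components of $E^+$ and $E^-$ (endpoints may be infinite). $B$ is the set of all finite endpoints $a_k^\pm,b_k^\pm$. Components of the marginals (terms at infinite endpoints are zero). For $k\in\mathcal{K}^+$: $\mu_k^+=(F_\mu^+(a_k^+)-F_\nu^+(a_k^+))\delta_{a_k^+}+\mu|_{]a_k^+,b_k^+[}$ and $\nu_k^+=\nu|_{]a_k^+,b_k^+[}+(F_\mu^-(b_k^+)-F_\nu^-(b_k^+))\delta_{b_k^+}$.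 For $k\in\mathcal{K}^-$: $\mu_k^-=\mu|_{]a_k^-,b_k^-[}+(F_\nu^-(b_k^-)-F_\mu^-(b_k^-))\delta_{b_k^-}$ and $\nu_k^-=(F_\nu^+(a_k^-)-F_\mu^+(a_k^-))\delta_{a_k^-}+\nu|_{]a_k^-,b_k^-[}$. With $\mu^\pm=\sum_{k\in\mathcal{K}^\pm}\mu_k^\pm$: $\mu^==\mu|_{B^c\cap E^=}+\sum_{x\in B}(\mu(x)-\mu^+(x)-\mu^-(x))\delta_x$. Kellerer transport plans. For each $k\in\mathcal{K}^+$ there is exactly one measure in $\mathrm{Marg}(\mu_k^+,\nu_k^+)$ of the form $(\eta_1\otimes\eta_2)|_{\mathrm F}$ with $\eta_1,\eta_2\in\mathcal{M}_+^\sigma(\mathbb{R})$ (theorem of Kellerer); it is denoted $\mathcal{K}_{\mathrm F}(\mu_k^+,\nu_k^+)$. For $k\in\mathcal{K}^-$, likewise $\mathcal{K}_{\mathrm F}(\nu_k^-,\mu_k^-)$ exists and is unique, and $\mathcal{K}_{\tilde{\mathrm F}}(\mu_k^-,\nu_k^-):=i_\#\mathcal{K}_{\mathrm F}(\nu_k^-,\mu_k^-)$ with $i(x,y)=(y,x)$. Define $$\mathcal{K}(\mu,\nu)=\sum_{k\in\mathcal{K}^+}\mathcal{K}_{\mathrm F}(\mu_k^+,\nu_k^+)+\sum_{k\in\mathcal{K}^-}\mathcal{K}_{\tilde{\mathrm F}}(\mu_k^-,\nu_k^-)+(\mathrm{id},\mathrm{id})_\#\mu^=.$$ *)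

theory Defs
  imports "HOL-Probability.Probability"
begin

section \<open>Positive Borel measures\<close>

definition fin_measures :: "'a::topological_space measure set" where
  "fin_measures = {M. sets M = sets borel \<and> finite_measure M}"

definition sigma_fin_measures :: "'a::topological_space measure set" where
  "sigma_fin_measures = {M. sets M = sets borel \<and> sigma_finite_measure M}"

definition marginal_pairs :: "(real measure \<times> real measure) set" where
  "marginal_pairs = {(\<mu>, \<nu>). \<mu> \<in> fin_measures \<and> \<nu> \<in> fin_measures \<and>
     emeasure \<mu> UNIV = emeasure \<nu> UNIV \<and> emeasure \<mu> UNIV > 0}"

text \<open>The restriction of a measure to a set is again a measure on the whole space
  (unlike for \<^const>\<open>restrict_space\<close>).\<close>

definition restr :: "'a measure \<Rightarrow> 'a set \<Rightarrow> 'a measure" where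
  "restr M A = density M (indicator A)"

definition add_measure :: "'a::topological_space measure \<Rightarrow> 'a measure \<Rightarrow> 'a measure" where
  "add_measure M N = measure_of UNIV (sets borel) (\<lambda>A. emeasure M A + emeasure N A)"

definition sum_measures :: "'i set \<Rightarrow> ('i \<Rightarrow> 'a::topological_space measure) \<Rightarrow> 'a measure" where
  "sum_measures I M = measure_of UNIV (sets borel) (\<lambda>A. \<integral>\<^sup>+i. emeasure (M i) A \<partial>count_space I)"

text \<open>The values of the two constructions just defined, which show that the set functions
  given to \<^const>\<open>measure_of\<close> are countably additive.\<close>

lemma sets_add_measure [simp]: "sets (add_measure M N) = sets borel"
  unfolding add_measure_def by (metis sets.sigma_sets_eq sets_measure_of space_borel sets.space_closed)

lemma sets_sum_measures [simp]: "sets (sum_measures I M) = sets borel"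
  unfolding sum_measures_def by (metis sets.sigma_sets_eq sets_measure_of space_borel sets.space_closed)

lemma emeasure_add_measure:
  assumes "sets M = sets borel" "sets N = sets borel" "A \<in> sets borel"
  shows "emeasure (add_measure M N) A = emeasure M A + emeasure N A"
proof (rule emeasure_measure_of[OF add_measure_def])
  show "countably_additive (sets (add_measure M N)) (\<lambda>A. emeasure M A + emeasure N A)"
    by (auto simp: countably_additive_def assms suminf_add[symmetric] suminf_emeasure)
qed (use assms in \<open>auto simp: positive_def\<close>)

lemma emeasure_sum_measures:
  assumes "\<And>i. i \<in> I \<Longrightarrow> sets (M i) = sets borel" "A \<in> sets borel"
  shows "emeasure (sum_measures I M) A = (\<integral>\<^sup>+i. emeasure (M i) A \<partial>count_space I)"
proof (rule emeasure_measure_of[OF sum_measures_def])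
  show "countably_additive (sets (sum_measures I M)) (\<lambda>A. \<integral>\<^sup>+i. emeasure (M i) A \<partial>count_space I)"
    by (auto simp: countably_additive_def assms nn_integral_suminf[symmetric] suminf_emeasure
        intro!: nn_integral_cong)
qed (use assms in \<open>auto simp: positive_def\<close>)

text \<open>Weak convergence of finite Borel measures, tested against bounded continuous functions.
  The library's \<^const>\<open>weak_conv_m\<close> is for measures on the real line only.\<close>

definition weakly_tendsto ::
    "('i \<Rightarrow> 'a::topological_space measure) \<Rightarrow> 'a measure \<Rightarrow> 'i filter \<Rightarrow> bool" where
  "weakly_tendsto M N F \<longleftrightarrow>
     N \<in> fin_measures \<and> (\<forall>\<^sub>F i in F. M i \<in> fin_measures) \<and>
     (\<forall>f::'a \<Rightarrow> real. continuous_on UNIV f \<and> bounded (range f) \<longrightarrow>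
        ((\<lambda>i. \<integral>x. f x \<partial>M i) \<longlongrightarrow> (\<integral>x. f x \<partial>N)) F)"

section \<open>Transport plans, cost and entropy\<close>

definition Marg :: "real measure \<Rightarrow> real measure \<Rightarrow> (real \<times> real) measure set" where
  "Marg \<gamma>1 \<gamma>2 = {\<pi> \<in> fin_measures. distr \<pi> borel fst = \<gamma>1 \<and> distr \<pi> borel snd = \<gamma>2}"

definition transport_cost :: "(real \<times> real) measure \<Rightarrow> ennreal" where
  "transport_cost \<pi> = (\<integral>\<^sup>+(x, y). ennreal \<bar>y - x\<bar> \<partial>\<pi>)"

definition W1 :: "real measure \<Rightarrow> real measure \<Rightarrow> ennreal" where
  "W1 \<mu> \<nu> = (INF \<pi>\<in>Marg \<mu> \<nu>. transport_cost \<pi>)"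

text \<open>The entropy takes values in the extended reals: the negative part of the integrand is bounded,
  so for a finite reference measure the difference below is never of the form
  infinity minus infinity.  Note \<^term>\<open>RN_deriv \<gamma>2 \<gamma>1\<close> is the density of
  \<^term>\<open>\<gamma>1\<close> with respect to \<^term>\<open>\<gamma>2\<close>, and
  \<^term>\<open>absolutely_continuous \<gamma>2 \<gamma>1\<close> says that \<^term>\<open>\<gamma>1\<close> is absolutely
  continuous with respect to \<^term>\<open>\<gamma>2\<close>.\<close>

definition Ent :: "'a measure \<Rightarrow> 'a measure \<Rightarrow> ereal" where
  "Ent \<gamma>1 \<gamma>2 =
     (if absolutely_continuous \<gamma>2 \<gamma>1 then
        let h = (\<lambda>z. ln (enn2real (RN_deriv \<gamma>2 \<gamma>1 z)) * enn2real (RN_deriv \<gamma>2 \<gamma>1 z)) in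
          enn2ereal (\<integral>\<^sup>+z. ennreal (h z) \<partial>\<gamma>2) - enn2ereal (\<integral>\<^sup>+z. ennreal (- h z) \<partial>\<gamma>2)
      else \<infinity>)"

definition cyclically_monotone :: "(real \<times> real) set \<Rightarrow> bool" where
  "cyclically_monotone \<Gamma> \<longleftrightarrow>
     (\<forall>n\<ge>1. \<forall>x y :: nat \<Rightarrow> real. (\<forall>i<n. (x i, y i) \<in> \<Gamma>) \<longrightarrow>
        (\<Sum>i<n. \<bar>y i - x i\<bar>) \<le> (\<Sum>i<n. \<bar>y ((i + 1) mod n) - x i\<bar>))"

definition cm_plans :: "real measure \<Rightarrow> real measure \<Rightarrow> (real \<times> real) measure set" where
  "cm_plans \<mu> \<nu> = {\<pi> \<in> Marg \<mu> \<nu>. \<exists>\<Gamma>. cyclically_monotone \<Gamma> \<and> (AE z in \<pi>. z \<in> \<Gamma>)}"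

definition J_eps :: "real \<Rightarrow> real measure \<Rightarrow> real measure \<Rightarrow> (real \<times> real) measure \<Rightarrow> ereal" where
  "J_eps \<epsilon> \<mu> \<nu> \<pi> = enn2ereal (transport_cost \<pi>) + ereal \<epsilon> * Ent \<pi> (\<mu> \<Otimes>\<^sub>M \<nu>)"

definition pi_eps :: "real measure \<Rightarrow> real measure \<Rightarrow> real \<Rightarrow> (real \<times> real) measure" where
  "pi_eps \<mu> \<nu> \<epsilon> = (THE \<pi>. is_arg_min (J_eps \<epsilon> \<mu> \<nu>) (\<lambda>\<pi>. \<pi> \<in> Marg \<mu> \<nu>) \<pi>)"

section \<open>Components\<close>

text \<open>\<^term>\<open>cdf \<gamma> t\<close> is the mass of \<^term>\<open>{..t}\<close>; this is its left-continuous version.\<close>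

definition cdf_left :: "real measure \<Rightarrow> real \<Rightarrow> real" where
  "cdf_left \<gamma> t = measure \<gamma> {..<t}"

definition E_plus :: "real measure \<Rightarrow> real measure \<Rightarrow> real set" where
  "E_plus \<mu> \<nu> = {x. cdf \<mu> x > cdf \<nu> x} \<inter> {x. cdf_left \<mu> x > cdf_left \<nu> x}"

definition E_minus :: "real measure \<Rightarrow> real measure \<Rightarrow> real set" where
  "E_minus \<mu> \<nu> = {x. cdf \<mu> x < cdf \<nu> x} \<inter> {x. cdf_left \<mu> x < cdf_left \<nu> x}"

definition E_eq :: "real measure \<Rightarrow> real measure \<Rightarrow> real set" where
  "E_eq \<mu> \<nu> = - (E_plus \<mu> \<nu> \<union> E_minus \<mu> \<nu>)"

text \<open>The families of components are indexed by the components themselves, open intervals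
  \<^term>\<open>C\<close>.  The left endpoint is finite iff \<^term>\<open>bdd_below C\<close>, and is then
  \<^term>\<open>Inf C\<close>; likewise on the right.\<close>

definition endpoints :: "real measure \<Rightarrow> real measure \<Rightarrow> real set" where
  "endpoints \<mu> \<nu> =
     (let \<C> = components (E_plus \<mu> \<nu>) \<union> components (E_minus \<mu> \<nu>)
      in {Inf C | C. C \<in> \<C> \<and> bdd_below C} \<union> {Sup C | C. C \<in> \<C> \<and> bdd_above C})"

definition dirac_left :: "real set \<Rightarrow> (real \<Rightarrow> real) \<Rightarrow> real measure" where
  "dirac_left C c =
     (if bdd_below C then scale_measure (ennreal (c (Inf C))) (return borel (Inf C))
      else null_measure borel)"

definition dirac_right :: "real set \<Rightarrow> (real \<Rightarrow> real) \<Rightarrow> real measure" where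
  "dirac_right C c =
     (if bdd_above C then scale_measure (ennreal (c (Sup C))) (return borel (Sup C))
      else null_measure borel)"

definition mu_plus_comp :: "real measure \<Rightarrow> real measure \<Rightarrow> real set \<Rightarrow> real measure" where
  "mu_plus_comp \<mu> \<nu> C = add_measure (dirac_left C (\<lambda>a. cdf \<mu> a - cdf \<nu> a)) (restr \<mu> C)"

definition nu_plus_comp :: "real measure \<Rightarrow> real measure \<Rightarrow> real set \<Rightarrow> real measure" where
  "nu_plus_comp \<mu> \<nu> C = add_measure (restr \<nu> C) (dirac_right C (\<lambda>b. cdf_left \<mu> b - cdf_left \<nu> b))"

definition mu_minus_comp :: "real measure \<Rightarrow> real measure \<Rightarrow> real set \<Rightarrow> real measure" where
  "mu_minus_comp \<mu> \<nu> C = add_measure (restr \<mu> C) (dirac_right C (\<lambda>b. cdf_left \<nu> b - cdf_left \<mu> b))"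

definition nu_minus_comp :: "real measure \<Rightarrow> real measure \<Rightarrow> real set \<Rightarrow> real measure" where
  "nu_minus_comp \<mu> \<nu> C = add_measure (dirac_left C (\<lambda>a. cdf \<nu> a - cdf \<mu> a)) (restr \<nu> C)"

definition mu_plus :: "real measure \<Rightarrow> real measure \<Rightarrow> real measure" where
  "mu_plus \<mu> \<nu> = sum_measures (components (E_plus \<mu> \<nu>)) (mu_plus_comp \<mu> \<nu>)"

definition mu_minus :: "real measure \<Rightarrow> real measure \<Rightarrow> real measure" where
  "mu_minus \<mu> \<nu> = sum_measures (components (E_minus \<mu> \<nu>)) (mu_minus_comp \<mu> \<nu>)"

definition mu_eq :: "real measure \<Rightarrow> real measure \<Rightarrow> real measure" where
  "mu_eq \<mu> \<nu> =
     add_measure (restr \<mu> (- endpoints \<mu> \<nu> \<inter> E_eq \<mu> \<nu>))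
       (sum_measures (endpoints \<mu> \<nu>)
          (\<lambda>x. scale_measure
                 (ennreal (measure \<mu> {x} - measure (mu_plus \<mu> \<nu>) {x} - measure (mu_minus \<mu> \<nu>) {x}))
                 (return borel x)))"

section \<open>Kellerer transport plans\<close>

definition F_set :: "(real \<times> real) set" where
  "F_set = {(x, y). x \<le> y}"

definition Kellerer_F :: "real measure \<Rightarrow> real measure \<Rightarrow> (real \<times> real) measure" where
  "Kellerer_F \<gamma>1 \<gamma>2 =
     (THE \<pi>. \<pi> \<in> Marg \<gamma>1 \<gamma>2 \<and>
        (\<exists>\<eta>1\<in>sigma_fin_measures. \<exists>\<eta>2\<in>sigma_fin_measures. \<pi> = restr (\<eta>1 \<Otimes>\<^sub>M \<eta>2) F_set))"

definition Kellerer_F_tilde :: "real measure \<Rightarrow> real measure \<Rightarrow> (real \<times> real) measure" where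
  "Kellerer_F_tilde \<gamma>1 \<gamma>2 = distr (Kellerer_F \<gamma>2 \<gamma>1) borel (\<lambda>(x, y). (y, x))"

definition Kellerer_plan :: "real measure \<Rightarrow> real measure \<Rightarrow> (real \<times> real) measure" where
  "Kellerer_plan \<mu> \<nu> =
     add_measure
       (add_measure
          (sum_measures (components (E_plus \<mu> \<nu>))
             (\<lambda>C. Kellerer_F (mu_plus_comp \<mu> \<nu> C) (nu_plus_comp \<mu> \<nu> C)))
          (sum_measures (components (E_minus \<mu> \<nu>))
             (\<lambda>C. Kellerer_F_tilde (mu_minus_comp \<mu> \<nu> C) (nu_minus_comp \<mu> \<nu> C))))
       (distr (mu_eq \<mu> \<nu>) borel (\<lambda>x. (x, x)))"

end

theory Submission
  imports Defs
begin

text \<open>Strict convexity of \<open>x ln x\<close> bounds the distance in total variation of two plans by the gap of their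
  entropies in the midpoint inequality. Along \<open>\<epsilon> \<rightarrow> 0\<close> the entropy of the minimizers increases to a finite limit, so
  the minimizers are Cauchy in total variation; by Fatou's lemma their limit has minimal entropy among all plans of
  minimal cost.

  It remains to identify this limit \<open>\<pi>\<close>. A plan is optimal iff at no level \<open>t\<close> mass crosses \<open>t\<close> in both directions,
  which splits \<open>\<pi>\<close> into its restrictions to disjoint strips over the components of \<open>E\<^sup>+\<close> and \<open>E\<^sup>-\<close> and a part on
  the diagonal, with the prescribed marginals. Since \<open>|y - x| = (y - t) + (t - x)\<close> on the quadrant
  \<open>]-\<infinity>, t] \<times> [t, \<infinity>[\<close>, replacing \<open>\<pi>\<close> there by the product of its marginals keeps it optimal, so minimality of
  the entropy forces \<open>\<pi>\<close> to be a product on each of these quadrants. The quadrants with \<open>t\<close> in a component cover its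
  strip, and the products on them can be glued to a measure of Kellerer's form. Plans of this form are unique given
  their marginals.\<close>

section \<open>The entropy functional and convergence in mean\<close>

text \<open>The bound on the total variation takes the place of compactness: it gives existence and
  uniqueness of the minimizers for fixed \<epsilon> as well as their convergence. Both are wanted
  because \<open>pi_eps\<close> and \<open>Kellerer_F\<close> are definite descriptions. On the
  components existence comes from the limit itself, whose strips are shown to have Kellerer's form.

  Three obstacles shape the second half. Nothing is known about the entropies of the marginals of
  the quadrant part, so their logarithms must first be shown integrable, which the comparison of the
  plan with the product provides. Of the uncountably many quadrants only countably many can be
  glued: rational levels reach all points off the diagonal, whereas a point on the diagonal lies in
  the quadrant of its own level only; there the density of the limit leaves mass only at atoms of
  \<mu>. And the factors of a Kellerer plan may be infinite measures, so they are assembled from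
  finite pieces that agree after rescaling.

  The components of \<open>E_minus\<close> are components of \<open>E_plus\<close> for the exchanged
  pair, which is why the exchange of \<mu> and \<nu> is carried through all notions.\<close>

lemma relative_entropy_integrand_ge:
  fixes p q :: real
  assumes "p \<ge> 0" "q \<ge> 0" "q = 0 \<Longrightarrow> p = 0"
  shows "(sqrt p - sqrt q)\<^sup>2 \<le> p * ln p - p * ln q - p + q"
proof (cases "p = 0")
  case False
  then have p: "p > 0" and q: "q > 0"
    using assms by force+
  \<comment> \<open>Applied to the root of the ratio instead of the ratio itself, the tangent
    inequality leaves the squared difference of the roots as a remainder, where the ratio would only
    give 0.\<close>
  have "ln (sqrt (q / p)) \<le> sqrt (q / p) - 1"
    by (rule ln_le_minus_one) (use p q in simp)
  then have "ln q - ln p \<le> 2 * (sqrt q / sqrt p) - 2"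
    using p q by (simp add: ln_sqrt ln_div real_sqrt_divide)
  then have "p * (ln q - ln p) \<le> p * (2 * (sqrt q / sqrt p) - 2)"
    using p by (intro mult_left_mono) auto
  also have "\<dots> = 2 * (sqrt p * sqrt q) - 2 * p"
    using p by (simp add: field_simps real_sqrt_mult_self flip: power2_eq_square)
  finally have "p * ln q - p * ln p \<le> 2 * (sqrt p * sqrt q) - 2 * p"
    by (simp add: algebra_simps)
  moreover have "(sqrt p - sqrt q)\<^sup>2 = p + q - 2 * (sqrt p * sqrt q)"
    using p q by (simp add: power2_diff)
  ultimately show ?thesis by linarith
qed (use assms in auto)

text \<open>The case \<open>q = 1\<close> of the previous bound. The constant is not sharp, but any
  constant is integrable over a finite measure, which is what Fatou's lemma and the domination
  arguments below ask for.\<close>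

lemma mult_ln_self_ge:
  fixes x :: real
  assumes "x \<ge> 0"
  shows "- 1 \<le> x * ln x"
proof -
  have "0 \<le> (sqrt x - sqrt 1)\<^sup>2" by simp
  also have "\<dots> \<le> x * ln x - x * ln 1 - x + 1"
    by (rule relative_entropy_integrand_ge) (use assms in auto)
  finally show ?thesis using assms by simp
qed

lemma continuous_mult_ln_self: "continuous_on {0..} (\<lambda>x::real. x * ln x)"
proof -
  have "((\<lambda>x::real. x * ln x) \<longlongrightarrow> 0) (at_right 0)"
    by real_asymp
  then have "continuous (at 0 within {0..}) (\<lambda>x::real. x * ln x)"
    unfolding continuous_within 
    by (simp add: at_within_Ici_at_right)
  moreover have "continuous (at x within {0..}) (\<lambda>x::real. x * ln x)" if "x > 0" for x
    using that by (intro continuous_intros) auto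
  ultimately show ?thesis
    unfolding continuous_on_eq_continuous_within
    by (metis atLeast_iff le_less)
qed

text \<open>Quantitative strict convexity of \<open>x ln x\<close>: it makes the plans of almost
  minimal entropy a Cauchy family in the norm of total variation.\<close>

definition entropy_gap :: "real \<Rightarrow> real \<Rightarrow> real" where
  "entropy_gap a b = a * ln a + b * ln b - 2 * ((a + b) / 2 * ln ((a + b) / 2))"

text \<open>\<open>entropy_gap a b\<close> is the sum of the relative entropy integrands of
  \<open>a\<close> and of \<open>b\<close> with respect to their mean, hence at least half the
  square of \<open>sqrt a - sqrt b\<close>. Factoring \<open>a - b\<close> into the difference and
  the sum of the roots, the weighted inequality of arithmetic and geometric means gives the bound.
  With \<open>\<delta>\<close> free the bound can be integrated term by term, and
  \<open>\<delta>\<close> is chosen only afterwards.\<close>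

lemma abs_diff_le_entropy_gap:
  assumes "a \<ge> 0" "b \<ge> 0" "\<delta> > 0"
  shows "\<bar>a - b\<bar> \<le> entropy_gap a b / \<delta> + \<delta> * (a + b)"
proof -
  define m where "m = (a + b) / 2"
  define s t where "s = sqrt a - sqrt b" and "t = sqrt a + sqrt b"
  have "(sqrt a - sqrt m)\<^sup>2 \<le> a * ln a - a * ln m - a + m"
    by (rule relative_entropy_integrand_ge) (use assms in \<open>auto simp: m_def\<close>)
  moreover have "(sqrt b - sqrt m)\<^sup>2 \<le> b * ln b - b * ln m - b + m"
    by (rule relative_entropy_integrand_ge) (use assms in \<open>auto simp: m_def\<close>)
  moreover have "entropy_gap a b = a * ln a - a * ln m - a + m + (b * ln b - b * ln m - b + m)"
    unfolding entropy_gap_def m_def by (simp add: field_simps)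
  moreover have "s\<^sup>2 / 2 \<le> (sqrt a - sqrt m)\<^sup>2 + (sqrt b - sqrt m)\<^sup>2"
  proof -
    have "(sqrt a - sqrt m)\<^sup>2 + (sqrt b - sqrt m)\<^sup>2 - s\<^sup>2 / 2
        = (sqrt a + sqrt b - 2 * sqrt m)\<^sup>2 / 2"
      by (simp only: s_def power2_eq_square) (simp add: field_simps del: real_sqrt_mult_self)
    then show ?thesis
      using zero_le_power2[of "sqrt a + sqrt b - 2 * sqrt m"] by linarith
  qed
  ultimately have gap: "s\<^sup>2 / 2 \<le> entropy_gap a b" by linarith
  have "\<bar>s * t\<bar> \<le> (s\<^sup>2 / \<delta> + \<delta> * t\<^sup>2) / 2"
  proof -
    have "0 \<le> (\<bar>s\<bar> / sqrt \<delta> - sqrt \<delta> * \<bar>t\<bar>)\<^sup>2" by simp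
    also have "\<dots> = s\<^sup>2 / \<delta> + \<delta> * t\<^sup>2 - 2 * \<bar>s * t\<bar>"
      using assms by (simp add: power2_diff power_divide power_mult_distrib abs_mult)
    finally show ?thesis by simp
  qed
  moreover have "t\<^sup>2 \<le> 2 * (a + b)"
    using zero_le_power2[of s] assms by (simp add: s_def t_def power2_diff power2_sum)
  then have "\<delta> * t\<^sup>2 \<le> \<delta> * (2 * (a + b))"
    using assms by (intro mult_left_mono) auto
  moreover have "s\<^sup>2 / 2 / \<delta> \<le> entropy_gap a b / \<delta>"
    using gap assms by (intro divide_right_mono) auto
  moreover have "a - b = s * t"
    using assms by (simp add: s_def t_def algebra_simps)
  ultimately show ?thesis by (simp add: field_simps)
qed

text \<open>A negative gap would contradict the preceding bound for small \<open>\<delta>\<close>,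
  where the term of order \<open>1 / \<delta>\<close> dominates.\<close>

lemma entropy_gap_nonneg:
  assumes "a \<ge> 0" "b \<ge> 0"
  shows "entropy_gap a b \<ge> 0"
proof (rule ccontr)
  assume "\<not> ?thesis"
  then have neg: "entropy_gap a b < 0" by simp
  show False
  proof (cases "a + b = 0")
    case True
    then show False using assms neg by (simp add: entropy_gap_def add_nonneg_eq_0_iff)
  next
    case False
    then have ab: "a + b > 0" using assms by auto
    \<comment> \<open>The choice makes \<open>\<delta>\<^sup>2 * (a + b)\<close> half of the
      supposed deficit, so that the sum stays negative.\<close>
    define \<delta> where "\<delta> = sqrt (- entropy_gap a b / (2 * (a + b)))"
    have pos: "- entropy_gap a b / (2 * (a + b)) > 0"
      using ab neg by (intro divide_pos_pos) auto
    then have \<delta>: "\<delta> > 0" unfolding \<delta>_def by (rule real_sqrt_gt_zero)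
    have "0 \<le> entropy_gap a b / \<delta> + \<delta> * (a + b)"
      using abs_diff_le_entropy_gap[OF assms \<delta>] by linarith
    then have "0 \<le> (entropy_gap a b / \<delta> + \<delta> * (a + b)) * \<delta>"
      using \<delta> by simp
    also have "\<dots> = entropy_gap a b + \<delta>\<^sup>2 * (a + b)"
      using \<delta> by (simp add: field_simps power2_eq_square)
    also have "\<delta>\<^sup>2 = - entropy_gap a b / (2 * (a + b))"
      unfolding \<delta>_def using pos by (intro real_sqrt_pow2) auto
    also have "entropy_gap a b + - entropy_gap a b / (2 * (a + b)) * (a + b) = entropy_gap a b / 2"
    proof -
      have "E + - E / (2 * s) * s = E / 2" if "s > 0" for E s :: real
        using that by (simp add: field_simps)
      then show ?thesis using ab by blast
    qed
    finally show False using neg by simp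
  qed
qed

text \<open>Completeness of \<open>L1\<close> in the form used below: convergence in mean of the
  whole sequence carries the marginals to the limit, pointwise convergence of a subsequence serves
  Fatou's lemma for the entropy.\<close>

lemma L1_Cauchy_imp_convergent:
  fixes f :: "nat \<Rightarrow> 'a \<Rightarrow> real"
  assumes int [measurable]: "\<And>n. integrable M (f n)"
    and Cauchy: "\<And>e. e > 0 \<Longrightarrow> \<exists>N. \<forall>i\<ge>N. \<forall>j\<ge>N. (\<integral>x. \<bar>f i x - f j x\<bar> \<partial>M) < e"
  obtains g r where "integrable M g" "strict_mono (r :: nat \<Rightarrow> nat)"
    "AE x in M. (\<lambda>n. f (r n) x) \<longlonglongrightarrow> g x"
    "(\<lambda>n. \<integral>x. \<bar>f n x - g x\<bar> \<partial>M) \<longlonglongrightarrow> 0"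
proof -
  obtain r :: "nat \<Rightarrow> nat" where r: "strict_mono r" and cau: "AE x in M. Cauchy (\<lambda>i. f (r i) x)"
    using cauchy_L1_AE_cauchy_subseq[of M f] int Cauchy by (auto simp: real_norm_def)
  define g where "g x = lim (\<lambda>i. f (r i) x)" for x
  have g_meas [measurable]: "g \<in> borel_measurable M"
    unfolding g_def by measurable
  have lim: "AE x in M. (\<lambda>n. f (r n) x) \<longlonglongrightarrow> g x"
    using cau by eventually_elim (simp add: g_def Cauchy_convergent_iff convergent_LIMSEQ_iff)
  \<comment> \<open>With \<open>i\<close> fixed, Fatou's lemma along the subsequence turns the
    Cauchy estimate into an estimate against the limit.\<close>
  have bound: "(\<integral>\<^sup>+x. ennreal \<bar>f i x - g x\<bar> \<partial>M) \<le> ennreal e"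
    if e: "e > 0" and N: "\<forall>i\<ge>N. \<forall>j\<ge>N. (\<integral>x. \<bar>f i x - f j x\<bar> \<partial>M) < e" and i: "i \<ge> N" for e N i
  proof -
    have "(\<integral>\<^sup>+x. ennreal \<bar>f i x - g x\<bar> \<partial>M) = (\<integral>\<^sup>+x. liminf (\<lambda>j. ennreal \<bar>f i x - f (r j) x\<bar>) \<partial>M)"
    proof (rule nn_integral_cong_AE)
      show "AE x in M. ennreal \<bar>f i x - g x\<bar> = liminf (\<lambda>j. ennreal \<bar>f i x - f (r j) x\<bar>)"
        using lim
      proof eventually_elim
        case (elim x)
        then have "(\<lambda>j. ennreal \<bar>f i x - f (r j) x\<bar>) \<longlonglongrightarrow> ennreal \<bar>f i x - g x\<bar>"
          by (intro tendsto_ennrealI tendsto_intros)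
        then show ?case
          by (rule lim_imp_Liminf[symmetric, OF sequentially_bot])
      qed
    qed
    also have "\<dots> \<le> liminf (\<lambda>j. \<integral>\<^sup>+x. ennreal \<bar>f i x - f (r j) x\<bar> \<partial>M)"
      by (rule nn_integral_liminf) measurable
    also have "\<dots> \<le> liminf (\<lambda>j::nat. ennreal e)"
    proof (rule Liminf_mono)
      show "\<forall>\<^sub>F j in sequentially. (\<integral>\<^sup>+x. ennreal \<bar>f i x - f (r j) x\<bar> \<partial>M) \<le> ennreal e"
        using eventually_ge_at_top[of N]
      proof eventually_elim
        case (elim j)
        then have "r j \<ge> N" using seq_suble[OF r, of j] by linarith
        then have "(\<integral>x. \<bar>f i x - f (r j) x\<bar> \<partial>M) \<le> e"
          using N i by (auto intro: less_imp_le)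
        then show ?case
          by (subst nn_integral_eq_integral) (auto intro!: ennreal_leI int)
      qed
    qed
    also have "\<dots> = ennreal e"
      by (simp add: lim_imp_Liminf)
    finally show ?thesis .
  qed
  have diff_int: "integrable M (\<lambda>x. f i x - g x)" if "i \<ge> N"
    "\<forall>i\<ge>N. \<forall>j\<ge>N. (\<integral>x. \<bar>f i x - f j x\<bar> \<partial>M) < 1" for i N
    using bound[of 1 N i] that
    by (intro integrableI_bounded) (auto intro: le_less_trans)
  obtain N where "\<forall>i\<ge>N. \<forall>j\<ge>N. (\<integral>x. \<bar>f i x - f j x\<bar> \<partial>M) < 1"
    using Cauchy[of 1] by auto
  then have "integrable M (\<lambda>x. f N x - (f N x - g x))"
    by (intro Bochner_Integration.integrable_diff int diff_int) auto
  then have g_int: "integrable M g" by simp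
  have "(\<lambda>n. \<integral>x. \<bar>f n x - g x\<bar> \<partial>M) \<longlonglongrightarrow> 0"
  proof (rule LIMSEQ_I)
    fix e :: real assume e: "e > 0"
    then obtain N where N: "\<forall>i\<ge>N. \<forall>j\<ge>N. (\<integral>x. \<bar>f i x - f j x\<bar> \<partial>M) < e / 2"
      using Cauchy[of "e / 2"] by auto
    have "norm ((\<integral>x. \<bar>f n x - g x\<bar> \<partial>M) - 0) < e" if "n \<ge> N" for n
    proof -
      have "ennreal (\<integral>x. \<bar>f n x - g x\<bar> \<partial>M) = (\<integral>\<^sup>+x. ennreal \<bar>f n x - g x\<bar> \<partial>M)"
        by (subst nn_integral_eq_integral) (use int g_int in auto)
      also have "\<dots> \<le> ennreal (e / 2)" 
        by (rule bound[OF _ N that]) (use e in simp)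
      finally have "(\<integral>x. \<bar>f n x - g x\<bar> \<partial>M) \<le> e / 2"
        using e by (simp add: ennreal_le_iff)
      moreover have "0 \<le> (\<integral>x. \<bar>f n x - g x\<bar> \<partial>M)" by simp
      ultimately show ?thesis using e by simp
    qed
    then show "\<exists>no. \<forall>n\<ge>no. norm ((\<integral>x. \<bar>f n x - g x\<bar> \<partial>M) - 0) < e" by blast
  qed
  then show ?thesis using that g_int r lim by blast
qed

text \<open>Adding the constant \<open>k\<close>, integrable since the measure is finite, reduces
  the claim to Fatou's lemma for nonnegative functions. The bounds \<open>v n\<close> are kept apart
  from the integrals, which need not converge.\<close>

lemma (in finite_measure) Fatou_bounded_below:
  fixes f :: "nat \<Rightarrow> 'a \<Rightarrow> real"
  assumes int [measurable]: "\<And>n. integrable M (f n)"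
    and g_meas [measurable]: "g \<in> borel_measurable M"
    and lower: "\<And>n. AE x in M. - k \<le> f n x"
    and lim: "AE x in M. (\<lambda>n. f n x) \<longlonglongrightarrow> g x"
    and le: "\<And>n. (\<integral>x. f n x \<partial>M) \<le> v n" and v: "v \<longlonglongrightarrow> w"
  shows "integrable M g" "(\<integral>x. g x \<partial>M) \<le> w"
proof -
  define c where "c = k * measure M (space M)"
  have glow: "AE x in M. - k \<le> g x"
  proof -
    have "AE x in M. \<forall>n. - k \<le> f n x" using lower by (simp add: AE_all_countable)
    then show ?thesis using lim
      by eventually_elim (auto intro: LIMSEQ_le_const)
  qed
  have vn: "0 \<le> v n + c" for n
  proof -
    have "(\<integral>x. - k \<partial>M) \<le> (\<integral>x. f n x \<partial>M)"
      by (rule integral_mono_AE) (use int lower in auto)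
    then show ?thesis using le[of n] by (simp add: c_def mult.commute)
  qed
  have w: "0 \<le> w + c"
    by (rule LIMSEQ_le_const[OF tendsto_add[OF v tendsto_const]]) (use vn in auto)
  have "(\<integral>\<^sup>+x. ennreal (g x + k) \<partial>M) = (\<integral>\<^sup>+x. liminf (\<lambda>n. ennreal (f n x + k)) \<partial>M)"
  proof (rule nn_integral_cong_AE)
    show "AE x in M. ennreal (g x + k) = liminf (\<lambda>n. ennreal (f n x + k))"
      using lim
    proof eventually_elim
      case (elim x)
      then have "(\<lambda>n. ennreal (f n x + k)) \<longlonglongrightarrow> ennreal (g x + k)"
        by (intro tendsto_ennrealI tendsto_intros)
      then show ?case by (rule lim_imp_Liminf[symmetric, OF sequentially_bot])
    qed
  qed
  also have "\<dots> \<le> liminf (\<lambda>n. \<integral>\<^sup>+x. ennreal (f n x + k) \<partial>M)"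
    by (rule nn_integral_liminf) measurable
  also have "\<dots> \<le> liminf (\<lambda>n. ennreal (v n + c))"
  proof (rule Liminf_mono, rule always_eventually, rule allI)
    fix n
    have "(\<integral>\<^sup>+x. ennreal (f n x + k) \<partial>M) = ennreal (\<integral>x. f n x + k \<partial>M)"
      by (rule nn_integral_eq_integral) (use int lower[of n] in auto)
    also have "(\<integral>x. f n x + k \<partial>M) = (\<integral>x. f n x \<partial>M) + c"
      using int by (simp add: c_def mult.commute)
    finally show "(\<integral>\<^sup>+x. ennreal (f n x + k) \<partial>M) \<le> ennreal (v n + c)"
      using le[of n] by (simp add: ennreal_leI)
  qed
  also have "\<dots> = ennreal (w + c)"
    by (intro lim_imp_Liminf tendsto_ennrealI tendsto_intros v sequentially_bot)
  finally have fin: "(\<integral>\<^sup>+x. ennreal (g x + k) \<partial>M) \<le> ennreal (w + c)" .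
  have intk: "integrable M (\<lambda>x. g x + k)"
    by (rule integrableI_nonneg) (use fin glow in \<open>auto intro: le_less_trans\<close>)
  then have "integrable M (\<lambda>x. (g x + k) - k)"
    by (intro Bochner_Integration.integrable_diff) auto
  then show g: "integrable M g" by simp
  have "ennreal (\<integral>x. g x + k \<partial>M) \<le> ennreal (w + c)"
    using fin by (subst nn_integral_eq_integral[symmetric]) (use intk glow in auto)
  then have "(\<integral>x. g x + k \<partial>M) \<le> w + c"
    using w by (simp add: ennreal_le_iff)
  then show "(\<integral>x. g x \<partial>M) \<le> w"
    using g by (simp add: c_def mult.commute)
qed

section \<open>Plans and their densities\<close>

lemma sets_borel_pair: "sets (borel \<Otimes>\<^sub>M borel :: (real \<times> real) measure) = sets borel"
  by (metis borel_prod)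

lemma borel_measurable_fst_snd:
  "(fst :: real \<times> real \<Rightarrow> real) \<in> borel_measurable borel"
  "(snd :: real \<times> real \<Rightarrow> real) \<in> borel_measurable borel"
  by (simp_all flip: borel_prod)

lemma sets_borel_fst_snd:
  fixes \<pi> :: "(real \<times> real) measure"
  assumes "sets \<pi> = sets borel"
  shows "fst \<in> measurable \<pi> borel" "snd \<in> measurable \<pi> borel"
  unfolding measurable_cong_sets[OF assms refl] by (fact borel_measurable_fst_snd)+

lemma vimage_fst_snd_borel:
  fixes U :: "real set"
  assumes "U \<in> sets borel"
  shows "{z :: real \<times> real. fst z \<in> U} \<in> sets borel" "{z :: real \<times> real. snd z \<in> U} \<in> sets borel"
  using measurable_sets[OF borel_measurable_fst_snd(1) assms]
    measurable_sets[OF borel_measurable_fst_snd(2) assms]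
  by (simp_all add: vimage_def)

lemma sets_pair_borel:
  fixes M N :: "real measure"
  assumes "sets M = sets borel" "sets N = sets borel"
  shows "sets (M \<Otimes>\<^sub>M N) = sets borel"
  using sets_pair_measure_cong[OF assms] sets_borel_pair by simp

lemma MargD:
  assumes "\<pi> \<in> Marg \<gamma>1 \<gamma>2"
  shows "sets \<pi> = sets borel" "space \<pi> = UNIV" "finite_measure \<pi>"
    "U \<in> sets borel \<Longrightarrow> emeasure \<pi> {z. fst z \<in> U} = emeasure \<gamma>1 U"
    "U \<in> sets borel \<Longrightarrow> emeasure \<pi> {z. snd z \<in> U} = emeasure \<gamma>2 U"
    "sets \<gamma>1 = sets borel" "sets \<gamma>2 = sets borel"
proof -
  have *: "sets \<pi> = sets borel" "finite_measure \<pi>" "distr \<pi> borel fst = \<gamma>1" "distr \<pi> borel snd = \<gamma>2"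
    using assms by (auto simp: Marg_def fin_measures_def)
  have sp: "space \<pi> = UNIV" using sets_eq_imp_space_eq[OF *(1)] by simp
  note m = sets_borel_fst_snd[OF *(1)]
  show "sets \<pi> = sets borel" "space \<pi> = UNIV" "finite_measure \<pi>" by fact+
  show "emeasure \<pi> {z. fst z \<in> U} = emeasure \<gamma>1 U" if "U \<in> sets borel"
    using that m by (subst *(3)[symmetric], subst emeasure_distr) (auto simp: sp vimage_def)
  show "emeasure \<pi> {z. snd z \<in> U} = emeasure \<gamma>2 U" if "U \<in> sets borel"
    using that m by (subst *(4)[symmetric], subst emeasure_distr) (auto simp: sp vimage_def)
  show "sets \<gamma>1 = sets borel" "sets \<gamma>2 = sets borel"
    using *(3,4) by auto
qed

lemma MargI:
  assumes "sets \<pi> = sets borel" "finite_measure \<pi>" "sets \<gamma>1 = sets borel" "sets \<gamma>2 = sets borel"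
    "\<And>U. U \<in> sets borel \<Longrightarrow> emeasure \<pi> {z. fst z \<in> U} = emeasure \<gamma>1 U"
    "\<And>U. U \<in> sets borel \<Longrightarrow> emeasure \<pi> {z. snd z \<in> U} = emeasure \<gamma>2 U"
  shows "\<pi> \<in> Marg \<gamma>1 \<gamma>2"
proof -
  have sp: "space \<pi> = UNIV" using sets_eq_imp_space_eq[OF assms(1)] by simp
  note m = sets_borel_fst_snd[OF assms(1)]
  have "distr \<pi> borel fst = \<gamma>1"
    by (rule measure_eqI) (use assms m in \<open>auto simp: emeasure_distr sp vimage_def\<close>)
  moreover have "distr \<pi> borel snd = \<gamma>2"
    by (rule measure_eqI) (use assms m in \<open>auto simp: emeasure_distr sp vimage_def\<close>)
  ultimately show ?thesis using assms by (auto simp: Marg_def fin_measures_def)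
qed

section \<open>A pair of marginals and the densities of its plans\<close>

locale finite_borel_pair = M: finite_borel_measure \<mu> + N: finite_borel_measure \<nu>
  for \<mu> \<nu> :: "real measure" +
  assumes mass_eq: "emeasure \<mu> UNIV = emeasure \<nu> UNIV"
begin

declare M.M_is_borel [measurable_cong] N.M_is_borel [measurable_cong]

sublocale R: pair_sigma_finite \<mu> \<nu> ..

abbreviation R :: "(real \<times> real) measure" where "R \<equiv> \<mu> \<Otimes>\<^sub>M \<nu>"

sublocale RF: finite_measure "\<mu> \<Otimes>\<^sub>M \<nu>"
  by (rule finite_measure_pair_measure) unfold_locales

lemma sets_R: "sets R = sets borel"
  by (rule sets_pair_borel[OF M.M_is_borel N.M_is_borel])

lemma space_R: "space R = UNIV"
  using sets_eq_imp_space_eq[OF sets_R] by simp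

lemma UNIV_in_sets_R [simp]: "UNIV \<in> sets R"
  using sets.top[of R] by (simp only: space_R)

lemma space_mu [simp]: "space \<mu> = UNIV" and space_nu [simp]: "space \<nu> = UNIV"
  using M.borel_UNIV N.borel_UNIV by auto

text \<open>Nonnegativity is required at every point, not only almost everywhere, so that the
  inequalities for real numbers apply pointwise.\<close>

definition plan_density :: "(real \<times> real \<Rightarrow> real) \<Rightarrow> bool" where
  "plan_density p \<longleftrightarrow> p \<in> borel_measurable R \<and> (\<forall>z. 0 \<le> p z) \<and> density R p \<in> Marg \<mu> \<nu>"

lemma plan_densityD [measurable_dest]: "plan_density p \<Longrightarrow> p \<in> borel_measurable R"
  by (simp add: plan_density_def)

lemma plan_density_nonneg: "plan_density p \<Longrightarrow> 0 \<le> p z"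
  unfolding plan_density_def by blast

abbreviation mass :: real where "mass \<equiv> measure \<mu> UNIV"

lemma plan_density_nn_marginals:
  assumes p: "plan_density p" and U [measurable]: "U \<in> sets borel"
  shows "(\<integral>\<^sup>+z. ennreal (p z) * indicator U (fst z) \<partial>R) = emeasure \<mu> U"
    "(\<integral>\<^sup>+z. ennreal (p z) * indicator U (snd z) \<partial>R) = emeasure \<nu> U"
proof -
  note [measurable] = plan_densityD[OF p]
  have marg: "density R p \<in> Marg \<mu> \<nu>" using p by (simp add: plan_density_def)
  have 1: "{z. fst z \<in> U} \<in> sets R" "{z. snd z \<in> U} \<in> sets R"
    using vimage_fst_snd_borel[OF U] by (simp_all add: sets_R)
  show "(\<integral>\<^sup>+z. ennreal (p z) * indicator U (fst z) \<partial>R) = emeasure \<mu> U"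
    using MargD(4)[OF marg U] 1 by (simp add: emeasure_density indicator_def)
  show "(\<integral>\<^sup>+z. ennreal (p z) * indicator U (snd z) \<partial>R) = emeasure \<nu> U"
    using MargD(5)[OF marg U] 1 by (simp add: emeasure_density indicator_def)
qed

lemma plan_density_integrable:
  assumes p: "plan_density p"
  shows "integrable R p" "(\<integral>z. p z \<partial>R) = mass"
proof -
  note [measurable] = plan_densityD[OF p]
  have "(\<integral>\<^sup>+z. ennreal (p z) \<partial>R) = ennreal mass"
    using plan_density_nn_marginals(1)[OF p, of UNIV] by (simp add: M.emeasure_eq_measure)
  then have "has_bochner_integral R p mass"
    by (intro has_bochner_integral_nn_integral) (auto simp: plan_density_nonneg[OF p])
  then show "integrable R p" "(\<integral>z. p z \<partial>R) = mass"
    by (auto simp: has_bochner_integral_iff)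
qed

lemma plan_densityI_nn:
  assumes [measurable]: "p \<in> borel_measurable R" and nonneg: "\<And>z. 0 \<le> p z"
    and 1: "\<And>U. U \<in> sets borel \<Longrightarrow> (\<integral>\<^sup>+z. ennreal (p z) * indicator U (fst z) \<partial>R) = emeasure \<mu> U"
    and 2: "\<And>U. U \<in> sets borel \<Longrightarrow> (\<integral>\<^sup>+z. ennreal (p z) * indicator U (snd z) \<partial>R) = emeasure \<nu> U"
  shows "plan_density p"
proof -
  have "density R p \<in> Marg \<mu> \<nu>"
  proof (rule MargI)
    show "sets (density R p) = sets borel" by (simp add: sets_R)
    have "emeasure (density R p) (space (density R p)) = emeasure \<mu> UNIV"
      using 1[of UNIV] by (subst emeasure_density) (auto simp: space_R)
    then show "finite_measure (density R p)"
      by (intro finite_measureI) (simp add: M.emeasure_eq_measure)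
    fix U :: "real set" assume U [measurable]: "U \<in> sets borel"
    have "{z. fst z \<in> U} \<in> sets R" "{z. snd z \<in> U} \<in> sets R"
      using vimage_fst_snd_borel[OF U] by (simp_all add: sets_R)
    then show "emeasure (density R p) {z. fst z \<in> U} = emeasure \<mu> U"
      "emeasure (density R p) {z. snd z \<in> U} = emeasure \<nu> U"
      using 1[OF U] 2[OF U] by (simp_all add: emeasure_density indicator_def)
  qed (auto simp: M.M_is_borel N.M_is_borel)
  then show ?thesis using assms by (simp add: plan_density_def)
qed

lemma plan_density_marginals:
  assumes p: "plan_density p" and U [measurable]: "U \<in> sets borel"
  shows "(\<integral>z. p z * indicator U (fst z) \<partial>R) = measure \<mu> U"
    "(\<integral>z. p z * indicator U (snd z) \<partial>R) = measure \<nu> U"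
proof -
  note [measurable] = plan_densityD[OF p]
  show "(\<integral>z. p z * indicator U (fst z) \<partial>R) = measure \<mu> U"
    using plan_density_nn_marginals(1)[OF p U]
    by (subst integral_eq_nn_integral)
       (auto simp: plan_density_nonneg[OF p] ennreal_mult'' ennreal_indicator measure_def)
  show "(\<integral>z. p z * indicator U (snd z) \<partial>R) = measure \<nu> U"
    using plan_density_nn_marginals(2)[OF p U]
    by (subst integral_eq_nn_integral)
       (auto simp: plan_density_nonneg[OF p] ennreal_mult'' ennreal_indicator measure_def)
qed

lemma plan_densityI:
  assumes [measurable]: "integrable R p" and nonneg: "\<And>z. 0 \<le> p z"
    and 1: "\<And>U. U \<in> sets borel \<Longrightarrow> (\<integral>z. p z * indicator U (fst z) \<partial>R) = measure \<mu> U"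
    and 2: "\<And>U. U \<in> sets borel \<Longrightarrow> (\<integral>z. p z * indicator U (snd z) \<partial>R) = measure \<nu> U"
  shows "plan_density p"
proof (rule plan_densityI_nn)
  fix U :: "real set" assume U [measurable]: "U \<in> sets borel"
  have "integrable R (\<lambda>z. p z * indicator U (fst z))" "integrable R (\<lambda>z. p z * indicator U (snd z))"
    by (rule Bochner_Integration.integrable_bound[OF assms(1)]; auto split: split_indicator)+
  from nn_integral_eq_integral[OF this(1)] nn_integral_eq_integral[OF this(2)]
  show "(\<integral>\<^sup>+z. ennreal (p z) * indicator U (fst z) \<partial>R) = emeasure \<mu> U"
    "(\<integral>\<^sup>+z. ennreal (p z) * indicator U (snd z) \<partial>R) = emeasure \<nu> U"
    using 1[OF U] 2[OF U] nonneg
    by (simp_all add: ennreal_mult'' ennreal_indicator M.emeasure_eq_measure N.emeasure_eq_measure)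
qed (use nonneg in auto)

abbreviation entropy :: "(real \<times> real \<Rightarrow> real) \<Rightarrow> real" where
  "entropy p \<equiv> \<integral>z. p z * ln (p z) \<partial>R"

abbreviation cost :: "(real \<times> real \<Rightarrow> real) \<Rightarrow> real" where
  "cost p \<equiv> \<integral>z. \<bar>snd z - fst z\<bar> * p z \<partial>R"

text \<open>Both integrability conditions belong to the notion because the integral of a function
  that is not integrable is 0: only under them are \<open>entropy\<close> and \<open>cost\<close>
  the true values.\<close>

definition admissible :: "(real \<times> real \<Rightarrow> real) \<Rightarrow> bool" where
  "admissible p \<longleftrightarrow> plan_density p \<and> integrable R (\<lambda>z. p z * ln (p z)) \<and>
     integrable R (\<lambda>z. \<bar>snd z - fst z\<bar> * p z)"

lemma admissibleD:
  assumes "admissible p"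
  shows "plan_density p" "integrable R (\<lambda>z. p z * ln (p z))"
    "integrable R (\<lambda>z. \<bar>snd z - fst z\<bar> * p z)"
  using assms by (auto simp: admissible_def)

lemma entropy_ge:
  assumes "plan_density p" "integrable R (\<lambda>z. p z * ln (p z))"
  shows "- measure R UNIV \<le> entropy p"
proof -
  have "(\<integral>z. - 1 \<partial>R) \<le> entropy p"
    by (rule integral_mono) (use assms mult_ln_self_ge plan_density_nonneg in auto)
  then show ?thesis by (simp add: space_R)
qed

lemma cost_nonneg: "plan_density p \<Longrightarrow> 0 \<le> cost p"
  by (rule Bochner_Integration.integral_nonneg) (simp add: plan_density_nonneg)

text \<open>The integrand is at least \<open>- 1\<close> and the reference measure is finite, so the
  negative part has a finite integral. Only the positive part can be infinite, and then the value is
  \<open>\<infinity>\<close>.\<close>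

lemma Ent_density:
  assumes p: "plan_density p"
  shows "Ent (density R p) R =
    (if integrable R (\<lambda>z. p z * ln (p z)) then ereal (entropy p) else \<infinity>)"
proof -
  note [measurable] = plan_densityD[OF p]
  let ?h = "\<lambda>z. ln (enn2real (RN_deriv R (density R p) z)) * enn2real (RN_deriv R (density R p) z)"
  have ac: "absolutely_continuous R (density R p)"
    by (rule absolutely_continuousI_density) simp
  have "AE z in R. ennreal (p z) = RN_deriv R (density R p) z"
    by (rule R.RN_deriv_unique) auto
  then have h: "AE z in R. ?h z = p z * ln (p z)"
  proof eventually_elim
    case (elim z)
    then have "enn2real (RN_deriv R (density R p) z) = p z"
      by (metis enn2real_ennreal plan_density_nonneg[OF p])
    then show ?case by (simp only: mult.commute)
  qed
  have pos: "(\<integral>\<^sup>+z. ennreal (?h z) \<partial>R) = (\<integral>\<^sup>+z. ennreal (p z * ln (p z)) \<partial>R)"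
    by (rule nn_integral_cong_AE) (use h in \<open>eventually_elim, simp\<close>)
  have neg: "(\<integral>\<^sup>+z. ennreal (- ?h z) \<partial>R) = (\<integral>\<^sup>+z. ennreal (- (p z * ln (p z))) \<partial>R)"
    by (rule nn_integral_cong_AE) (use h in \<open>eventually_elim, simp\<close>)
  have "(\<integral>\<^sup>+z. ennreal (- (p z * ln (p z))) \<partial>R) \<le> (\<integral>\<^sup>+z. 1 \<partial>R)"
  proof (rule nn_integral_mono)
    fix z
    have "- (p z * ln (p z)) \<le> 1" using mult_ln_self_ge[OF plan_density_nonneg[OF p], of z] by linarith
    then show "ennreal (- (p z * ln (p z))) \<le> 1" by (simp add: ennreal_le_1)
  qed
  also have "\<dots> < \<infinity>" by (simp add: space_R RF.emeasure_eq_measure)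
  finally have fin: "(\<integral>\<^sup>+z. ennreal (- (p z * ln (p z))) \<partial>R) < \<infinity>" .
  have E: "Ent (density R p) R = enn2ereal (\<integral>\<^sup>+z. ennreal (p z * ln (p z)) \<partial>R)
      - enn2ereal (\<integral>\<^sup>+z. ennreal (- (p z * ln (p z))) \<partial>R)"
    unfolding Ent_def Let_def using ac pos neg by simp
  obtain n where n: "(\<integral>\<^sup>+z. ennreal (- (p z * ln (p z))) \<partial>R) = ennreal n" "0 \<le> n"
    using fin unfolding infinity_ennreal_def less_top_ennreal by blast
  show ?thesis
  proof (cases "integrable R (\<lambda>z. p z * ln (p z))")
    case True
    then have "(\<integral>\<^sup>+z. ennreal (p z * ln (p z)) \<partial>R) < \<infinity>"
      by (auto simp: real_integrable_def less_top)
    then obtain a where a: "(\<integral>\<^sup>+z. ennreal (p z * ln (p z)) \<partial>R) = ennreal a" "0 \<le> a"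
      unfolding infinity_ennreal_def less_top_ennreal by blast
    show ?thesis
      using True n a unfolding E by (simp add: real_lebesgue_integral_def[OF True] enn2ereal_ennreal)
  next
    case False
    then have "(\<integral>\<^sup>+z. ennreal (p z * ln (p z)) \<partial>R) = \<infinity>"
      using fin by (auto simp: real_integrable_def)
    then show ?thesis using False n unfolding E by (simp add: enn2ereal_ennreal)
  qed
qed

lemma transport_cost_density:
  assumes p: "plan_density p"
  shows "transport_cost (density R p) =
    (if integrable R (\<lambda>z. \<bar>snd z - fst z\<bar> * p z) then ennreal (cost p) else \<infinity>)"
proof -
  note [measurable] = plan_densityD[OF p]
  have E: "transport_cost (density R p) = (\<integral>\<^sup>+z. ennreal (\<bar>snd z - fst z\<bar> * p z) \<partial>R)"
    unfolding transport_cost_def split_beta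
    by (subst nn_integral_density) (auto simp: ennreal_mult'' plan_density_nonneg[OF p] mult.commute)
  show ?thesis
  proof (cases "integrable R (\<lambda>z. \<bar>snd z - fst z\<bar> * p z)")
    case True
    have "(\<integral>\<^sup>+z. ennreal (\<bar>snd z - fst z\<bar> * p z) \<partial>R) = ennreal (cost p)"
      by (rule nn_integral_eq_integral[OF True]) (simp add: plan_density_nonneg[OF p])
    then show ?thesis unfolding E using True by metis
  next
    case False
    have "(\<integral>\<^sup>+z. ennreal (\<bar>snd z - fst z\<bar> * p z) \<partial>R) = \<infinity>"
    proof (rule ccontr)
      assume "\<not> ?thesis"
      then have "integrable R (\<lambda>z. \<bar>snd z - fst z\<bar> * p z)"
        by (intro integrableI_nonneg) (auto simp: plan_density_nonneg[OF p] less_top)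
      then show False using False by contradiction
    qed
    then show ?thesis unfolding E using False by argo
  qed
qed

lemma finite_Ent_imp_density:
  assumes \<pi>: "\<pi> \<in> Marg \<mu> \<nu>" and fin: "Ent \<pi> R < \<infinity>"
  obtains p where "plan_density p" "\<pi> = density R p" "integrable R (\<lambda>z. p z * ln (p z))"
proof -
  have ac: "absolutely_continuous R \<pi>"
    using fin by (auto simp: Ent_def split: if_splits)
  have sets: "sets \<pi> = sets R" using MargD(1)[OF \<pi>] sets_R by simp
  have finm: "finite_measure \<pi>" using MargD(3)[OF \<pi>] .
  \<comment> \<open>The derivative in its real-valued, everywhere nonnegative version, as
    \<open>plan_density\<close> demands.\<close>
  obtain D where D: "D \<in> borel_measurable R" "AE x in R. RN_deriv R \<pi> x = ennreal (D x)" "\<And>x. 0 \<le> D x"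
    using R.real_RN_deriv[OF finm ac sets] by metis
  note [measurable] = D(1)
  have "density R (RN_deriv R \<pi>) = density R D"
    by (rule density_cong) (use D in auto)
  then have eq: "\<pi> = density R D"
    using R.density_RN_deriv[OF ac sets] by simp
  then have "plan_density D" using D \<pi> by (simp add: plan_density_def)
  moreover from this have "integrable R (\<lambda>z. D z * ln (D z))"
    using fin Ent_density[of D] eq by (auto split: if_splits)
  ultimately show ?thesis using that eq by blast
qed

lemma J_eps_density:
  assumes "admissible p"
  shows "J_eps \<epsilon> \<mu> \<nu> (density R p) = ereal (cost p + \<epsilon> * entropy p)"
proof -
  note p = admissibleD[OF assms]
  show ?thesis
    unfolding J_eps_def Ent_density[OF p(1)] transport_cost_density[OF p(1)]
    using p cost_nonneg[OF p(1)] by (simp add: enn2ereal_ennreal)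
qed

lemma finite_J_eps_imp_density:
  assumes \<pi>: "\<pi> \<in> Marg \<mu> \<nu>" and \<epsilon>: "\<epsilon> > 0" and fin: "J_eps \<epsilon> \<mu> \<nu> \<pi> < \<infinity>"
  obtains p where "admissible p" "\<pi> = density R p"
proof -
  have "Ent \<pi> R < \<infinity>"
  proof (rule ccontr)
    assume "\<not> ?thesis"
    then have "J_eps \<epsilon> \<mu> \<nu> \<pi> = \<infinity>" using \<epsilon> by (simp add: J_eps_def)
    then show False using fin by simp
  qed
  then obtain p where p: "plan_density p" "\<pi> = density R p" "integrable R (\<lambda>z. p z * ln (p z))"
    using finite_Ent_imp_density[OF \<pi>] by blast
  have "integrable R (\<lambda>z. \<bar>snd z - fst z\<bar> * p z)"
  proof (rule ccontr)
    assume "\<not> ?thesis"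
    then have "J_eps \<epsilon> \<mu> \<nu> \<pi> = \<infinity>"
      using p by (simp add: J_eps_def Ent_density transport_cost_density)
    then show False using fin by simp
  qed
  then show ?thesis using that p by (auto simp: admissible_def)
qed

section \<open>Convexity of cost and entropy\<close>

definition midpoint :: "(real \<times> real \<Rightarrow> real) \<Rightarrow> (real \<times> real \<Rightarrow> real) \<Rightarrow> real \<times> real \<Rightarrow> real" where
  "midpoint p q z = (p z + q z) / 2"

abbreviation gap :: "(real \<times> real \<Rightarrow> real) \<Rightarrow> (real \<times> real \<Rightarrow> real) \<Rightarrow> real" where
  "gap p q \<equiv> entropy p + entropy q - 2 * entropy (midpoint p q)"

lemma midpoint:
  assumes p: "admissible p" and q: "admissible q"
  shows "admissible (midpoint p q)" "cost (midpoint p q) = (cost p + cost q) / 2"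
    "gap p q = (\<integral>z. entropy_gap (p z) (q z) \<partial>R)" "integrable R (\<lambda>z. entropy_gap (p z) (q z))"
proof -
  note P = admissibleD[OF p] and Q = admissibleD[OF q]
  note nonneg = plan_density_nonneg[OF P(1)] plan_density_nonneg[OF Q(1)]
  note int = plan_density_integrable(1)[OF P(1)] plan_density_integrable(1)[OF Q(1)]
  note [measurable] = plan_densityD[OF P(1)] plan_densityD[OF Q(1)]
  let ?m = "midpoint p q"
  have [measurable]: "?m \<in> borel_measurable R" unfolding midpoint_def[abs_def] by measurable
  have indU: "integrable R (\<lambda>z. f z * indicator U (g z))" 
    if "integrable R f" "U \<in> sets borel" "g \<in> borel_measurable R" for f :: "_ \<Rightarrow> real" and U :: "real set" and g
  proof -
    note [measurable] = that(2,3)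
    show ?thesis
    by (rule Bochner_Integration.integrable_bound[OF that(1)]; use that in \<open>auto split: split_indicator\<close>)
  qed
  have m: "plan_density ?m"
  proof (rule plan_densityI)
    show "integrable R ?m" using int unfolding midpoint_def[abs_def] by auto
    fix U :: "real set" assume U [measurable]: "U \<in> sets borel"
    show "(\<integral>z. ?m z * indicator U (fst z) \<partial>R) = measure \<mu> U"
      "(\<integral>z. ?m z * indicator U (snd z) \<partial>R) = measure \<nu> U"
      using plan_density_marginals[OF P(1) U] plan_density_marginals[OF Q(1) U]
        indU[OF int(1) U] indU[OF int(2) U]
      by (simp_all add: midpoint_def add_divide_distrib distrib_right)
  qed (use nonneg in \<open>auto simp: midpoint_def\<close>)
  \<comment> \<open>The entropy integrand of the midpoint is bounded above by convexity and below by
    \<open>- 1\<close>.\<close>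
  have intm: "integrable R (\<lambda>z. ?m z * ln (?m z))"
  proof (rule Bochner_Integration.integrable_bound)
    show "integrable R (\<lambda>z. \<bar>p z * ln (p z)\<bar> + \<bar>q z * ln (q z)\<bar> + 1)"
      using P Q by auto
    show "AE z in R. norm (?m z * ln (?m z)) \<le> norm (\<bar>p z * ln (p z)\<bar> + \<bar>q z * ln (q z)\<bar> + 1)"
    proof (rule AE_I2)
      fix z
      have "0 \<le> entropy_gap (p z) (q z)" by (rule entropy_gap_nonneg) (use nonneg in auto)
      then show "norm (?m z * ln (?m z)) \<le> norm (\<bar>p z * ln (p z)\<bar> + \<bar>q z * ln (q z)\<bar> + 1)"
        using mult_ln_self_ge[OF plan_density_nonneg[OF m], of z]
        unfolding entropy_gap_def midpoint_def by (auto simp: abs_if)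
    qed
  qed measurable
  have c: "(\<lambda>z. \<bar>snd z - fst z\<bar> * ?m z) = (\<lambda>z. (\<bar>snd z - fst z\<bar> * p z + \<bar>snd z - fst z\<bar> * q z) / 2)"
    by (simp add: midpoint_def algebra_simps)
  have "integrable R (\<lambda>z. \<bar>snd z - fst z\<bar> * ?m z)"
    unfolding c using P Q by auto
  then show "admissible ?m" using m intm by (simp add: admissible_def)
  show "cost ?m = (cost p + cost q) / 2"
    unfolding c using P Q by simp
  have e: "(\<lambda>z. entropy_gap (p z) (q z)) = (\<lambda>z. p z * ln (p z) + q z * ln (q z) - 2 * (?m z * ln (?m z)))"
    by (simp add: entropy_gap_def midpoint_def fun_eq_iff)
  show "integrable R (\<lambda>z. entropy_gap (p z) (q z))" 
    unfolding e using P Q intm by (intro Bochner_Integration.integrable_diff Bochner_Integration.integrable_add) auto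
  show "gap p q = (\<integral>z. entropy_gap (p z) (q z) \<partial>R)"
    unfolding e using P Q intm by simp
qed

text \<open>The pointwise bound integrates to this because two plans together have mass
  \<open>2 * mass\<close>.\<close>

lemma L1_dist_le_gap:
  assumes p: "admissible p" and q: "admissible q" and \<delta>: "\<delta> > 0"
  shows "(\<integral>z. \<bar>p z - q z\<bar> \<partial>R) \<le> gap p q / \<delta> + \<delta> * (2 * mass)"
proof -
  note P = admissibleD[OF p] and Q = admissibleD[OF q]
  note int = plan_density_integrable[OF P(1)] plan_density_integrable[OF Q(1)]
  have "(\<integral>z. \<bar>p z - q z\<bar> \<partial>R) \<le> (\<integral>z. entropy_gap (p z) (q z) / \<delta> + \<delta> * (p z + q z) \<partial>R)"
  proof (rule integral_mono)
    show "integrable R (\<lambda>z. entropy_gap (p z) (q z) / \<delta> + \<delta> * (p z + q z))"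
      using int midpoint(4)[OF p q] by auto
    show "\<bar>p z - q z\<bar> \<le> entropy_gap (p z) (q z) / \<delta> + \<delta> * (p z + q z)" for z
      by (rule abs_diff_le_entropy_gap) (use \<delta> plan_density_nonneg P Q in auto)
  qed (use int in auto)
  also have "\<dots> = gap p q / \<delta> + \<delta> * (2 * mass)"
    using int midpoint(3,4)[OF p q] by simp
  finally show ?thesis .
qed

text \<open>Used twice: for a minimizing sequence at fixed \<epsilon>, and for the minimizers along
  a sequence of \<epsilon> tending to 0.\<close>

lemma gap_Cauchy_imp_convergent:
  assumes adm: "\<And>n. admissible (p n)"
    and gap: "\<And>e. e > 0 \<Longrightarrow> \<exists>N. \<forall>i\<ge>N. \<forall>j\<ge>N. gap (p i) (p j) < e"
  obtains q r where "plan_density q" "strict_mono (r :: nat \<Rightarrow> nat)"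
    "AE z in R. (\<lambda>n. p (r n) z) \<longlonglongrightarrow> q z"
    "(\<lambda>n. \<integral>z. \<bar>p n z - q z\<bar> \<partial>R) \<longlonglongrightarrow> 0"
proof -
  have pd: "plan_density (p n)" for n using adm admissibleD(1) by blast
  note int = plan_density_integrable(1)[OF pd]
  note [measurable] = plan_densityD[OF pd]
  have cau: "\<exists>N. \<forall>i\<ge>N. \<forall>j\<ge>N. (\<integral>z. \<bar>p i z - p j z\<bar> \<partial>R) < e" if e: "e > 0" for e
  proof -
    \<comment> \<open>Half of \<open>e\<close> is reserved for the mass term; the summand 1 keeps
      the denominator positive.\<close>
    define \<delta> where "\<delta> = e / (4 * (mass + 1))"
    have m: "mass + 1 > 0" by (smt (verit) measure_nonneg)
    then have \<delta>: "\<delta> > 0" using e by (simp add: \<delta>_def)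
    obtain N where N: "\<forall>i\<ge>N. \<forall>j\<ge>N. gap (p i) (p j) < e / 2 * \<delta>"
      using gap[of "e / 2 * \<delta>"] e \<delta> by auto
    have "(\<integral>z. \<bar>p i z - p j z\<bar> \<partial>R) < e" if "i \<ge> N" "j \<ge> N" for i j
    proof -
      have "gap (p i) (p j) / \<delta> < e / 2"
        using N that \<delta> by (simp add: pos_divide_less_eq)
      moreover have "\<delta> * (2 * mass) \<le> \<delta> * (2 * (mass + 1))"
        using \<delta> by (intro mult_left_mono) auto
      moreover have "\<delta> * (2 * (mass + 1)) = e / 2"
        using m by (simp add: \<delta>_def divide_simps)
      ultimately show ?thesis
        using L1_dist_le_gap[OF adm adm \<delta>, of i j] by linarith
    qed
    then show ?thesis by blast
  qed
  obtain g r where g: "integrable R g" and r: "strict_mono (r :: nat \<Rightarrow> nat)"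
    and lim: "AE z in R. (\<lambda>n. p (r n) z) \<longlonglongrightarrow> g z"
    and L1: "(\<lambda>n. \<integral>z. \<bar>p n z - g z\<bar> \<partial>R) \<longlonglongrightarrow> 0"
    by (rule L1_Cauchy_imp_convergent[OF int cau])
  note [measurable] = borel_measurable_integrable[OF g]
  \<comment> \<open>The limit is nonnegative almost everywhere; the modification makes it so at
    every point.\<close>
  define q where "q z = max (g z) 0" for z
  have gq: "AE z in R. g z = q z"
    using lim
  proof eventually_elim
    case (elim z)
    then have "0 \<le> g z"
      by (rule LIMSEQ_le_const) (use plan_density_nonneg[OF pd] in auto)
    then show ?case by (simp add: q_def)
  qed
  have [measurable]: "q \<in> borel_measurable R" unfolding q_def[abs_def] by measurable
  have intq: "integrable R q"
    using integrable_cong_AE[of g R q] gq g by simp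
  have L1q: "(\<integral>z. \<bar>p n z - g z\<bar> \<partial>R) = (\<integral>z. \<bar>p n z - q z\<bar> \<partial>R)" for n
    by (rule integral_cong_AE) (use gq in \<open>auto elim!: eventually_mono\<close>)
  \<comment> \<open>Testing with an indicator is continuous for the distance in mean, so each
    marginal value, constant along the sequence, survives.\<close>
  have marg: "(\<integral>z. q z * indicator U (f z) \<partial>R) = c"
    if [measurable]: "U \<in> sets borel" "f \<in> borel_measurable R"
      and c: "\<And>n. (\<integral>z. p n z * indicator U (f z) \<partial>R) = c"
    for U :: "real set" and f c
  proof -
    have indU: "integrable R (\<lambda>z. h z * indicator U (f z))" if "integrable R h" for h :: "_ \<Rightarrow> real"
      by (rule Bochner_Integration.integrable_bound[OF that]; use that in \<open>auto split: split_indicator\<close>)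
    have "\<bar>c - (\<integral>z. q z * indicator U (f z) \<partial>R)\<bar> \<le> (\<integral>z. \<bar>p n z - q z\<bar> \<partial>R)" for n
    proof -
      have "c - (\<integral>z. q z * indicator U (f z) \<partial>R) = (\<integral>z. (p n z - q z) * indicator U (f z) \<partial>R)"
        using indU[OF intq] indU[OF int] c[of n] by (simp add: left_diff_distrib)
      also have "\<bar>\<dots>\<bar> \<le> (\<integral>z. \<bar>(p n z - q z) * indicator U (f z)\<bar> \<partial>R)"
        by (rule integral_abs_bound)
      also have "\<dots> \<le> (\<integral>z. \<bar>p n z - q z\<bar> \<partial>R)"
      proof (rule integral_mono)
        show "integrable R (\<lambda>z. \<bar>(p n z - q z) * indicator U (f z)\<bar>)"
          by (intro integrable_abs indU Bochner_Integration.integrable_diff int intq)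
        show "integrable R (\<lambda>z. \<bar>p n z - q z\<bar>)"
          by (intro integrable_abs Bochner_Integration.integrable_diff int intq)
      qed (simp split: split_indicator)
      finally show ?thesis .
    qed
    moreover have "(\<lambda>n. \<integral>z. \<bar>p n z - q z\<bar> \<partial>R) \<longlonglongrightarrow> 0"
      using L1 L1q by simp
    ultimately have "\<bar>c - (\<integral>z. q z * indicator U (f z) \<partial>R)\<bar> \<le> 0"
      using LIMSEQ_le_const by blast
    then show ?thesis by simp
  qed
  have "plan_density q"
  proof (rule plan_densityI)
    fix U :: "real set" assume [measurable]: "U \<in> sets borel"
    show "(\<integral>z. q z * indicator U (fst z) \<partial>R) = measure \<mu> U"
      by (rule marg) (auto simp: plan_density_marginals[OF pd])
    show "(\<integral>z. q z * indicator U (snd z) \<partial>R) = measure \<nu> U"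
      by (rule marg) (auto simp: plan_density_marginals[OF pd])
  qed (use intq in \<open>auto simp: q_def\<close>)
  moreover have "AE z in R. (\<lambda>n. p (r n) z) \<longlonglongrightarrow> q z"
    using lim gq by eventually_elim simp
  ultimately show ?thesis using that r L1 L1q by simp
qed

end

section \<open>Optimal plans for the cost of distance\<close>

text \<open>The distance of two points is the length of the set of levels between them. Exchanging
  the order of integration collects, level by level, the mass that crosses upwards and
  downwards.\<close>

lemma transport_cost_eq_crossings:
  assumes sets: "sets \<pi> = sets borel" and fin: "finite_measure \<pi>"
  shows "transport_cost \<pi> =
    (\<integral>\<^sup>+t. emeasure \<pi> {z. fst z \<le> t \<and> t < snd z} + emeasure \<pi> {z. snd z \<le> t \<and> t < fst z} \<partial>lborel)"
proof -
  interpret finite_measure \<pi> by fact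
  interpret P: pair_sigma_finite \<pi> lborel ..
  have sp: "space \<pi> = UNIV" using sets_eq_imp_space_eq[OF sets] by simp
  note [measurable] = sets_borel_fst_snd[OF sets]
  let ?f = "\<lambda>z t. indicator {fst z..<snd z} t + indicator {snd z..<fst z} t :: ennreal"
  have abs: "ennreal \<bar>snd z - fst z\<bar> = (\<integral>\<^sup>+t. ?f z t \<partial>lborel)" for z :: "real \<times> real"
  proof -
    have "(\<integral>\<^sup>+t. ?f z t \<partial>lborel) = emeasure lborel {fst z..<snd z} + emeasure lborel {snd z..<fst z}"
      by (subst nn_integral_add) auto
    then show ?thesis by (cases "fst z \<le> snd z") (auto simp: emeasure_lborel_Ico)
  qed
  have "transport_cost \<pi> = (\<integral>\<^sup>+z. (\<integral>\<^sup>+t. ?f z t \<partial>lborel) \<partial>\<pi>)"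
    unfolding transport_cost_def split_beta abs ..
  also have "\<dots> = (\<integral>\<^sup>+t. (\<integral>\<^sup>+z. ?f z t \<partial>\<pi>) \<partial>lborel)"
  proof (rule P.Fubini'[symmetric])
    have "(\<lambda>(z, t). indicator {w. fst (fst w) \<le> snd w \<and> snd w < snd (fst w)} (z, t) +
        indicator {w. snd (fst w) \<le> snd w \<and> snd w < fst (fst w)} (z, t) :: ennreal)
      \<in> borel_measurable (\<pi> \<Otimes>\<^sub>M lborel)"
    proof -
      have "{w \<in> space (\<pi> \<Otimes>\<^sub>M lborel). fst (fst w) \<le> snd w \<and> snd w < snd (fst w)} \<in> sets (\<pi> \<Otimes>\<^sub>M lborel)"
        "{w \<in> space (\<pi> \<Otimes>\<^sub>M lborel). snd (fst w) \<le> snd w \<and> snd w < fst (fst w)} \<in> sets (\<pi> \<Otimes>\<^sub>M lborel)"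
        by measurable
      then have [measurable]: "{w. fst (fst w) \<le> snd w \<and> snd w < snd (fst w)} \<in> sets (\<pi> \<Otimes>\<^sub>M lborel)"
        "{w. snd (fst w) \<le> snd w \<and> snd w < fst (fst w)} \<in> sets (\<pi> \<Otimes>\<^sub>M lborel)"
        by (simp_all add: space_pair_measure sp)
      show ?thesis by measurable
    qed
    also have "(\<lambda>(z, t). indicator {w. fst (fst w) \<le> snd w \<and> snd w < snd (fst w)} (z, t) +
        indicator {w. snd (fst w) \<le> snd w \<and> snd w < fst (fst w)} (z, t) :: ennreal) = (\<lambda>(z, t). ?f z t)"
      by (auto simp: fun_eq_iff indicator_def)
    finally show "(\<lambda>(z, t). ?f z t) \<in> borel_measurable (\<pi> \<Otimes>\<^sub>M lborel)" .
  qed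
  also have "(\<lambda>t. (\<integral>\<^sup>+z. ?f z t \<partial>\<pi>)) =
    (\<lambda>t. emeasure \<pi> {z. fst z \<le> t \<and> t < snd z} + emeasure \<pi> {z. snd z \<le> t \<and> t < fst z})"
  proof
    fix t
    have "{z \<in> space \<pi>. fst z \<le> t \<and> t < snd z} \<in> sets \<pi>" "{z \<in> space \<pi>. snd z \<le> t \<and> t < fst z} \<in> sets \<pi>"
      by measurable
    then have m: "{z. fst z \<le> t \<and> t < snd z} \<in> sets \<pi>" "{z. snd z \<le> t \<and> t < fst z} \<in> sets \<pi>"
      by (simp_all add: sp)
    have "(\<integral>\<^sup>+z. ?f z t \<partial>\<pi>) = (\<integral>\<^sup>+z. indicator {z. fst z \<le> t \<and> t < snd z} z +
        indicator {z. snd z \<le> t \<and> t < fst z} z \<partial>\<pi>)"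
      by (rule nn_integral_cong) (auto simp: indicator_def)
    then show "(\<integral>\<^sup>+z. ?f z t \<partial>\<pi>) =
      emeasure \<pi> {z. fst z \<le> t \<and> t < snd z} + emeasure \<pi> {z. snd z \<le> t \<and> t < fst z}"
      using m by (simp add: nn_integral_add)
  qed
  finally show ?thesis .
qed

text \<open>This is the distribution function of the larger coordinate, which is where its one-sided
  limits come from. Together with the marginals it determines the crossing masses in both
  directions.\<close>

definition inner_cdf :: "(real \<times> real) measure \<Rightarrow> real \<Rightarrow> real" where
  "inner_cdf \<pi> t = measure \<pi> {z. fst z \<le> t \<and> snd z \<le> t}"

lemma borel_pred_sets:
  fixes \<pi> :: "(real \<times> real) measure"
  assumes "sets \<pi> = sets borel" "{z \<in> space (borel \<Otimes>\<^sub>M borel). P z} \<in> sets (borel \<Otimes>\<^sub>M borel)"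
  shows "{z. P z} \<in> sets \<pi>"
  using assms sets_borel_pair by (simp add: space_pair_measure)

lemma halfplane_sets:
  fixes \<pi> :: "(real \<times> real) measure"
  assumes "sets \<pi> = sets borel"
  shows "{z. fst z \<le> t} \<in> sets \<pi>" "{z. snd z \<le> t} \<in> sets \<pi>" "{z. fst z < t} \<in> sets \<pi>" "{z. snd z < t} \<in> sets \<pi>"
    "{z. fst z > t} \<in> sets \<pi>" "{z. snd z > t} \<in> sets \<pi>" "{z. fst z \<ge> t} \<in> sets \<pi>" "{z. snd z \<ge> t} \<in> sets \<pi>"
  by (rule borel_pred_sets[OF assms]; measurable)+

text \<open>A positive value would persist on an interval to the right. Equality of costs controls
  the crossings only at almost every level; this extends it to every level.\<close>

lemma right_continuous_nonneg_AE_zero: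
  fixes \<phi> :: "real \<Rightarrow> real"
  assumes nonneg: "\<And>t. 0 \<le> \<phi> t" and AE: "AE t in lborel. \<phi> t = 0"
    and cont: "(\<phi> \<longlongrightarrow> \<phi> t) (at_right t)"
  shows "\<phi> t = 0"
proof (rule ccontr)
  assume "\<phi> t \<noteq> 0"
  then have "0 < \<phi> t" using nonneg[of t] by simp
  then have "\<forall>\<^sub>F s in at_right t. 0 < \<phi> s"
    using cont by (rule order_tendstoD(1)[rotated])
  then obtain b where b: "b > t" "\<And>s. t < s \<Longrightarrow> s < b \<Longrightarrow> 0 < \<phi> s"
    by (auto simp: eventually_at_right_field)
  have "AE s in lborel. s \<notin> {t<..<b}"
    using AE by eventually_elim (use b(2) in force)
  then have "emeasure lborel {t<..<b} = 0"
    by (subst (asm) AE_iff_measurable[of "{t<..<b}"]) auto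
  then show False using b(1) by simp
qed

section \<open>Level crossings and plans of minimal cost\<close>

context finite_borel_pair
begin

text \<open>The known formula for the transport distance on the line in terms of the distribution
  functions. It is a lower bound for the cost of all plans and the exact cost of optimal
  ones.\<close>

definition min_cost :: ennreal where
  "min_cost = (\<integral>\<^sup>+t. ennreal \<bar>cdf \<mu> t - cdf \<nu> t\<bar> \<partial>lborel)"

text \<open>A plan has minimal cost iff at no level \<open>t\<close> mass crosses \<open>t\<close> in both directions, that is, iff as much mass as
  possible stays below \<open>t\<close>.\<close>

definition optimal :: "(real \<times> real) measure \<Rightarrow> bool" where
  "optimal \<pi> \<longleftrightarrow> \<pi> \<in> Marg \<mu> \<nu> \<and> (\<forall>t. inner_cdf \<pi> t = min (cdf \<mu> t) (cdf \<nu> t))"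

lemma crossing_measures:
  assumes \<pi>: "\<pi> \<in> Marg \<mu> \<nu>"
  shows "measure \<pi> {z. fst z \<le> t \<and> t < snd z} = cdf \<mu> t - inner_cdf \<pi> t"
    "measure \<pi> {z. snd z \<le> t \<and> t < fst z} = cdf \<nu> t - inner_cdf \<pi> t"
proof -
  interpret finite_measure \<pi> using MargD(3)[OF \<pi>] .
  note [measurable] = halfplane_sets[OF MargD(1)[OF \<pi>]]
  have s: "{z. fst z \<le> t \<and> t < snd z} = {z. fst z \<le> t} \<inter> {z. snd z > t}"
    "{z. snd z \<le> t \<and> t < fst z} = {z. snd z \<le> t} \<inter> {z. fst z > t}"
    "{z. fst z \<le> t \<and> snd z \<le> t} = {z. fst z \<le> t} \<inter> {z. snd z \<le> t}" by auto
  have "cdf \<mu> t = measure \<pi> {z. fst z \<le> t}" "cdf \<nu> t = measure \<pi> {z. snd z \<le> t}"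
    using MargD(4,5)[OF \<pi>, of "{..t}"] by (auto simp: cdf_def measure_def)
  moreover have "measure \<pi> {z. fst z \<le> t} = measure \<pi> ({z. fst z \<le> t} \<inter> {z. snd z > t} \<union> {z. fst z \<le> t} \<inter> {z. snd z \<le> t})"
    by (rule arg_cong[where f="measure \<pi>"]) auto
  moreover have "\<dots> = measure \<pi> ({z. fst z \<le> t} \<inter> {z. snd z > t}) + measure \<pi> ({z. fst z \<le> t} \<inter> {z. snd z \<le> t})"
    by (rule finite_measure_Union) auto
  moreover have "measure \<pi> {z. snd z \<le> t} = measure \<pi> ({z. snd z \<le> t} \<inter> {z. fst z > t} \<union> {z. fst z \<le> t} \<inter> {z. snd z \<le> t})"
    by (rule arg_cong[where f="measure \<pi>"]) auto
  moreover have "\<dots> = measure \<pi> ({z. snd z \<le> t} \<inter> {z. fst z > t}) + measure \<pi> ({z. fst z \<le> t} \<inter> {z. snd z \<le> t})"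
    by (rule finite_measure_Union) auto
  ultimately show "measure \<pi> {z. fst z \<le> t \<and> t < snd z} = cdf \<mu> t - inner_cdf \<pi> t"
    "measure \<pi> {z. snd z \<le> t \<and> t < fst z} = cdf \<nu> t - inner_cdf \<pi> t"
    unfolding inner_cdf_def s by linarith+
qed

lemma inner_cdf_le:
  assumes \<pi>: "\<pi> \<in> Marg \<mu> \<nu>"
  shows "inner_cdf \<pi> t \<le> min (cdf \<mu> t) (cdf \<nu> t)"
  using crossing_measures[OF \<pi>, of t]
    measure_nonneg[of \<pi> "{z. fst z \<le> t \<and> t < snd z}"] measure_nonneg[of \<pi> "{z. snd z \<le> t \<and> t < fst z}"]
  by linarith

lemma inner_cdf_limits:
  assumes \<pi>: "\<pi> \<in> Marg \<mu> \<nu>"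
  shows "(inner_cdf \<pi> \<longlongrightarrow> inner_cdf \<pi> t) (at_right t)"
    "(inner_cdf \<pi> \<longlongrightarrow> measure \<pi> ({z. fst z < t} \<inter> {z. snd z < t})) (at_left t)"
proof -
  note [measurable] = sets_borel_fst_snd[OF MargD(1)[OF \<pi>]]
  interpret finite_measure \<pi> using MargD(3)[OF \<pi>] .
  let ?N = "distr \<pi> borel (\<lambda>z. max (fst z) (snd z))"
  interpret N': finite_borel_measure ?N
    by (intro finite_borel_measure.intro finite_measure_distr finite_borel_measure_axioms.intro) auto
  have "cdf ?N s = inner_cdf \<pi> s" for s
    unfolding cdf_def inner_cdf_def
    by (subst measure_distr) (auto simp: MargD(2)[OF \<pi>] intro!: arg_cong[where f="measure \<pi>"])
  then have eq: "cdf ?N = inner_cdf \<pi>" by auto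
  show "(inner_cdf \<pi> \<longlongrightarrow> inner_cdf \<pi> t) (at_right t)"
    using N'.cdf_is_right_cont[of t] by (simp add: continuous_within eq)
  have "measure ?N {..<t} = measure \<pi> ({z. fst z < t} \<inter> {z. snd z < t})"
    by (subst measure_distr) (auto simp: MargD(2)[OF \<pi>] intro!: arg_cong[where f="measure \<pi>"])
  then show "(inner_cdf \<pi> \<longlongrightarrow> measure \<pi> ({z. fst z < t} \<inter> {z. snd z < t})) (at_left t)"
    using N'.cdf_at_left[of t] by (simp add: eq)
qed

lemma transport_cost_eq:
  assumes \<pi>: "\<pi> \<in> Marg \<mu> \<nu>"
  shows "transport_cost \<pi> = (\<integral>\<^sup>+t. ennreal (cdf \<mu> t + cdf \<nu> t - 2 * inner_cdf \<pi> t) \<partial>lborel)"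
proof -
  interpret finite_measure \<pi> using MargD(3)[OF \<pi>] .
  show ?thesis
    unfolding transport_cost_eq_crossings[OF MargD(1,3)[OF \<pi>]] emeasure_eq_measure crossing_measures[OF \<pi>]
    using inner_cdf_le[OF \<pi>] by (auto intro!: nn_integral_cong simp flip: ennreal_plus)
qed

lemma abs_cdf_diff: "\<bar>cdf \<mu> t - cdf \<nu> t\<bar> = cdf \<mu> t + cdf \<nu> t - 2 * min (cdf \<mu> t) (cdf \<nu> t)"
  by (auto simp: min_def)

lemma min_cost_le: "\<pi> \<in> Marg \<mu> \<nu> \<Longrightarrow> min_cost \<le> transport_cost \<pi>"
  unfolding transport_cost_eq min_cost_def abs_cdf_diff
  by (intro nn_integral_mono ennreal_leI) (use inner_cdf_le in force)

lemma optimal_cost: "optimal \<pi> \<Longrightarrow> transport_cost \<pi> = min_cost"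
  unfolding optimal_def by (auto simp: transport_cost_eq min_cost_def abs_cdf_diff)

lemma cdf_borel_measurable [measurable]: "cdf \<mu> \<in> borel_measurable borel" "cdf \<nu> \<in> borel_measurable borel"
  by (auto intro!: borel_measurable_mono simp: mono_def M.cdf_nondecreasing N.cdf_nondecreasing)

text \<open>The cost integrand dominates that of \<open>min_cost\<close> at each level, so equality
  of the finite integrals forces equality at almost every level, and right continuity then at every
  level.\<close>

lemma min_cost_imp_optimal:
  assumes \<pi>: "\<pi> \<in> Marg \<mu> \<nu>" and le: "transport_cost \<pi> \<le> min_cost" and fin: "min_cost < \<infinity>"
  shows "optimal \<pi>"
proof -
  interpret finite_measure \<pi> using MargD(3)[OF \<pi>] .
  have [measurable]: "inner_cdf \<pi> \<in> borel_measurable borel"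
    unfolding inner_cdf_def
    by (intro borel_measurable_mono monoI finite_measure_mono borel_pred_sets[OF MargD(1)[OF \<pi>]]) (auto, measurable)
  let ?f = "\<lambda>t. ennreal (cdf \<mu> t + cdf \<nu> t - 2 * inner_cdf \<pi> t)"
  let ?g = "\<lambda>t. ennreal \<bar>cdf \<mu> t - cdf \<nu> t\<bar>"
  have "(\<integral>\<^sup>+t. ?f t - ?g t \<partial>lborel) = (\<integral>\<^sup>+t. ?f t \<partial>lborel) - (\<integral>\<^sup>+t. ?g t \<partial>lborel)"
  proof (rule nn_integral_diff)
    show "(\<integral>\<^sup>+t. ?g t \<partial>lborel) \<noteq> \<infinity>" using fin by (auto simp: min_cost_def)
    show "AE t in lborel. ?g t \<le> ?f t"
      unfolding abs_cdf_diff using inner_cdf_le[OF \<pi>] by (intro AE_I2 ennreal_leI) force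
  qed auto
  also have "\<dots> = 0"
    using le transport_cost_eq[OF \<pi>] min_cost_def fin by (simp add: diff_eq_0_iff_ennreal)
  finally have "AE t in lborel. ?f t - ?g t = 0"
    by (subst (asm) nn_integral_0_iff_AE) auto
  then have AE: "AE t in lborel. min (cdf \<mu> t) (cdf \<nu> t) - inner_cdf \<pi> t = 0"
  proof eventually_elim
    case (elim t)
    then have "?f t \<le> ?g t"
      by (simp add: diff_eq_0_iff_ennreal)
    then have "cdf \<mu> t + cdf \<nu> t - 2 * inner_cdf \<pi> t \<le> \<bar>cdf \<mu> t - cdf \<nu> t\<bar>"
      by (simp add: ennreal_le_iff)
    then show ?case using inner_cdf_le[OF \<pi>, of t] unfolding abs_cdf_diff by linarith
  qed
  have "min (cdf \<mu> t) (cdf \<nu> t) - inner_cdf \<pi> t = 0" for t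
  proof (rule right_continuous_nonneg_AE_zero[OF _ AE])
    show "((\<lambda>t. min (cdf \<mu> t) (cdf \<nu> t) - inner_cdf \<pi> t) \<longlongrightarrow> min (cdf \<mu> t) (cdf \<nu> t) - inner_cdf \<pi> t) (at_right t)"
      using M.cdf_is_right_cont[of t] N.cdf_is_right_cont[of t] inner_cdf_limits(1)[OF \<pi>, of t]
      by (intro tendsto_diff tendsto_min) (auto simp: continuous_within)
  qed (use inner_cdf_le[OF \<pi>] in auto)
  then show ?thesis using \<pi> by (simp add: optimal_def)
qed

text \<open>If mass crosses a level in both directions, the cyclically monotone set contains a point
  of each crossing, and exchanging their targets shortens the total way.\<close>

lemma cm_plan_optimal:
  assumes "\<pi> \<in> cm_plans \<mu> \<nu>"
  shows "optimal \<pi>"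
proof -
  from assms obtain \<Gamma> where \<pi>: "\<pi> \<in> Marg \<mu> \<nu>" and \<Gamma>: "cyclically_monotone \<Gamma>" and AE: "AE z in \<pi>. z \<in> \<Gamma>"
    by (auto simp: cm_plans_def)
  interpret finite_measure \<pi> using MargD(3)[OF \<pi>] .
  have meet: "\<exists>z\<in>A. z \<in> \<Gamma>" if "measure \<pi> A > 0" for A
  proof (rule ccontr)
    assume "\<not> ?thesis"
    with AE have "AE z in \<pi>. z \<notin> A" by (auto elim: eventually_mono)
    moreover have "A \<in> sets \<pi>" using that measure_notin_sets by force
    ultimately have "emeasure \<pi> A = 0"
      by (subst (asm) AE_iff_measurable) (auto dest: sets.sets_into_space)
    then show False using that by (simp add: measure_def)
  qed
  have "inner_cdf \<pi> t = min (cdf \<mu> t) (cdf \<nu> t)" for t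
  proof (rule ccontr)
    assume "inner_cdf \<pi> t \<noteq> min (cdf \<mu> t) (cdf \<nu> t)"
    then have "measure \<pi> {z. fst z \<le> t \<and> t < snd z} > 0" "measure \<pi> {z. snd z \<le> t \<and> t < fst z} > 0"
      using inner_cdf_le[OF \<pi>, of t] unfolding crossing_measures[OF \<pi>] by linarith+
    then obtain z w where z: "fst z \<le> t" "t < snd z" "z \<in> \<Gamma>" and w: "snd w \<le> t" "t < fst w" "w \<in> \<Gamma>"
      using meet by (metis (mono_tags, lifting) mem_Collect_eq)
    \<comment> \<open>The cycle of length 2 through \<open>z\<close> and \<open>w\<close>; the index
      \<open>(i + 1) mod 2\<close> exchanges the targets.\<close>
    have "(\<Sum>i<2. \<bar>(if i = (0::nat) then snd z else snd w) - (if i = 0 then fst z else fst w)\<bar>)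
      \<le> (\<Sum>i<2. \<bar>(if (i + 1) mod 2 = 0 then snd z else snd w) - (if i = (0::nat) then fst z else fst w)\<bar>)"
      using \<Gamma>[unfolded cyclically_monotone_def, rule_format, of 2 "\<lambda>i. if i = 0 then fst z else fst w" "\<lambda>i. if i = 0 then snd z else snd w"]
        z w by auto
    then show False using z w by (simp add: numeral_2_eq_2)
  qed
  then show ?thesis using \<pi> by (simp add: optimal_def)
qed

end

section \<open>Entropic minimizers and their limit\<close>

lemma tendsto_mult_ln_self:
  fixes x :: "nat \<Rightarrow> real"
  assumes "x \<longlonglongrightarrow> l" "\<And>n. x n \<ge> 0"
  shows "(\<lambda>n. x n * ln (x n)) \<longlonglongrightarrow> l * ln l"
proof (rule continuous_on_tendsto_compose[OF continuous_mult_ln_self assms(1)])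
  show "l \<in> {0..}" using LIMSEQ_le_const[OF assms(1), of 0] assms(2) by auto
qed (use assms(2) in auto)

context finite_borel_pair
begin

definition objective :: "real \<Rightarrow> (real \<times> real \<Rightarrow> real) \<Rightarrow> real" where
  "objective \<epsilon> p = cost p + \<epsilon> * entropy p"

definition minimizes :: "real \<Rightarrow> (real \<times> real \<Rightarrow> real) \<Rightarrow> bool" where
  "minimizes \<epsilon> q \<longleftrightarrow> admissible q \<and> (\<forall>p. admissible p \<longrightarrow> objective \<epsilon> q \<le> objective \<epsilon> p)"

lemma objective_midpoint:
  assumes "admissible p" "admissible q"
  shows "2 * objective \<epsilon> (midpoint p q) = objective \<epsilon> p + objective \<epsilon> q - \<epsilon> * gap p q"
  using midpoint(2)[OF assms] by (simp add: objective_def algebra_simps)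

text \<open>Since the cost is affine, the midpoint of two almost minimizing densities would beat the
  infimum if their gap were large. A minimizing sequence is therefore Cauchy, and Fatou's lemma
  gives lower semicontinuity.\<close>

lemma minimizer_exists:
  assumes p0: "admissible p0" and \<epsilon>: "\<epsilon> > 0"
  obtains q where "minimizes \<epsilon> q"
proof -
  let ?S = "objective \<epsilon> ` Collect admissible"
  define v where "v = Inf ?S"
  have "- \<epsilon> * measure R UNIV \<le> objective \<epsilon> p" if "admissible p" for p
  proof -
    have "\<epsilon> * (- measure R UNIV) \<le> \<epsilon> * entropy p"
      using entropy_ge[OF admissibleD(1,2)[OF that]] \<epsilon> by (intro mult_left_mono) auto
    then show ?thesis using cost_nonneg[OF admissibleD(1)[OF that]] by (simp add: objective_def)
  qed
  then have bdd: "bdd_below ?S" by (intro bdd_belowI2) auto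
  have vle: "v \<le> objective \<epsilon> p" if "admissible p" for p
    unfolding v_def by (rule cInf_lower) (use that bdd in auto)
  have "\<exists>p. admissible p \<and> objective \<epsilon> p < v + 1 / Suc n" for n
    using cInf_lessD[of ?S "v + 1 / Suc n"] p0 by (auto simp: v_def)
  then obtain p where adm: "\<And>n. admissible (p n)" and lt: "\<And>n. objective \<epsilon> (p n) < v + 1 / Suc n"
    by metis
  have gap_le: "gap (p i) (p j) \<le> (1 / Suc i + 1 / Suc j) / \<epsilon>" for i j
  proof -
    have "v \<le> objective \<epsilon> (midpoint (p i) (p j))" by (rule vle) (rule midpoint(1)[OF adm adm])
    then have "\<epsilon> * gap (p i) (p j) \<le> 1 / Suc i + 1 / Suc j"
      using objective_midpoint[OF adm adm, of \<epsilon> i j] lt[of i] lt[of j] by linarith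
    then show ?thesis using \<epsilon> by (simp add: pos_le_divide_eq mult.commute)
  qed
  have gap_C: "\<exists>N. \<forall>i\<ge>N. \<forall>j\<ge>N. gap (p i) (p j) < e" if "e > 0" for e
  proof -
    have "0 < e * \<epsilon> / 2" using \<epsilon> that by simp
    then obtain N :: nat where N: "1 / Suc N < e * \<epsilon> / 2"
      unfolding inverse_eq_divide[symmetric] using reals_Archimedean by blast
    have "gap (p i) (p j) < e" if "i \<ge> N" "j \<ge> N" for i j
    proof -
      have "1 / Suc i \<le> 1 / Suc N" "1 / Suc j \<le> 1 / Suc N" using that by (auto simp: divide_simps)
      then have "(1 / Suc i + 1 / Suc j) / \<epsilon> < (e * \<epsilon>) / \<epsilon>"
        using N \<epsilon> by (intro divide_strict_right_mono) linarith+
      then show ?thesis using gap_le[of i j] \<epsilon> by simp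
    qed
    then show ?thesis by blast
  qed
  obtain q r where q: "plan_density q" and r: "strict_mono (r :: nat \<Rightarrow> nat)"
    and lim: "AE z in R. (\<lambda>n. p (r n) z) \<longlonglongrightarrow> q z"
    by (rule gap_Cauchy_imp_convergent[OF adm gap_C]) blast
  note [measurable] = plan_densityD[OF q]
  note P = admissibleD[OF adm]
  \<comment> \<open>Cost and entropy are passed to the limit together, since minimality concerns
    only their weighted sum.\<close>
  let ?f = "\<lambda>p z. \<bar>snd z - fst z\<bar> * p z + \<epsilon> * (p z * ln (p z))"
  have intf: "integrable R (?f (p n))" and objf: "(\<integral>z. ?f (p n) z \<partial>R) = objective \<epsilon> (p n)" for n
    using P(2)[of n] P(3)[of n] by (auto simp: objective_def)
  have low: "- \<epsilon> \<le> ?f g z" if "plan_density g" for g z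
  proof -
    have "\<epsilon> * (- 1) \<le> \<epsilon> * (g z * ln (g z))"
      using \<epsilon> mult_ln_self_ge[OF plan_density_nonneg[OF that]] by (intro mult_left_mono) auto
    moreover have "0 \<le> \<bar>snd z - fst z\<bar> * g z"
      using plan_density_nonneg[OF that] by simp
    ultimately show ?thesis by simp
  qed
  have F: "integrable R (?f q)" "(\<integral>z. ?f q z \<partial>R) \<le> v"
  proof -
    have *: "AE z in R. (\<lambda>n. ?f (p (r n)) z) \<longlonglongrightarrow> ?f q z"
      using lim by eventually_elim
        (intro tendsto_intros tendsto_mult_ln_self plan_density_nonneg[OF P(1)])
    have **: "(\<lambda>n. v + 1 / Suc n) \<longlonglongrightarrow> v"
      using LIMSEQ_inverse_real_of_nat_add[of v] by (simp add: inverse_eq_divide)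
    have ***: "(\<integral>z. ?f (p (r n)) z \<partial>R) \<le> v + 1 / Suc n" for n
    proof -
      have "1 / Suc (r n) \<le> 1 / Suc n" using seq_suble[OF r, of n] by (auto simp: divide_simps)
      then show ?thesis using lt[of "r n"] objf[of "r n"] by linarith
    qed
    note F = RF.Fatou_bounded_below[OF intf _ _ * *** **, of \<epsilon>]
    show "integrable R (?f q)" by (rule F(1)) (use low[OF P(1)] in auto)
    show "(\<integral>z. ?f q z \<partial>R) \<le> v" by (rule F(2)) (use low[OF P(1)] in auto)
  qed
  \<comment> \<open>Separate integrability is recovered from the sum: the entropy integrand lies
    between \<open>- 1\<close> and the sum divided by \<open>\<epsilon>\<close>.\<close>
  have intq: "integrable R (\<lambda>z. q z * ln (q z))"
  proof (rule Bochner_Integration.integrable_bound)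
    show "integrable R (\<lambda>z. \<bar>?f q z / \<epsilon>\<bar> + 1)" using F(1) by auto
    show "AE z in R. norm (q z * ln (q z)) \<le> norm (\<bar>?f q z / \<epsilon>\<bar> + 1)"
    proof (rule AE_I2)
      fix z
      have "q z * ln (q z) \<le> ?f q z / \<epsilon>"
        using \<epsilon> plan_density_nonneg[OF q, of z] by (simp add: field_simps)
      moreover have "- 1 \<le> q z * ln (q z)" by (rule mult_ln_self_ge[OF plan_density_nonneg[OF q]])
      ultimately show "norm (q z * ln (q z)) \<le> norm (\<bar>?f q z / \<epsilon>\<bar> + 1)"
        unfolding real_norm_def by linarith
    qed
  qed measurable
  have "integrable R (\<lambda>z. ?f q z - \<epsilon> * (q z * ln (q z)))"
    by (intro Bochner_Integration.integrable_diff F(1)) (use intq in auto)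
  then have intc: "integrable R (\<lambda>z. \<bar>snd z - fst z\<bar> * q z)" by simp
  have "objective \<epsilon> q = (\<integral>z. ?f q z \<partial>R)"
    using intq intc by (simp add: objective_def)
  then have "minimizes \<epsilon> q"
    using F(2) vle q intq intc by (auto simp: minimizes_def admissible_def intro: order_trans)
  then show ?thesis by (rule that)
qed

text \<open>Without a positive gap, the bound on the distance in mean is proportional to
  \<open>\<delta>\<close> and can be made arbitrarily small.\<close>

lemma gap_zero_imp_eq:
  assumes p: "admissible p" and q: "admissible q" and gap: "gap p q \<le> 0"
  shows "density R p = density R q"
proof -
  have int: "integrable R p" "integrable R q"
    using plan_density_integrable(1) admissibleD(1) p q by auto
  have "(\<integral>z. \<bar>p z - q z\<bar> \<partial>R) \<le> 0 + e" if "e > 0" for e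
  proof -
    define \<delta> where "\<delta> = e / (2 * mass + 1)"
    have m: "2 * mass + 1 > 0" using measure_nonneg[of \<mu> UNIV] by linarith
    then have \<delta>: "\<delta> > 0" using that by (simp add: \<delta>_def)
    have "(\<integral>z. \<bar>p z - q z\<bar> \<partial>R) \<le> gap p q / \<delta> + \<delta> * (2 * mass)" by (rule L1_dist_le_gap[OF p q \<delta>])
    also have "gap p q / \<delta> \<le> 0" using gap \<delta> by (simp add: divide_nonpos_pos)
    also have "\<delta> * (2 * mass) \<le> \<delta> * (2 * mass + 1)" using \<delta> by (intro mult_left_mono) auto
    also have "\<dots> = e" using m by (simp add: \<delta>_def)
    finally show ?thesis by simp
  qed
  then have "(\<integral>z. \<bar>p z - q z\<bar> \<partial>R) \<le> 0" by (rule field_le_epsilon)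
  then have "(\<integral>z. \<bar>p z - q z\<bar> \<partial>R) = 0"
    by (intro antisym) (auto intro!: Bochner_Integration.integral_nonneg)
  then have "AE z in R. \<bar>p z - q z\<bar> = 0"
    using int by (subst (asm) integral_nonneg_eq_0_iff_AE) auto
  then have "AE z in R. ennreal (p z) = ennreal (q z)" by eventually_elim simp
  then show ?thesis by (rule density_cong[rotated 2]) (use int in auto)
qed

text \<open>Competitors range over all plans, but a plan of finite value has an admissible density,
  so the comparison reduces to densities. Uniqueness, required by the definite description, follows
  by comparison with the midpoint.\<close>

lemma pi_eps_eq_density:
  assumes q: "minimizes \<epsilon> q" and \<epsilon>: "\<epsilon> > 0"
  shows "pi_eps \<mu> \<nu> \<epsilon> = density R q"
proof -
  have adm: "admissible q" using q by (simp add: minimizes_def)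
  have J: "J_eps \<epsilon> \<mu> \<nu> (density R p) = ereal (objective \<epsilon> p)" if "admissible p" for p
    using J_eps_density[OF that] by (simp add: objective_def)
  have ge: "ereal (objective \<epsilon> q) \<le> J_eps \<epsilon> \<mu> \<nu> \<pi>" if \<pi>: "\<pi> \<in> Marg \<mu> \<nu>" for \<pi>
  proof (cases "J_eps \<epsilon> \<mu> \<nu> \<pi> < \<infinity>")
    case True
    then obtain p where "admissible p" "\<pi> = density R p"
      using finite_J_eps_imp_density[OF \<pi> \<epsilon>] by blast
    then show ?thesis using q J by (auto simp: minimizes_def)
  qed auto
  show ?thesis
    unfolding pi_eps_def
  proof (rule the_equality)
    show "is_arg_min (J_eps \<epsilon> \<mu> \<nu>) (\<lambda>\<pi>. \<pi> \<in> Marg \<mu> \<nu>) (density R q)"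
      using adm ge J[OF adm] by (auto simp: is_arg_min_def admissible_def plan_density_def not_less)
    fix \<pi> assume \<pi>: "is_arg_min (J_eps \<epsilon> \<mu> \<nu>) (\<lambda>\<pi>. \<pi> \<in> Marg \<mu> \<nu>) \<pi>"
    have marg: "\<pi> \<in> Marg \<mu> \<nu>" using \<pi> by (simp add: is_arg_min_def)
    have le: "J_eps \<epsilon> \<mu> \<nu> \<pi> \<le> ereal (objective \<epsilon> q)"
      using \<pi> J[OF adm] adm by (auto simp: is_arg_min_def admissible_def plan_density_def not_less)
    then have "J_eps \<epsilon> \<mu> \<nu> \<pi> < \<infinity>" by (rule le_less_trans) simp
    then obtain p where p: "admissible p" "\<pi> = density R p"
      using finite_J_eps_imp_density[OF marg \<epsilon>] by blast
    have "objective \<epsilon> p \<le> objective \<epsilon> q" using le p J by simp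
    moreover have "objective \<epsilon> q \<le> objective \<epsilon> (midpoint p q)"
      using q midpoint(1)[OF p(1) adm] by (simp add: minimizes_def)
    ultimately have "\<epsilon> * gap p q \<le> 0"
      using objective_midpoint[OF p(1) adm, of \<epsilon>] by linarith
    then have "gap p q \<le> 0" using \<epsilon> by (simp add: mult_le_0_iff)
    then show "\<pi> = density R q" using gap_zero_imp_eq[OF p(1) adm] p(2) by simp
  qed
qed

section \<open>The limit of the minimizers as \<epsilon> tends to 0\<close>

definition entropy_minimal :: "(real \<times> real \<Rightarrow> real) \<Rightarrow> bool" where
  "entropy_minimal q \<longleftrightarrow> admissible q \<and> optimal (density R q) \<and>
     (\<forall>p. admissible p \<longrightarrow> optimal (density R p) \<longrightarrow> entropy q \<le> entropy p)"

lemma admissible_cost: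
  assumes "admissible p"
  shows "transport_cost (density R p) = ennreal (cost p)"
  using transport_cost_density[OF admissibleD(1)[OF assms]] admissibleD(3)[OF assms] by simp

text \<open>As the parameter decreases, the entropy of the minimizers increases and their cost
  decreases. The entropy stays below that of \<open>p0\<close>, whose cost is minimal, and its
  increments bound the gaps; this makes the sequence Cauchy although the objective changes from term
  to term.\<close>

lemma minimizers_convergent:
  assumes p0: "admissible p0" "optimal (density R p0)"
    and S: "\<And>n. 0 < S n" "decseq S" "S \<longlonglongrightarrow> 0"
    and P: "\<And>\<epsilon>. \<epsilon> > 0 \<Longrightarrow> minimizes \<epsilon> (P \<epsilon>)"
  obtains q where "entropy_minimal q" "(\<lambda>n. \<integral>z. \<bar>P (S n) z - q z\<bar> \<partial>R) \<longlonglongrightarrow> 0"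
proof -
  define p where "p n = P (S n)" for n
  have adm: "admissible (p n)" for n using P S(1) by (auto simp: p_def minimizes_def)
  note PD = admissibleD[OF adm]
  have min: "objective (S n) (p n) \<le> objective (S n) g" if "admissible g" for n g
    using P S(1) that by (auto simp: p_def minimizes_def)
  have cost_eq: "min_cost = ennreal (cost g)" if "admissible g" "optimal (density R g)" for g
    using optimal_cost[OF that(2)] admissible_cost[OF that(1)] by simp
  have cost_ge: "cost g \<le> cost h" if "admissible g" "optimal (density R g)" "admissible h" for g h
  proof -
    have "density R h \<in> Marg \<mu> \<nu>"
      using admissibleD(1)[OF that(3)] by (simp add: plan_density_def)
    from min_cost_le[OF this] show ?thesis
      using cost_eq[OF that(1,2)] admissible_cost[OF that(3)] cost_nonneg[OF admissibleD(1)[OF that(3)]]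
      by (simp add: ennreal_le_iff)
  qed
  have ent_le: "entropy (p n) \<le> entropy g" if "admissible g" "optimal (density R g)" for n g
  proof -
    have "S n * (entropy (p n) - entropy g) \<le> 0"
      using min[OF that(1), of n] cost_ge[OF that adm, of n] by (simp add: objective_def algebra_simps)
    then show ?thesis using S(1)[of n] by (simp add: mult_le_0_iff)
  qed
  \<comment> \<open>Adding the two minimality inequalities cancels the costs and leaves a sign for
    the product of the difference of the parameters and that of the entropies.\<close>
  have mono: "entropy (p n) \<le> entropy (p m)" "cost (p m) \<le> cost (p n)" if "n \<le> m" for n m
  proof -
    have le: "S m \<le> S n" using S(2) that by (simp add: decseqD)
    have 1: "cost (p n) + S n * entropy (p n) \<le> cost (p m) + S n * entropy (p m)"
      using min[OF adm] by (simp add: objective_def)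
    have 2: "cost (p m) + S m * entropy (p m) \<le> cost (p n) + S m * entropy (p n)"
      using min[OF adm] by (simp add: objective_def)
    show E: "entropy (p n) \<le> entropy (p m)"
    proof (cases "S m = S n")
      case False
      have "(S n - S m) * (entropy (p n) - entropy (p m)) \<le> 0"
        using 1 2 by (simp add: algebra_simps)
      then show ?thesis using False le by (simp add: mult_le_0_iff)
    qed (simp add: p_def)
    have "S m * entropy (p n) \<le> S m * entropy (p m)"
      using E S(1)[of m] by (intro mult_left_mono) auto
    then show "cost (p m) \<le> cost (p n)" using 2 by linarith
  qed
  \<comment> \<open>The midpoint costs at most as much as the earlier minimizer \<open>p n\<close>,
    hence has at least its entropy. Inserting this lower bound turns the gap into an increment of
    the entropy.\<close>
  have gap1: "gap (p n) (p m) \<le> entropy (p m) - entropy (p n)" if "n \<le> m" for n m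
  proof -
    have *: "s * (E - E') \<le> 0" if "C + s * E \<le> C' + s * E'" "C'' \<le> C" "C' = (C + C'') / 2"
      for s C C' C'' E E' :: real
    proof -
      have "C' \<le> C" using that(2,3) by simp
      then have "s * E \<le> s * E'" using that(1) by linarith
      then show ?thesis by (simp only: right_diff_distrib diff_le_0_iff_le)
    qed
    have "objective (S n) (p n) \<le> objective (S n) (midpoint (p n) (p m))"
      by (rule min[OF midpoint(1)[OF adm adm]])
    then have "S n * (entropy (p n) - entropy (midpoint (p n) (p m))) \<le> 0"
      unfolding objective_def by (rule *[OF _ mono(2)[OF that] midpoint(2)[OF adm adm]])
    then have "entropy (p n) \<le> entropy (midpoint (p n) (p m))"
      using S(1)[of n] by (simp add: mult_le_0_iff)
    then show ?thesis by linarith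
  qed
  have gap_sym: "gap f g = gap g f" for f g
  proof -
    have "midpoint f g = midpoint g f" by (auto simp: midpoint_def)
    then show ?thesis by simp
  qed
  have inc: "incseq (\<lambda>n. entropy (p n))" using mono(1) by (simp add: incseq_def)
  obtain L where L: "(\<lambda>n. entropy (p n)) \<longlonglongrightarrow> L" "\<And>n. entropy (p n) \<le> L"
    using incseq_convergent[OF inc, of "entropy p0"] ent_le[OF p0] by auto
  have gap_C: "\<exists>N. \<forall>i\<ge>N. \<forall>j\<ge>N. gap (p i) (p j) < e" if e: "e > 0" for e
  proof -
    obtain N where N: "\<bar>entropy (p N) - L\<bar> < e"
      using LIMSEQ_D[OF L(1) e] by (auto simp: real_norm_def)
    have *: "gap (p i) (p j) < e" if "i \<ge> N" "i \<le> j" for i j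
    proof -
      have "entropy (p N) \<le> entropy (p i)" using mono(1)[OF that(1)] .
      then show ?thesis using gap1[OF that(2)] L(2)[of j] N by linarith
    qed
    have "gap (p i) (p j) < e" if "i \<ge> N" "j \<ge> N" for i j
    proof (cases "i \<le> j")
      case True then show ?thesis by (rule *[OF that(1)])
    next
      case False
      then have "gap (p j) (p i) < e" using that by (intro *) auto
      then show ?thesis by (subst gap_sym)
    qed
    then show ?thesis by blast
  qed
  obtain q r where q: "plan_density q" and r: "strict_mono (r :: nat \<Rightarrow> nat)"
    and lim: "AE z in R. (\<lambda>n. p (r n) z) \<longlonglongrightarrow> q z"
    and L1: "(\<lambda>n. \<integral>z. \<bar>p n z - q z\<bar> \<partial>R) \<longlonglongrightarrow> 0"
    by (rule gap_Cauchy_imp_convergent[OF adm gap_C]) blast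
  note [measurable] = plan_densityD[OF q]
  have limE: "AE z in R. (\<lambda>n. p (r n) z * ln (p (r n) z)) \<longlonglongrightarrow> q z * ln (q z)"
    using lim by eventually_elim (intro tendsto_mult_ln_self plan_density_nonneg[OF PD(1)])
  have limC: "AE z in R. (\<lambda>n. \<bar>snd z - fst z\<bar> * p (r n) z) \<longlonglongrightarrow> \<bar>snd z - fst z\<bar> * q z"
    using lim by eventually_elim (intro tendsto_intros)
  \<comment> \<open>Since \<open>r n \<ge> n\<close>, monotonicity of the cost allows a bound with
    the parameter \<open>S n\<close> instead of \<open>S (r n)\<close>, whose limit is
    known.\<close>
  have cle: "cost (p (r n)) \<le> cost p0 + S n * (entropy p0 + measure R UNIV)" for n
  proof -
    have "cost (p n) \<le> cost p0 + S n * (entropy p0 - entropy (p n))"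
      using min[OF p0(1), of n] by (simp add: objective_def algebra_simps)
    also have "S n * (entropy p0 - entropy (p n)) \<le> S n * (entropy p0 + measure R UNIV)"
      using entropy_ge[OF PD(1,2), of n] S(1)[of n] by (intro mult_left_mono) auto
    finally show ?thesis using mono(2)[OF seq_suble[OF r, of n]] by linarith
  qed
  have v: "(\<lambda>n. cost p0 + S n * (entropy p0 + measure R UNIV)) \<longlonglongrightarrow> cost p0 + 0 * (entropy p0 + measure R UNIV)"
    by (intro tendsto_intros S)
  have lowE: "AE z in R. - 1 \<le> p (r n) z * ln (p (r n) z)" for n
    by (intro AE_I2 mult_ln_self_ge plan_density_nonneg[OF PD(1)])
  have lowC: "AE z in R. - 0 \<le> \<bar>snd z - fst z\<bar> * p (r n) z" for n
    by (intro AE_I2) (simp add: plan_density_nonneg[OF PD(1)])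
  have E: "integrable R (\<lambda>z. q z * ln (q z))" "entropy q \<le> L"
    by (rule RF.Fatou_bounded_below[OF PD(2) _ lowE limE L(2) tendsto_const]; measurable)+
  have C: "integrable R (\<lambda>z. \<bar>snd z - fst z\<bar> * q z)" "cost q \<le> cost p0 + 0 * (entropy p0 + measure R UNIV)"
    by (rule RF.Fatou_bounded_below[OF PD(3) _ lowC limC cle v]; measurable)+
  have admq: "admissible q" using q E C by (simp add: admissible_def)
  have marg: "density R q \<in> Marg \<mu> \<nu>" using q by (simp add: plan_density_def)
  have "optimal (density R q)"
  proof (rule min_cost_imp_optimal[OF marg])
    show "transport_cost (density R q) \<le> min_cost"
      unfolding admissible_cost[OF admq] cost_eq[OF p0] using C(2) by (simp add: ennreal_leI)
    show "min_cost < \<infinity>" unfolding cost_eq[OF p0] by simp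
  qed
  moreover have "entropy q \<le> entropy g" if "admissible g" "optimal (density R g)" for g
    using E(2) LIMSEQ_le_const2[OF L(1), of "entropy g"] ent_le[OF that] by force
  ultimately have "entropy_minimal q" using admq by (simp add: entropy_minimal_def)
  then show ?thesis using that L1 by (simp add: p_def)
qed

lemma integral_density_tendsto:
  fixes f :: "real \<times> real \<Rightarrow> real"
  assumes p: "\<And>n. plan_density (p n)" and q: "plan_density q"
    and L1: "(\<lambda>n. \<integral>z. \<bar>p n z - q z\<bar> \<partial>R) \<longlonglongrightarrow> 0"
    and f: "f \<in> borel_measurable R" "\<And>z. \<bar>f z\<bar> \<le> c"
  shows "(\<lambda>n. \<integral>z. f z \<partial>density R (p n)) \<longlonglongrightarrow> (\<integral>z. f z \<partial>density R q)"
proof -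
  note [measurable] = f(1) plan_densityD[OF p] plan_densityD[OF q]
  have int: "integrable R (\<lambda>z. g z * f z)" if "integrable R g" for g
  proof (rule Bochner_Integration.integrable_bound)
    note [measurable] = borel_measurable_integrable[OF that]
    show "integrable R (\<lambda>z. \<bar>g z\<bar> * c)" using that by auto
    show "(\<lambda>z. g z * f z) \<in> borel_measurable R" by measurable
    show "AE z in R. norm (g z * f z) \<le> norm (\<bar>g z\<bar> * c)"
      using f(2) by (intro AE_I2) (auto simp: abs_mult intro!: mult_left_mono order_trans[OF f(2)])
  qed
  note ip = plan_density_integrable(1)[OF p] and iq = plan_density_integrable(1)[OF q]
  have "norm ((\<integral>z. p n z * f z \<partial>R) - (\<integral>z. q z * f z \<partial>R)) \<le> (\<integral>z. \<bar>p n z - q z\<bar> \<partial>R) * c" for n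
  proof -
    have "norm ((\<integral>z. p n z * f z \<partial>R) - (\<integral>z. q z * f z \<partial>R)) = norm (\<integral>z. (p n z - q z) * f z \<partial>R)"
      using int[OF ip] int[OF iq] by (simp add: left_diff_distrib)
    also have "\<dots> \<le> (\<integral>z. \<bar>(p n z - q z) * f z\<bar> \<partial>R)"
      unfolding real_norm_def by (rule integral_abs_bound)
    also have "\<dots> \<le> (\<integral>z. \<bar>p n z - q z\<bar> * c \<partial>R)"
    proof (rule integral_mono)
      show "integrable R (\<lambda>z. \<bar>(p n z - q z) * f z\<bar>)"
        by (intro integrable_abs int Bochner_Integration.integrable_diff ip iq)
      show "integrable R (\<lambda>z. \<bar>p n z - q z\<bar> * c)"
        by (intro integrable_mult_left integrable_abs Bochner_Integration.integrable_diff ip iq)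
      show "\<bar>(p n z - q z) * f z\<bar> \<le> \<bar>p n z - q z\<bar> * c" for z
        unfolding abs_mult by (intro mult_left_mono f(2)) auto
    qed
    finally show ?thesis by simp
  qed
  then have "\<forall>\<^sub>F n in sequentially.
      norm ((\<integral>z. p n z * f z \<partial>R) - (\<integral>z. q z * f z \<partial>R)) \<le> (\<integral>z. \<bar>p n z - q z\<bar> \<partial>R) * c"
    by (intro always_eventually allI)
  from Lim_null_comparison[OF this tendsto_mult_left_zero[OF L1]]
  have "(\<lambda>n. \<integral>z. p n z * f z \<partial>R) \<longlonglongrightarrow> (\<integral>z. q z * f z \<partial>R)"
    by (rule LIM_zero_cancel)
  moreover have "(\<integral>z. f z \<partial>density R g) = (\<integral>z. g z * f z \<partial>R)" if "plan_density g" for g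
  proof -
    note [measurable] = plan_densityD[OF that]
    show ?thesis using plan_density_nonneg[OF that] by (subst integral_density) auto
  qed
  ultimately show ?thesis using p q by simp
qed

text \<open>The density obtained from \<open>minimizers_convergent\<close> may depend on the
  sequence of parameters. That all entropy-minimal densities define one measure \<open>K\<close>
  turns the limits along sequences into a limit of the whole family.\<close>

theorem weakly_tendsto_entropy_minimal:
  assumes p0: "admissible p0" "optimal (density R p0)"
    and K: "\<And>q. entropy_minimal q \<Longrightarrow> density R q = K"
  shows "weakly_tendsto (pi_eps \<mu> \<nu>) K (at_right 0)"
proof -
  have "\<exists>q. minimizes \<epsilon> q" if "\<epsilon> > 0" for \<epsilon>
    using minimizer_exists[OF p0(1) that] by blast
  then obtain P where P: "\<And>\<epsilon>. \<epsilon> > 0 \<Longrightarrow> minimizes \<epsilon> (P \<epsilon>)" by metis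
  have eq: "pi_eps \<mu> \<nu> \<epsilon> = density R (P \<epsilon>)" if "\<epsilon> > 0" for \<epsilon>
    by (rule pi_eps_eq_density[OF P[OF that] that])
  have pd: "plan_density (P \<epsilon>)" if "\<epsilon> > 0" for \<epsilon>
    using P[OF that] by (simp add: minimizes_def admissible_def)
  have fin: "density R p \<in> fin_measures" if "plan_density p" for p
    using that by (simp add: plan_density_def Marg_def)
  show ?thesis
    unfolding weakly_tendsto_def
  proof (intro conjI allI impI)
    \<comment> \<open>This particular sequence exhibits one entropy-minimal density, whence
      \<open>K\<close> is a finite measure.\<close>
    have S: "0 < 1 / real (Suc n)" "decseq (\<lambda>n. 1 / real (Suc n))" for n
      by (auto simp: decseq_def divide_simps)
    have S2: "(\<lambda>n. 1 / real (Suc n)) \<longlonglongrightarrow> 0"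
      using LIMSEQ_inverse_real_of_nat by (simp add: inverse_eq_divide)
    obtain q where "entropy_minimal q"
      by (rule minimizers_convergent[OF p0 S S2 P])
    then show "K \<in> fin_measures"
      using K[of q] fin[of q] by (auto simp: entropy_minimal_def admissible_def)
    show "\<forall>\<^sub>F \<epsilon> in at_right 0. pi_eps \<mu> \<nu> \<epsilon> \<in> fin_measures"
      using eventually_at_right_less[of "0::real"] by eventually_elim (simp add: eq fin pd)
    fix f :: "real \<times> real \<Rightarrow> real" assume f: "continuous_on UNIV f \<and> bounded (range f)"
    then obtain c where c: "\<And>z. \<bar>f z\<bar> \<le> c" by (auto simp: bounded_iff)
    have "f \<in> borel_measurable borel" using f by (intro borel_measurable_continuous_onI) auto
    then have fm: "f \<in> borel_measurable R" by (simp add: measurable_cong_sets[OF sets_R refl])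
    show "((\<lambda>\<epsilon>. \<integral>z. f z \<partial>pi_eps \<mu> \<nu> \<epsilon>) \<longlongrightarrow> (\<integral>z. f z \<partial>K)) (at_right 0)"
    proof (rule tendsto_at_right_sequentially[of 0 1])
      fix S :: "nat \<Rightarrow> real"
      assume S: "\<And>n. 0 < S n" "\<And>n. S n < 1" "decseq S" "S \<longlonglongrightarrow> 0"
      obtain q where q: "entropy_minimal q" "(\<lambda>n. \<integral>z. \<bar>P (S n) z - q z\<bar> \<partial>R) \<longlonglongrightarrow> 0"
        by (rule minimizers_convergent[OF p0 S(1,3,4) P])
      have "(\<lambda>n. \<integral>z. f z \<partial>density R (P (S n))) \<longlonglongrightarrow> (\<integral>z. f z \<partial>density R q)"
        by (rule integral_density_tendsto[OF pd _ q(2) fm c])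
           (use S q(1) in \<open>auto simp: entropy_minimal_def admissible_def\<close>)
      then show "(\<lambda>n. \<integral>z. f z \<partial>pi_eps \<mu> \<nu> (S n)) \<longlonglongrightarrow> (\<integral>z. f z \<partial>K)"
        using S(1) K[OF q(1)] by (simp add: eq)
    qed simp
  qed
qed

end

section \<open>Product structure on quadrants\<close>

context finite_borel_pair
begin

lemma nn_integral_prod:
  assumes [measurable]: "g \<in> borel_measurable \<mu>" "k \<in> borel_measurable \<nu>"
  shows "(\<integral>\<^sup>+z. g (fst z) * k (snd z) \<partial>R) = (\<integral>\<^sup>+x. g x \<partial>\<mu>) * (\<integral>\<^sup>+y. k y \<partial>\<nu>)"
proof -
  have "(\<integral>\<^sup>+z. g (fst z) * k (snd z) \<partial>R) = (\<integral>\<^sup>+x. \<integral>\<^sup>+y. g x * k y \<partial>\<nu> \<partial>\<mu>)"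
    by (subst N.nn_integral_fst[symmetric]) auto
  then show ?thesis by (simp add: nn_integral_cmult nn_integral_multc)
qed

text \<open>On a quadrant \<open>]-\<infinity>, t] \<times> [t, \<infinity>[\<close> the cost splits into a function of \<open>x\<close> and a function of
  \<open>y\<close>, so replacing the plan there by the product of its marginals preserves optimality.
  As this decreases the entropy strictly unless the plan is of product form already,
  entropy-minimal optimal plans are of product form on all quadrants.\<close>

lemma entropy_minimal_product:
  assumes p: "entropy_minimal p"
    and [measurable]: "U \<in> sets borel" "V \<in> sets borel" and UV: "U \<subseteq> {..t}" "V \<subseteq> {t..}"
  shows "emeasure (density R p) (U \<times> V) * emeasure (density R p) ({..t} \<times> {t..}) =
    emeasure (density R p) (U \<times> {t..}) * emeasure (density R p) ({..t} \<times> V)"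
proof -
  have adm: "admissible p" and opt: "optimal (density R p)"
    and min: "\<And>g. admissible g \<Longrightarrow> optimal (density R g) \<Longrightarrow> entropy p \<le> entropy g"
    using p by (auto simp: entropy_minimal_def)
  note P = admissibleD[OF adm]
  note [measurable] = plan_densityD[OF P(1)]
  have p0: "0 \<le> p z" for z using plan_density_nonneg[OF P(1)] .
  define X Y where "X = {..t}" and "Y = {t..}"
  have [measurable]: "X \<in> sets borel" "Y \<in> sets borel" by (auto simp: X_def Y_def)
  \<comment> \<open>Densities, with respect to \<mu> and \<nu>, of the marginals of the part of the
    plan in the quadrant. They may be infinite on null sets; \<open>a\<close> and \<open>b\<close>
    below are their real versions.\<close>
  define A B where "A x = (\<integral>\<^sup>+y. ennreal (p (x, y)) * indicator Y y \<partial>\<nu>)"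
    and "B y = (\<integral>\<^sup>+x. ennreal (p (x, y)) * indicator X x \<partial>\<mu>)" for x y
  have [measurable]: "A \<in> borel_measurable \<mu>" "B \<in> borel_measurable \<nu>"
    unfolding A_def[abs_def] B_def[abs_def] by measurable
  define a b where "a x = enn2real (A x)" and "b y = enn2real (B y)" for x y
  have [measurable]: "a \<in> borel_measurable \<mu>" "b \<in> borel_measurable \<nu>"
    unfolding a_def[abs_def] b_def[abs_def] by measurable
  have ab0: "0 \<le> a x" "0 \<le> b y" for x y by (auto simp: a_def b_def)
  define Q where "Q z = (indicator X (fst z) * indicator Y (snd z) :: real)" for z
  have [measurable]: "Q \<in> borel_measurable R" unfolding Q_def[abs_def] by measurable
  have Q01: "Q z = 0 \<or> Q z = 1" for z by (auto simp: Q_def indicator_def)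
  have pQ_A: "(\<integral>\<^sup>+z. ennreal (Q z * p z) * f (fst z) \<partial>R) = (\<integral>\<^sup>+x. indicator X x * f x * A x \<partial>\<mu>)"
    if [measurable]: "f \<in> borel_measurable borel" for f
  proof -
    have "(\<integral>\<^sup>+z. ennreal (Q z * p z) * f (fst z) \<partial>R)
      = (\<integral>\<^sup>+x. \<integral>\<^sup>+y. (indicator X x * f x) * (ennreal (p (x, y)) * indicator Y y) \<partial>\<nu> \<partial>\<mu>)"
      by (subst N.nn_integral_fst[symmetric])
         (auto intro!: nn_integral_cong simp: Q_def mult_ac split: split_indicator)
    then show ?thesis unfolding A_def by (simp add: nn_integral_cmult)
  qed
  have pQ_B: "(\<integral>\<^sup>+z. ennreal (Q z * p z) * f (snd z) \<partial>R) = (\<integral>\<^sup>+y. indicator Y y * f y * B y \<partial>\<nu>)"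
    if [measurable]: "f \<in> borel_measurable borel" for f
  proof -
    have "(\<integral>\<^sup>+z. ennreal (Q z * p z) * f (snd z) \<partial>R)
      = (\<integral>\<^sup>+y. \<integral>\<^sup>+x. (indicator Y y * f y) * (ennreal (p (x, y)) * indicator X x) \<partial>\<mu> \<partial>\<nu>)"
      by (subst R.nn_integral_snd[symmetric])
         (auto intro!: nn_integral_cong simp: Q_def mult_ac split: split_indicator)
    then show ?thesis unfolding B_def by (simp add: nn_integral_cmult)
  qed
  \<comment> \<open>The mass of the quadrant, by which the product of the marginals has to be
    divided.\<close>
  define G' where "G' = (\<integral>\<^sup>+z. ennreal (Q z * p z) \<partial>R)"
  have "G' \<le> (\<integral>\<^sup>+z. ennreal (p z) \<partial>R)"
    unfolding G'_def
    by (intro nn_integral_mono ennreal_leI) (metis Q01 mult_zero_left mult_1 p0 order_refl)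
  also have "\<dots> < \<infinity>" using plan_density_nn_marginals(1)[OF P(1), of UNIV] M.emeasure_eq_measure by simp
  finally have G'fin: "G' < \<infinity>" .
  define G where "G = enn2real G'"
  have G'G: "G' = ennreal G" using G'fin by (simp add: G_def)
  have GA: "(\<integral>\<^sup>+x. indicator X x * A x \<partial>\<mu>) = ennreal G" and GB: "(\<integral>\<^sup>+y. indicator Y y * B y \<partial>\<nu>) = ennreal G"
    using pQ_A[of "\<lambda>_. 1"] pQ_B[of "\<lambda>_. 1"] by (simp_all add: G'_def flip: G'G)
  have A_fin: "AE x in \<mu>. indicator X x * A x = indicator X x * ennreal (a x)"
  proof -
    have "AE x in \<mu>. indicator X x * A x \<noteq> \<infinity>"
      by (rule nn_integral_noteq_infinite) (auto simp: GA)
    then show ?thesis by eventually_elim (auto simp: a_def less_top split: split_indicator_asm split_indicator)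
  qed
  have B_fin: "AE y in \<nu>. indicator Y y * B y = indicator Y y * ennreal (b y)"
  proof -
    have "AE y in \<nu>. indicator Y y * B y \<noteq> \<infinity>"
      by (rule nn_integral_noteq_infinite) (auto simp: GB)
    then show ?thesis by eventually_elim (auto simp: b_def less_top split: split_indicator_asm split_indicator)
  qed
  have pQ_a: "(\<integral>\<^sup>+z. ennreal (Q z * p z) * f (fst z) \<partial>R) = (\<integral>\<^sup>+x. indicator X x * f x * ennreal (a x) \<partial>\<mu>)"
    if "f \<in> borel_measurable borel" for f
    unfolding pQ_A[OF that]
    by (rule nn_integral_cong_AE) (use A_fin in \<open>eventually_elim, auto split: split_indicator_asm split_indicator\<close>)
  have pQ_b: "(\<integral>\<^sup>+z. ennreal (Q z * p z) * f (snd z) \<partial>R) = (\<integral>\<^sup>+y. indicator Y y * f y * ennreal (b y) \<partial>\<nu>)"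
    if "f \<in> borel_measurable borel" for f
    unfolding pQ_B[OF that]
    by (rule nn_integral_cong_AE) (use B_fin in \<open>eventually_elim, auto split: split_indicator_asm split_indicator\<close>)
  have Ga: "(\<integral>\<^sup>+x. indicator X x * ennreal (a x) \<partial>\<mu>) = ennreal G"
    and Gb: "(\<integral>\<^sup>+y. indicator Y y * ennreal (b y) \<partial>\<nu>) = ennreal G"
    using pQ_a[of "\<lambda>_. 1"] pQ_b[of "\<lambda>_. 1"] by (simp_all add: G'_def flip: G'G)
  have rect: "emeasure (density R p) (S \<times> T) = (\<integral>\<^sup>+z. ennreal (Q z * p z) * (indicator S (fst z) * indicator T (snd z)) \<partial>R)"
    if [measurable]: "S \<in> sets borel" "T \<in> sets borel" and "S \<subseteq> X" "T \<subseteq> Y" for S T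
  proof -
    have "emeasure (density R p) (S \<times> T) = (\<integral>\<^sup>+z. ennreal (p z) * indicator (S \<times> T) z \<partial>R)"
      by (rule emeasure_density) auto
    also have "\<dots> = (\<integral>\<^sup>+z. ennreal (Q z * p z) * (indicator S (fst z) * indicator T (snd z)) \<partial>R)"
      by (rule nn_integral_cong) (use that in \<open>auto simp: Q_def indicator_def\<close>)
    finally show ?thesis .
  qed
  show ?thesis
  proof (cases "G = 0")
    \<comment> \<open>Without mass in the quadrant no normalization is possible, but both sides of
      the claim vanish.\<close>
    case True
    have "emeasure (density R p) (S \<times> T) = 0"
      if [measurable]: "S \<in> sets borel" "T \<in> sets borel" and "S \<subseteq> X" "T \<subseteq> Y" for S T
    proof -
      have "emeasure (density R p) (S \<times> T) \<le> G'"
        unfolding rect[OF that] G'_def by (rule nn_integral_mono) (auto split: split_indicator)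
      then show ?thesis using True G'G by simp
    qed
    then show ?thesis using UV by (simp add: X_def Y_def)
  next
    case False
    then have G: "G > 0" using enn2real_nonneg[of G'] unfolding G_def by linarith
    \<comment> \<open>The competitor; division by \<open>G\<close> gives the quadrant the same mass
      and the same marginals as before.\<close>
    define p' where "p' z = (if Q z = 1 then a (fst z) * b (snd z) / G else p z)" for z
    have [measurable]: "p' \<in> borel_measurable R" unfolding p'_def[abs_def] by measurable
    have p'0: "0 \<le> p' z" for z using p0 ab0 G by (simp add: p'_def)
    have p'Q: "Q z * p' z = indicator X (fst z) * a (fst z) / G * (indicator Y (snd z) * b (snd z))" for z
      by (auto simp: p'_def Q_def indicator_def)
    have p'_rect: "(\<integral>\<^sup>+z. ennreal (Q z * p' z) * (f (fst z) * g (snd z)) \<partial>R)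
       = (\<integral>\<^sup>+x. indicator X x * f x * ennreal (a x) \<partial>\<mu>) * (\<integral>\<^sup>+y. indicator Y y * g y * ennreal (b y) \<partial>\<nu>) / ennreal G"
      if [measurable]: "f \<in> borel_measurable borel" "g \<in> borel_measurable borel" for f g
    proof -
      have "ennreal (Q z * p' z) * (f (fst z) * g (snd z)) =
         (indicator X (fst z) * f (fst z) * ennreal (a (fst z)) / ennreal G)
          * (indicator Y (snd z) * g (snd z) * ennreal (b (snd z)))" for z
      proof -
        have "ennreal (Q z * p' z) = indicator X (fst z) * ennreal (a (fst z)) / ennreal G * (indicator Y (snd z) * ennreal (b (snd z)))"
        proof -
          have "ennreal (a x * b y / G) = ennreal (a x) / ennreal G * ennreal (b y)" for x y
            using ab0(1)[of x] ab0(2)[of y] G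
            by (simp add: divide_ennreal ennreal_mult''[symmetric])
          then show ?thesis unfolding p'Q by (auto split: split_indicator)
        qed
        then show ?thesis by (simp add: divide_ennreal_def mult_ac)
      qed
      then have "(\<integral>\<^sup>+z. ennreal (Q z * p' z) * (f (fst z) * g (snd z)) \<partial>R) =
        (\<integral>\<^sup>+z. (indicator X (fst z) * f (fst z) * ennreal (a (fst z)) / ennreal G)
          * (indicator Y (snd z) * g (snd z) * ennreal (b (snd z))) \<partial>R)" by simp
      also have "\<dots> = (\<integral>\<^sup>+x. indicator X x * f x * ennreal (a x) / ennreal G \<partial>\<mu>) * (\<integral>\<^sup>+y. indicator Y y * g y * ennreal (b y) \<partial>\<nu>)"
        by (rule nn_integral_prod) measurable
      also have "(\<integral>\<^sup>+x. indicator X x * f x * ennreal (a x) / ennreal G \<partial>\<mu>) = (\<integral>\<^sup>+x. indicator X x * f x * ennreal (a x) \<partial>\<mu>) / ennreal G"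
        by (rule nn_integral_divide) measurable
      finally show ?thesis by (simp add: divide_ennreal_def mult_ac)
    qed
    have GG: "c * ennreal G / ennreal G = c" for c
      using G by (simp add: ennreal_mult_divide_eq)
    have Q_fst: "(\<integral>\<^sup>+z. ennreal (Q z * p' z) * f (fst z) \<partial>R) = (\<integral>\<^sup>+z. ennreal (Q z * p z) * f (fst z) \<partial>R)"
      if "f \<in> borel_measurable borel" for f
      using p'_rect[OF that, of "\<lambda>_. 1"] pQ_a[OF that] by (simp add: Gb GG)
    have Q_snd: "(\<integral>\<^sup>+z. ennreal (Q z * p' z) * f (snd z) \<partial>R) = (\<integral>\<^sup>+z. ennreal (Q z * p z) * f (snd z) \<partial>R)"
      if "f \<in> borel_measurable borel" for f
      using p'_rect[OF _ that, of "\<lambda>_. 1"] pQ_b[OF that] by (simp add: Ga GG mult.commute[of "ennreal G"])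
    have split: "(\<integral>\<^sup>+z. ennreal (h z) * f z \<partial>R) =
       (\<integral>\<^sup>+z. ennreal (Q z * h z) * f z \<partial>R) + (\<integral>\<^sup>+z. ennreal ((1 - Q z) * h z) * f z \<partial>R)"
      if [measurable]: "f \<in> borel_measurable R" "h \<in> borel_measurable R" for f h
    proof -
      have "ennreal (h z) * f z = ennreal (Q z * h z) * f z + ennreal ((1 - Q z) * h z) * f z" for z
        using Q01[of z] by auto
      then show ?thesis by (simp add: nn_integral_add)
    qed
    have off: "(1 - Q z) * p' z = (1 - Q z) * p z" for z
      using Q01[of z] by (auto simp: p'_def)
    have tot_fst: "(\<integral>\<^sup>+z. ennreal (p' z) * f (fst z) \<partial>R) = (\<integral>\<^sup>+z. ennreal (p z) * f (fst z) \<partial>R)"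
      and tot_snd: "(\<integral>\<^sup>+z. ennreal (p' z) * f (snd z) \<partial>R) = (\<integral>\<^sup>+z. ennreal (p z) * f (snd z) \<partial>R)"
      if [measurable]: "f \<in> borel_measurable borel" for f
      using Q_fst[OF that] Q_snd[OF that]
      by (simp_all add: split[of _ p] split[of _ p'] off)
    have pd': "plan_density p'"
    proof (rule plan_densityI_nn)
      fix U :: "real set" assume U [measurable]: "U \<in> sets borel"
      show "(\<integral>\<^sup>+z. ennreal (p' z) * indicator U (fst z) \<partial>R) = emeasure \<mu> U"
        using tot_fst[of "indicator U"] plan_density_nn_marginals(1)[OF P(1) U] by simp
      show "(\<integral>\<^sup>+z. ennreal (p' z) * indicator U (snd z) \<partial>R) = emeasure \<nu> U"
        using tot_snd[of "indicator U"] plan_density_nn_marginals(2)[OF P(1) U] by simp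
    qed (use p'0 in auto)
    have cost_split: "transport_cost (density R h) =
        (\<integral>\<^sup>+z. ennreal (Q z * h z) * ennreal (t - fst z) \<partial>R) + (\<integral>\<^sup>+z. ennreal (Q z * h z) * ennreal (snd z - t) \<partial>R)
        + (\<integral>\<^sup>+z. ennreal ((1 - Q z) * h z) * ennreal \<bar>snd z - fst z\<bar> \<partial>R)"
      if h: "plan_density h" for h
    proof -
      note [measurable] = plan_densityD[OF h]
      have "transport_cost (density R h) = (\<integral>\<^sup>+z. ennreal (h z) * ennreal \<bar>snd z - fst z\<bar> \<partial>R)"
        unfolding transport_cost_def split_beta by (subst nn_integral_density) auto
      also have "\<dots> = (\<integral>\<^sup>+z. ennreal (Q z * h z) * ennreal \<bar>snd z - fst z\<bar> \<partial>R) +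
        (\<integral>\<^sup>+z. ennreal ((1 - Q z) * h z) * ennreal \<bar>snd z - fst z\<bar> \<partial>R)"
        by (rule split) auto
      also have "(\<integral>\<^sup>+z. ennreal (Q z * h z) * ennreal \<bar>snd z - fst z\<bar> \<partial>R) =
        (\<integral>\<^sup>+z. ennreal (Q z * h z) * ennreal (t - fst z) + ennreal (Q z * h z) * ennreal (snd z - t) \<partial>R)"
        by (rule nn_integral_cong)
           (auto simp: Q_def X_def Y_def simp flip: ennreal_plus distrib_left split: split_indicator)
      also have "\<dots> = (\<integral>\<^sup>+z. ennreal (Q z * h z) * ennreal (t - fst z) \<partial>R) + (\<integral>\<^sup>+z. ennreal (Q z * h z) * ennreal (snd z - t) \<partial>R)"
        by (rule nn_integral_add) auto
      finally show ?thesis .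
    qed
    have "transport_cost (density R p') = transport_cost (density R p)"
      using Q_fst[of "\<lambda>x. ennreal (t - x)"] Q_snd[of "\<lambda>y. ennreal (y - t)"]
      by (simp add: cost_split[OF pd'] cost_split[OF P(1)] off)
    then have cost': "transport_cost (density R p') = min_cost" using optimal_cost[OF opt] by simp
    have mfin: "min_cost < \<infinity>"
      unfolding optimal_cost[OF opt, symmetric] admissible_cost[OF adm] by simp
    have opt': "optimal (density R p')"
      by (rule min_cost_imp_optimal) (use pd' cost' mfin in \<open>auto simp: plan_density_def\<close>)
    have intc': "integrable R (\<lambda>z. \<bar>snd z - fst z\<bar> * p' z)"
      using cost' mfin transport_cost_density[OF pd'] by (auto split: if_splits)
    define la where "la x = ln (a x)" for x
    define lb where "lb y = ln (b y)" for y
    have [measurable]: "la \<in> borel_measurable borel" "lb \<in> borel_measurable borel"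
      using \<open>a \<in> borel_measurable \<mu>\<close> \<open>b \<in> borel_measurable \<nu>\<close>
      by (simp_all add: la_def[abs_def] lb_def[abs_def] measurable_cong_sets[OF M.M_is_borel refl] measurable_cong_sets[OF N.M_is_borel refl])
    have [measurable]: "a \<in> borel_measurable borel" "b \<in> borel_measurable borel"
      using \<open>a \<in> borel_measurable \<mu>\<close> \<open>b \<in> borel_measurable \<nu>\<close>
      by (simp_all add: measurable_cong_sets[OF M.M_is_borel refl] measurable_cong_sets[OF N.M_is_borel refl])
    \<comment> \<open>The logarithms of \<open>a\<close> and \<open>b\<close> have to be integrated
      against the plan. Their negative parts are integrable because \<open>c * ln c\<close> is
      bounded below; the positive parts are handled by the inequality \<open>gibbs\<close>.\<close>
    have neg_le: "ennreal (max 0 (- ln c)) * ennreal c \<le> 1" if "0 \<le> c" for c :: real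
    proof -
      have "max 0 (- ln c) * c \<le> 1"
        using mult_ln_self_ge[OF that] by (auto simp: max_def mult.commute)
      then have "ennreal (max 0 (- ln c) * c) \<le> 1" by (simp add: ennreal_le_1)
      then show ?thesis using that by (subst ennreal_mult''[symmetric]) auto
    qed
    have int_neg_a: "integrable R (\<lambda>z. Q z * p z * max 0 (- la (fst z)))"
    proof (rule integrableI_nonneg)
      have "(\<integral>\<^sup>+z. ennreal (Q z * p z * max 0 (- la (fst z))) \<partial>R) = (\<integral>\<^sup>+z. ennreal (Q z * p z) * ennreal (max 0 (- la (fst z))) \<partial>R)"
        using p0 by (intro nn_integral_cong) (auto simp: ennreal_mult'' Q_def)
      also have "\<dots> = (\<integral>\<^sup>+x. indicator X x * ennreal (max 0 (- la x)) * ennreal (a x) \<partial>\<mu>)"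
        by (rule pQ_a) measurable
      also have "\<dots> \<le> (\<integral>\<^sup>+x. 1 \<partial>\<mu>)"
        unfolding la_def using neg_le[OF ab0(1)]
        by (intro nn_integral_mono) (simp split: split_indicator del: ennreal_max_0 ennreal_max_0')
      also have "\<dots> < \<infinity>" by (simp add: M.emeasure_eq_measure)
      finally show "(\<integral>\<^sup>+z. ennreal (Q z * p z * max 0 (- la (fst z))) \<partial>R) < \<infinity>" .
    qed (use p0 in \<open>auto simp: Q_def\<close>)
    have int_neg_b: "integrable R (\<lambda>z. Q z * p z * max 0 (- lb (snd z)))"
    proof (rule integrableI_nonneg)
      have "(\<integral>\<^sup>+z. ennreal (Q z * p z * max 0 (- lb (snd z))) \<partial>R) = (\<integral>\<^sup>+z. ennreal (Q z * p z) * ennreal (max 0 (- lb (snd z))) \<partial>R)"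
        using p0 by (intro nn_integral_cong) (auto simp: ennreal_mult'' Q_def)
      also have "\<dots> = (\<integral>\<^sup>+y. indicator Y y * ennreal (max 0 (- lb y)) * ennreal (b y) \<partial>\<nu>)"
        by (rule pQ_b) measurable
      also have "\<dots> \<le> (\<integral>\<^sup>+y. 1 \<partial>\<nu>)"
        unfolding lb_def using neg_le[OF ab0(2)]
        by (intro nn_integral_mono) (simp split: split_indicator del: ennreal_max_0 ennreal_max_0')
      also have "\<dots> < \<infinity>" by (simp add: N.emeasure_eq_measure)
      finally show "(\<integral>\<^sup>+z. ennreal (Q z * p z * max 0 (- lb (snd z))) \<partial>R) < \<infinity>" .
    qed (use p0 in \<open>auto simp: Q_def\<close>)
    have AE_pos: "AE z in R. Q z * p z > 0 \<longrightarrow> a (fst z) > 0 \<and> b (snd z) > 0"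
    proof -
      have "(\<integral>\<^sup>+z. ennreal (Q z * p z) * indicator {x. a x = 0} (fst z) \<partial>R) = 0"
        by (subst pQ_a) (auto simp: nn_integral_0_iff_AE split: split_indicator)
      then have 1: "AE z in R. ennreal (Q z * p z) * indicator {x. a x = 0} (fst z) = 0"
        by (subst (asm) nn_integral_0_iff_AE) auto
      have "(\<integral>\<^sup>+z. ennreal (Q z * p z) * indicator {x. b x = 0} (snd z) \<partial>R) = 0"
        by (subst pQ_b) (auto simp: nn_integral_0_iff_AE split: split_indicator)
      then have 2: "AE z in R. ennreal (Q z * p z) * indicator {x. b x = 0} (snd z) = 0"
        by (subst (asm) nn_integral_0_iff_AE) auto
      from 1 2 show ?thesis
      proof eventually_elim
        case (elim z)
        then show ?case using ab0(1)[of "fst z"] ab0(2)[of "snd z"]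
          by (auto simp: order_le_less not_le split: split_indicator_asm)
      qed
    qed
    have ln_p': "ln (p' z) = la (fst z) + lb (snd z) - ln G" if "Q z = 1" "a (fst z) > 0" "b (snd z) > 0" for z
      using that G by (simp add: p'_def la_def lb_def ln_mult ln_div)
    \<comment> \<open>Gibbs' inequality between the plan and the competitor, read as an upper bound
      for the sum of the two logarithms. With the bounds on the negative parts it dominates each
      logarithm separately.\<close>
    have gibbs: "AE z in R. Q z * p z > 0 \<longrightarrow>
        p z * (la (fst z) + lb (snd z) - ln G) + p z - p' z \<le> p z * ln (p z)"
      using AE_pos
    proof eventually_elim
      case (elim z)
      show ?case
      proof
        assume *: "Q z * p z > 0"
        then have Q1: "Q z = 1" using Q01[of z] by auto
        have "p' z > 0" using elim * Q1 G by (simp add: p'_def)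
        then have "0 \<le> p z * ln (p z) - p z * ln (p' z) - p z + p' z"
          using relative_entropy_integrand_ge[OF p0[of z] p'0[of z]] zero_le_power2[of "sqrt (p z) - sqrt (p' z)"] by linarith
        then show "p z * (la (fst z) + lb (snd z) - ln G) + p z - p' z \<le> p z * ln (p z)"
          using ln_p'[OF Q1] elim * by simp
      qed
    qed
    note intp = plan_density_integrable(1)[OF P(1)] and intp' = plan_density_integrable(1)[OF pd']
    have bound_int: "integrable R (\<lambda>z. \<bar>p z * ln (p z)\<bar> + p z + p' z + p z * \<bar>ln G\<bar>
        + Q z * p z * max 0 (- la (fst z)) + Q z * p z * max 0 (- lb (snd z)))" (is "integrable R ?bound")
      using P(2) intp intp' int_neg_a int_neg_b by auto
    have nonneg4: "0 \<le> \<bar>p z * ln (p z)\<bar>" "0 \<le> p z" "0 \<le> p' z" "0 \<le> p z * \<bar>ln G\<bar>" 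
      "0 \<le> Q z * p z * max 0 (- la (fst z))" "0 \<le> Q z * p z * max 0 (- lb (snd z))" for z
      using p0 p'0 by (auto simp: Q_def)
    have arith: "\<bar>u\<bar> \<le> \<bar>\<bar>E\<bar> + r + r' + g' + nu + nv\<bar>" "\<bar>v\<bar> \<le> \<bar>\<bar>E\<bar> + r + r' + g' + nu + nv\<bar>"
      if "u + v - g + r - r' \<le> E" "0 \<le> r" "0 \<le> r'" "g \<le> g'" "0 \<le> g'" "- nu \<le> u" "- nv \<le> v" "0 \<le> nu" "0 \<le> nv"
      for u v E r r' g g' nu nv :: real
      using that by linarith+
    have bounds: "AE z in R. norm (Q z * p z * la (fst z)) \<le> norm (?bound z) \<and>
        norm (Q z * p z * lb (snd z)) \<le> norm (?bound z)"
      using gibbs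
    proof eventually_elim
      case (elim z)
      show ?case
      proof (cases "Q z * p z > 0")
        case True
        then have Q1: "Q z = 1" and pz: "p z > 0" using Q01[of z] p0[of z] by auto
        have *: "p z * la (fst z) + p z * lb (snd z) - p z * ln G + p z - p' z \<le> p z * ln (p z)"
          using elim True by (simp add: algebra_simps)
        have "p z * (- max 0 (- la (fst z))) \<le> p z * la (fst z)" "p z * (- max 0 (- lb (snd z))) \<le> p z * lb (snd z)"
          and g: "p z * ln G \<le> p z * \<bar>ln G\<bar>"
          using pz by (intro mult_left_mono; simp)+
        then have n: "- (p z * max 0 (- la (fst z))) \<le> p z * la (fst z)" "- (p z * max 0 (- lb (snd z))) \<le> p z * lb (snd z)"
          by simp_all
        note n4 = nonneg4[of z, unfolded Q1 mult_1]
        show ?thesis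
          unfolding real_norm_def Q1 mult_1
          by (intro conjI arith[OF * n4(2,3) g n4(4) n n4(5,6)])
      next
        case False
        then have "Q z * p z = 0" using p0[of z] Q01[of z] by auto
        then show ?thesis by (simp only: mult_zero_left norm_zero norm_ge_zero simp_thms)
      qed
    qed
    have int_a: "integrable R (\<lambda>z. Q z * p z * la (fst z))"
      by (rule Bochner_Integration.integrable_bound[OF bound_int])
         (measurable, use bounds in \<open>eventually_elim, blast\<close>)
    have int_b: "integrable R (\<lambda>z. Q z * p z * lb (snd z))"
      by (rule Bochner_Integration.integrable_bound[OF bound_int])
         (measurable, use bounds in \<open>eventually_elim, blast\<close>)
    \<comment> \<open>On the quadrant a function of one coordinate has the same integral against the
      plan and the competitor. The factor \<open>s\<close> takes the values 1 and
      \<open>- 1\<close>, which covers the positive and the negative part.\<close>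
    have transfer: "integrable R (\<lambda>z. Q z * p' z * h z) \<and> (\<integral>z. Q z * p' z * h z \<partial>R) = (\<integral>z. Q z * p z * h z \<partial>R)"
      if int: "integrable R (\<lambda>z. Q z * p z * h z)" and [measurable]: "h \<in> borel_measurable R"
        and eq: "\<And>s. (\<integral>\<^sup>+z. ennreal (Q z * p' z) * ennreal (s * h z) \<partial>R) = (\<integral>\<^sup>+z. ennreal (Q z * p z) * ennreal (s * h z) \<partial>R)"
      for h
    proof -
      have m: "ennreal (Q z * g z * h z) = ennreal (Q z * g z) * ennreal (1 * h z)"
        "ennreal (- (Q z * g z * h z)) = ennreal (Q z * g z) * ennreal (- 1 * h z)"
        if "\<And>z. 0 \<le> g z" for g z
        using that[of z] Q01[of z] by (auto simp: ennreal_mult'[symmetric])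
      have pos: "(\<integral>\<^sup>+z. ennreal (Q z * p' z * h z) \<partial>R) = (\<integral>\<^sup>+z. ennreal (Q z * p z * h z) \<partial>R)"
        by (rule trans[OF nn_integral_cong[OF m(1)[of p', OF p'0]]
              trans[OF eq nn_integral_cong[OF m(1)[of p, OF p0, symmetric]]]])
      have neg: "(\<integral>\<^sup>+z. ennreal (- (Q z * p' z * h z)) \<partial>R) = (\<integral>\<^sup>+z. ennreal (- (Q z * p z * h z)) \<partial>R)"
        by (rule trans[OF nn_integral_cong[OF m(2)[of p', OF p'0]]
              trans[OF eq nn_integral_cong[OF m(2)[of p, OF p0, symmetric]]]])
      have i': "integrable R (\<lambda>z. Q z * p' z * h z)"
        using int pos neg by (simp add: real_integrable_def)
      then show ?thesis using int pos neg by (simp add: real_lebesgue_integral_def)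
    qed
    have Ta: "integrable R (\<lambda>z. Q z * p' z * la (fst z)) \<and>
        (\<integral>z. Q z * p' z * la (fst z) \<partial>R) = (\<integral>z. Q z * p z * la (fst z) \<partial>R)"
      by (rule transfer[OF int_a]) (measurable, rule Q_fst[of "\<lambda>x. ennreal (s * la x)" for s], measurable)
    have Tb: "integrable R (\<lambda>z. Q z * p' z * lb (snd z)) \<and>
        (\<integral>z. Q z * p' z * lb (snd z) \<partial>R) = (\<integral>z. Q z * p z * lb (snd z) \<partial>R)"
      by (rule transfer[OF int_b]) (measurable, rule Q_snd[of "\<lambda>x. ennreal (s * lb x)" for s], measurable)
    have int_Q: "integrable R (\<lambda>z. Q z * f z)" if "integrable R f" for f
    proof (rule Bochner_Integration.integrable_bound[OF that])
      note [measurable] = borel_measurable_integrable[OF that]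
      show "(\<lambda>z. Q z * f z) \<in> borel_measurable R" by measurable
      show "AE z in R. norm (Q z * f z) \<le> norm (f z)"
        by (intro AE_I2) (metis Q01 mult_zero_left mult_1 norm_zero norm_ge_zero order_refl)
    qed
    have T1: "integrable R (\<lambda>z. Q z * p' z) \<and> (\<integral>z. Q z * p' z \<partial>R) = (\<integral>z. Q z * p z \<partial>R)"
      using transfer[of "\<lambda>_. 1"] int_Q[OF intp] Q_fst[of "\<lambda>_. ennreal s" for s] by simp
    \<comment> \<open>The logarithm of the competitor is a sum of functions of one coordinate, so
      integrating it against the competitor or against the plan gives the same: \<open>L\<close> and
      \<open>L0\<close> have equal integrals.\<close>
    define L where "L z = Q z * p' z * la (fst z) + Q z * p' z * lb (snd z) - Q z * p' z * ln G" for z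
    define L0 where "L0 z = Q z * p z * la (fst z) + Q z * p z * lb (snd z) - Q z * p z * ln G" for z
    have L: "Q z * (p' z * ln (p' z)) = L z" for z
    proof (cases "Q z = 1 \<and> a (fst z) > 0 \<and> b (snd z) > 0")
      case True
      then have "ln (p' z) = la (fst z) + lb (snd z) - ln G" using ln_p'[of z] by blast
      then show ?thesis using True by (simp add: L_def right_diff_distrib distrib_left)
    next
      case False
      then have "Q z * p' z = 0"
        using Q01[of z] ab0(1)[of "fst z"] ab0(2)[of "snd z"] by (auto simp: p'_def order_le_less)
      then show ?thesis by (auto simp: L_def)
    qed
    have intL: "integrable R L" "integrable R L0" "(\<integral>z. L z \<partial>R) = (\<integral>z. L0 z \<partial>R)"
      using Ta Tb T1 int_a int_b int_Q[OF intp] unfolding L_def[abs_def] L0_def[abs_def] by auto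
    have eq_p': "p' z * ln (p' z) = L z + (p z * ln (p z) - Q z * (p z * ln (p z)))" for z
    proof -
      have "p' z * ln (p' z) = Q z * (p' z * ln (p' z)) + (1 - Q z) * (p' z * ln (p' z))"
        by (simp add: algebra_simps)
      also have "(1 - Q z) * (p' z * ln (p' z)) = (1 - Q z) * (p z * ln (p z))"
        using Q01[of z] by (auto simp: p'_def)
      finally show ?thesis by (simp add: L algebra_simps)
    qed
    have int_e': "integrable R (\<lambda>z. p' z * ln (p' z))"
      unfolding eq_p' using intL(1) P(2) int_Q[OF P(2)] by auto
    have ent': "entropy p' = (\<integral>z. L0 z \<partial>R) + (entropy p - (\<integral>z. Q z * (p z * ln (p z)) \<partial>R))"
      unfolding eq_p' using intL P(2) int_Q[OF P(2)] by simp
    have "admissible p'" using pd' int_e' intc' by (simp add: admissible_def)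
    then have le: "(\<integral>z. Q z * (p z * ln (p z)) \<partial>R) \<le> (\<integral>z. L0 z \<partial>R)"
      using min[OF _ opt'] ent' by simp
    \<comment> \<open>The integrand of the relative entropy of the plan with respect to the
      competitor on the quadrant. Minimality makes its integral at most 0, while pointwise it
      dominates a square; hence both vanish almost everywhere.\<close>
    define D where "D z = Q z * (p z * ln (p z)) - L0 z - Q z * p z + Q z * p' z" for z
    have intD: "integrable R D"
      unfolding D_def[abs_def] using intL(2) int_Q[OF P(2)] int_Q[OF intp] T1 by auto
    have Dle: "(\<integral>z. D z \<partial>R) \<le> 0"
      unfolding D_def using intL(2) int_Q[OF P(2)] int_Q[OF intp] T1 le by simp
    have Dge: "AE z in R. Q z * (sqrt (p z) - sqrt (p' z))\<^sup>2 \<le> D z"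
      using AE_pos
    proof eventually_elim
      case (elim z)
      consider "Q z = 0" | "Q z = 1" "p z = 0" | "Q z = 1" "p z > 0"
        using Q01[of z] p0[of z] by fastforce
      then show ?case
      proof cases
        case 3
        then have ab: "a (fst z) > 0" "b (snd z) > 0" using elim by auto
        then have "p' z > 0" using 3 G by (simp add: p'_def)
        then have "(sqrt (p z) - sqrt (p' z))\<^sup>2 \<le> p z * ln (p z) - p z * ln (p' z) - p z + p' z"
          using relative_entropy_integrand_ge[OF p0[of z] p'0[of z]] by linarith
        then show ?thesis using 3 ln_p'[OF 3(1) ab] by (simp add: D_def L0_def algebra_simps)
      qed (auto simp: D_def L0_def p'0)
    qed
    have D0: "AE z in R. 0 \<le> D z"
      using Dge
    proof eventually_elim
      case (elim z)
      have "0 \<le> Q z * (sqrt (p z) - sqrt (p' z))\<^sup>2" using Q01[of z] by auto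
      then show ?case using elim by linarith
    qed
    have "(\<integral>z. D z \<partial>R) = 0"
      using Dle integral_nonneg_AE[OF D0] by linarith
    then have "AE z in R. D z = 0"
      using integral_nonneg_eq_0_iff_AE[OF intD D0] by simp
    with Dge have same: "AE z in R. Q z * p z = Q z * p' z"
    proof eventually_elim
      case (elim z)
      show ?case
      proof (cases "Q z = 1")
        case True
        then have "(sqrt (p z) - sqrt (p' z))\<^sup>2 \<le> 0" using elim by simp
        then have "sqrt (p z) = sqrt (p' z)" by simp
        then show ?thesis by simp
      qed (use Q01[of z] in auto)
    qed
    have val: "emeasure (density R p) (S \<times> T) =
        (\<integral>\<^sup>+x. indicator S x * ennreal (a x) \<partial>\<mu>) * (\<integral>\<^sup>+y. indicator T y * ennreal (b y) \<partial>\<nu>) / ennreal G"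
      if [measurable]: "S \<in> sets borel" "T \<in> sets borel" and ST: "S \<subseteq> X" "T \<subseteq> Y" for S T
    proof -
      have "emeasure (density R p) (S \<times> T) = (\<integral>\<^sup>+z. ennreal (Q z * p' z) * (indicator S (fst z) * indicator T (snd z)) \<partial>R)"
        unfolding rect[OF that] by (rule nn_integral_cong_AE) (use same in \<open>eventually_elim, simp only:\<close>)
      also have "\<dots> = (\<integral>\<^sup>+x. indicator X x * indicator S x * ennreal (a x) \<partial>\<mu>) * (\<integral>\<^sup>+y. indicator Y y * indicator T y * ennreal (b y) \<partial>\<nu>) / ennreal G"
        by (rule p'_rect) measurable
      also have "(\<lambda>x. indicator X x * indicator S x * ennreal (a x)) = (\<lambda>x. indicator S x * ennreal (a x))"
        using ST by (auto simp: fun_eq_iff split: split_indicator)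
      also have "(\<lambda>y. indicator Y y * indicator T y * ennreal (b y)) = (\<lambda>y. indicator T y * ennreal (b y))"
        using ST by (auto simp: fun_eq_iff split: split_indicator)
      finally show ?thesis .
    qed
    have U: "U \<subseteq> X" and V: "V \<subseteq> Y" using UV by (auto simp: X_def Y_def)
    show ?thesis
      unfolding X_def[symmetric] Y_def[symmetric]
      by (simp add: val U V Ga Gb divide_ennreal_def mult_ac)
  qed
qed

end

section \<open>Components of the real line\<close>

text \<open>For an open interval \<open>C = ]a, b[\<close> these are \<open>[a, b[\<close>, \<open>]a, b]\<close> and the part of the half-plane \<open>F\<close> with
  \<open>x\<close> in the former and \<open>y\<close> in the latter; infinite endpoints are not included.\<close>

definition from_set :: "real set \<Rightarrow> real set" where
  "from_set C = {x. (bdd_below C \<longrightarrow> Inf C \<le> x) \<and> (bdd_above C \<longrightarrow> x < Sup C)}"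

definition to_set :: "real set \<Rightarrow> real set" where
  "to_set C = {x. (bdd_below C \<longrightarrow> Inf C < x) \<and> (bdd_above C \<longrightarrow> x \<le> Sup C)}"

definition strip :: "real set \<Rightarrow> (real \<times> real) set" where
  "strip C = {z. fst z \<in> from_set C \<and> snd z \<in> to_set C \<and> fst z \<le> snd z}"

definition open_interval :: "real set \<Rightarrow> bool" where
  "open_interval C \<longleftrightarrow> open C \<and> connected C \<and> C \<noteq> {}"

lemma mem_open_interval:
  assumes "open_interval C"
  shows "x \<in> C \<longleftrightarrow> (bdd_below C \<longrightarrow> Inf C < x) \<and> (bdd_above C \<longrightarrow> x < Sup C)"
proof
  have C: "open C" "connected C" "C \<noteq> {}" using assms by (auto simp: open_interval_def)
  assume x: "x \<in> C"
  then obtain e where e: "e > 0" "ball x e \<subseteq> C" using C(1) by (meson open_contains_ball)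
  have "x - e / 2 \<in> ball x e" "x + e / 2 \<in> ball x e" using e(1) by (auto simp: dist_real_def)
  then have "x - e / 2 \<in> C" "x + e / 2 \<in> C" using e(2) by auto
  then show "(bdd_below C \<longrightarrow> Inf C < x) \<and> (bdd_above C \<longrightarrow> x < Sup C)"
    using e(1) cInf_lower[of "x - e / 2" C] cSup_upper[of "x + e / 2" C] by auto
next
  have C: "open C" "connected C" "C \<noteq> {}" using assms by (auto simp: open_interval_def)
  assume x: "(bdd_below C \<longrightarrow> Inf C < x) \<and> (bdd_above C \<longrightarrow> x < Sup C)"
  obtain l where l: "l \<in> C" "l < x"
  proof (cases "bdd_below C")
    case True
    then show ?thesis using x C(3) cInf_lessD[of C x] that by auto
  next
    case False
    then show ?thesis using that by (auto simp: bdd_below_def not_le)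
  qed
  obtain u where u: "u \<in> C" "x < u"
  proof (cases "bdd_above C")
    case True
    then show ?thesis using x C(3) less_cSupD[of C x] that by auto
  next
    case False
    then show ?thesis using that by (auto simp: bdd_above_def not_le)
  qed
  show "x \<in> C" by (rule connectedD_interval[OF C(2) l(1) u(1)]) (use l u in simp_all)
qed

lemma open_interval_eq: "open_interval C \<Longrightarrow> C = from_set C \<inter> to_set C"
  by (rule set_eqI) (auto simp only: mem_open_interval from_set_def to_set_def Int_iff mem_Collect_eq less_imp_le)

lemma from_set_cases:
  assumes "open_interval C"
  shows "x \<in> from_set C \<longleftrightarrow> x \<in> C \<or> (bdd_below C \<and> x = Inf C)"
proof -
  obtain c where c: "c \<in> C" using assms by (auto simp: open_interval_def)
  then have "(bdd_below C \<longrightarrow> Inf C < c) \<and> (bdd_above C \<longrightarrow> c < Sup C)"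
    using mem_open_interval[OF assms] by auto
  then show ?thesis using mem_open_interval[OF assms, of x] by (auto simp: from_set_def)
qed

lemma to_set_cases:
  assumes "open_interval C"
  shows "x \<in> to_set C \<longleftrightarrow> x \<in> C \<or> (bdd_above C \<and> x = Sup C)"
proof -
  obtain c where c: "c \<in> C" using assms by (auto simp: open_interval_def)
  then have "(bdd_below C \<longrightarrow> Inf C < c) \<and> (bdd_above C \<longrightarrow> c < Sup C)"
    using mem_open_interval[OF assms] by auto
  then show ?thesis using mem_open_interval[OF assms, of x] by (auto simp: to_set_def)
qed

text \<open>Half-open intervals that share a point also share the points just to its right, which
  lie in both open intervals.\<close>

lemma from_set_Int:
  assumes C: "open_interval C" "open_interval C'" and x: "x \<in> from_set C" "x \<in> from_set C'"
  shows "C \<inter> C' \<noteq> {}"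
proof -
  define z where "z = min (if bdd_above C then (x + Sup C) / 2 else x + 1) (if bdd_above C' then (x + Sup C') / 2 else x + 1)"
  have "x < z" "bdd_above C \<longrightarrow> z < Sup C" "bdd_above C' \<longrightarrow> z < Sup C'"
    using x by (auto simp: z_def from_set_def min_less_iff_disj)
  then have "z \<in> C" "z \<in> C'"
    using x by (auto simp: mem_open_interval[OF C(1)] mem_open_interval[OF C(2)] from_set_def)
  then show ?thesis by blast
qed

lemma to_set_Int:
  assumes C: "open_interval C" "open_interval C'" and x: "x \<in> to_set C" "x \<in> to_set C'"
  shows "C \<inter> C' \<noteq> {}"
proof -
  define z where "z = max (if bdd_below C then (x + Inf C) / 2 else x - 1) (if bdd_below C' then (x + Inf C') / 2 else x - 1)"
  have "z < x" "bdd_below C \<longrightarrow> Inf C < z" "bdd_below C' \<longrightarrow> Inf C' < z"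
    using x by (auto simp: z_def to_set_def less_max_iff_disj)
  then have "z \<in> C" "z \<in> C'"
    using x by (auto simp: mem_open_interval[OF C(1)] mem_open_interval[OF C(2)] to_set_def)
  then show ?thesis by blast
qed

lemma from_to_set_borel [measurable]: "from_set C \<in> sets borel" "to_set C \<in> sets borel"
proof -
  have "from_set C = (if bdd_below C then {Inf C..} else UNIV) \<inter> (if bdd_above C then {..<Sup C} else UNIV)"
    "to_set C = (if bdd_below C then {Inf C<..} else UNIV) \<inter> (if bdd_above C then {..Sup C} else UNIV)"
    by (auto simp: from_set_def to_set_def)
  then show "from_set C \<in> sets borel" "to_set C \<in> sets borel" by auto
qed

lemma strip_sets [measurable]: "strip C \<in> sets (borel \<Otimes>\<^sub>M borel)"
proof -
  have "{z \<in> space (borel \<Otimes>\<^sub>M borel). fst z \<in> from_set C \<and> snd z \<in> to_set C \<and> fst z \<le> snd z} \<in> sets (borel \<Otimes>\<^sub>M borel)"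
    by measurable
  then show ?thesis by (simp add: strip_def space_pair_measure)
qed

lemma strip_disjoint: "open_interval C \<Longrightarrow> open_interval C' \<Longrightarrow> C \<inter> C' = {} \<Longrightarrow> strip C \<inter> strip C' = {}"
  using from_set_Int by (fastforce simp: strip_def)

text \<open>A common point would lie on the diagonal, hence over both open intervals.\<close>

lemma strip_swap_disjoint:
  assumes "open_interval C" "open_interval C'" "C \<inter> C' = {}" "(x, y) \<in> strip C"
  shows "(y, x) \<notin> strip C'"
proof
  assume "(y, x) \<in> strip C'"
  with assms have "x = y" by (auto simp: strip_def)
  with assms \<open>(y, x) \<in> strip C'\<close> have "x \<in> C" "x \<in> C'"
    using open_interval_eq[of C] open_interval_eq[of C'] by (auto simp: strip_def)
  then show False using assms by blast
qed

lemma components_open_interval: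
  assumes "open E" "C \<in> components E"
  shows "open_interval C"
  unfolding open_interval_def
  using assms open_components in_components_connected in_components_nonempty by metis

text \<open>An endpoint of \<open>C\<close> inside \<open>E'\<close> would belong to a component of
  \<open>E'\<close> that overlaps \<open>C\<close>. Overlap leaves only \<open>C\<close> itself,
  which omits its endpoints. The alternative of disjoint sets is for \<open>E_plus\<close> against
  \<open>E_minus\<close>.\<close>

lemma components_endpoint:
  fixes E E' :: "real set"
  assumes E: "open E" and C: "C \<in> components E" and E': "open E'" "E' = E \<or> E' \<inter> E = {}"
  shows "bdd_below C \<Longrightarrow> Inf C \<notin> E'" "bdd_above C \<Longrightarrow> Sup C \<notin> E'"
proof -
  note I = components_open_interval[OF E C]
  have *: "C' = C" if C': "C' \<in> components E'" "C' \<inter> C \<noteq> {}" for C'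
    using E'(2)
  proof
    assume "E' = E"
    then show ?thesis using components_nonoverlap[of C' E C] C C' by blast
  qed (use C' in_components_subset[OF C] in_components_subset[OF C'(1)] in blast)
  show "Inf C \<notin> E'" if b: "bdd_below C"
  proof
    assume "Inf C \<in> E'"
    then obtain C' where C': "C' \<in> components E'" "Inf C \<in> C'" using Union_components[of E'] by blast
    note I' = components_open_interval[OF E'(1) C'(1)]
    have "C' \<inter> C \<noteq> {}"
      by (rule from_set_Int[OF I' I, of "Inf C"]) (use C'(2) b from_set_cases I I' in auto)
    then have "Inf C \<in> C" using * C' by blast
    then show False using mem_open_interval[OF I] b by auto
  qed
  show "Sup C \<notin> E'" if b: "bdd_above C"
  proof
    assume "Sup C \<in> E'"
    then obtain C' where C': "C' \<in> components E'" "Sup C \<in> C'" using Union_components[of E'] by blast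
    note I' = components_open_interval[OF E'(1) C'(1)]
    have "C' \<inter> C \<noteq> {}"
      by (rule to_set_Int[OF I' I, of "Sup C"]) (use C'(2) b to_set_cases I I' in auto)
    then have "Sup C \<in> C" using * C' by blast
    then show False using mem_open_interval[OF I] b by auto
  qed
qed

lemma countable_components_real:
  fixes E :: "real set"
  assumes "open E"
  shows "countable (components E)"
proof (rule countable_disjoint_open_subsets)
  show "\<And>S. S \<in> components E \<Longrightarrow> open S" using assms open_components by blast
  show "disjoint (components E)" by (auto simp: pairwise_def disjnt_def components_nonoverlap)
qed

section \<open>The sets \<open>E_plus\<close> and \<open>E_minus\<close> and the crossings of
  optimal plans\<close>

context finite_borel_pair
begin

text \<open>At \<open>x\<close> the difference of the distribution functions has the one-sided
  limits \<open>h x\<close> and \<open>hl x\<close>, both positive, so it exceeds a constant near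
  \<open>x\<close>. Its left limits there are then at least this constant.\<close>

lemma E_plus_open: "open (E_plus \<mu> \<nu>)"
proof (rule openI)
  fix x assume x: "x \<in> E_plus \<mu> \<nu>"
  define h where "h t = cdf \<mu> t - cdf \<nu> t" for t
  define hl where "hl t = cdf_left \<mu> t - cdf_left \<nu> t" for t
  have R: "(h \<longlongrightarrow> h t) (at_right t)" for t
    using M.cdf_is_right_cont[of t] N.cdf_is_right_cont[of t] unfolding h_def continuous_within
    by (intro tendsto_diff)
  have L: "(h \<longlongrightarrow> hl t) (at_left t)" for t
    unfolding h_def hl_def cdf_left_def by (intro tendsto_diff M.cdf_at_left N.cdf_at_left)
  \<comment> \<open>Half of the minimum stays strictly below both limits and is still positive when
    the inequality becomes weak.\<close>
  define c where "c = min (h x) (hl x) / 2"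
  have c: "c > 0" "c < h x" "c < hl x" using x by (auto simp: E_plus_def h_def hl_def c_def)
  obtain b where b: "b > x" "\<And>s. x < s \<Longrightarrow> s < b \<Longrightarrow> c < h s"
    using order_tendstoD(1)[OF R c(2)] by (auto simp: eventually_at_right_field)
  obtain a where a: "a < x" "\<And>s. a < s \<Longrightarrow> s < x \<Longrightarrow> c < h s"
    using order_tendstoD(1)[OF L c(3)] by (auto simp: eventually_at_left_field)
  have h: "c < h s" if "s \<in> {a<..<b}" for s
    using that a b c by (cases s x rule: linorder_cases) auto
  have "hl s \<ge> c" if "s \<in> {a<..<b}" for s
  proof (rule tendsto_lowerbound[OF L])
    have "\<forall>\<^sub>F r in at_left s. r \<in> {a<..<s}" using that by (intro eventually_at_leftI) auto
    then show "\<forall>\<^sub>F r in at_left s. c \<le> h r"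
      by eventually_elim (use h that in \<open>force intro: less_imp_le\<close>)
  qed simp
  then have "{a<..<b} \<subseteq> E_plus \<mu> \<nu>"
    using h c(1) by (force simp: E_plus_def h_def hl_def)
  moreover have "x \<in> {a<..<b}" using a b by auto
  ultimately show "\<exists>e>0. ball x e \<subseteq> E_plus \<mu> \<nu>"
    by (meson open_contains_ball open_greaterThanLessThan subset_trans)
qed

lemma E_plus_E_minus_disjoint: "E_plus \<mu> \<nu> \<inter> E_minus \<mu> \<nu> = {}"
  by (auto simp: E_plus_def E_minus_def)

text \<open>Optimality fixes the crossing masses at each level. The last two formulas come from left
  limits in the level; they differ from the first two when the marginals have atoms.\<close>

lemma optimal_crossings:
  assumes opt: "optimal \<pi>"
  shows "measure \<pi> {z. fst z \<le> t \<and> t < snd z} = max 0 (cdf \<mu> t - cdf \<nu> t)"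
    "measure \<pi> {z. snd z \<le> t \<and> t < fst z} = max 0 (cdf \<nu> t - cdf \<mu> t)"
    "measure \<pi> {z. fst z < t \<and> t \<le> snd z} = max 0 (cdf_left \<mu> t - cdf_left \<nu> t)"
    "measure \<pi> {z. snd z < t \<and> t \<le> fst z} = max 0 (cdf_left \<nu> t - cdf_left \<mu> t)"
proof -
  have \<pi>: "\<pi> \<in> Marg \<mu> \<nu>" and H: "\<And>t. inner_cdf \<pi> t = min (cdf \<mu> t) (cdf \<nu> t)"
    using opt by (auto simp: optimal_def)
  show "measure \<pi> {z. fst z \<le> t \<and> t < snd z} = max 0 (cdf \<mu> t - cdf \<nu> t)"
    "measure \<pi> {z. snd z \<le> t \<and> t < fst z} = max 0 (cdf \<nu> t - cdf \<mu> t)"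
    unfolding crossing_measures[OF \<pi>] H by auto
  interpret finite_measure \<pi> using MargD(3)[OF \<pi>] .
  have "(inner_cdf \<pi> \<longlongrightarrow> min (cdf_left \<mu> t) (cdf_left \<nu> t)) (at_left t)"
    unfolding H[abs_def] cdf_left_def by (intro tendsto_min M.cdf_at_left N.cdf_at_left)
  then have inner: "measure \<pi> ({z. fst z < t} \<inter> {z. snd z < t}) = min (cdf_left \<mu> t) (cdf_left \<nu> t)"
    by (intro tendsto_unique[OF _ inner_cdf_limits(2)[OF \<pi>]]) auto
  note [measurable] = halfplane_sets[OF MargD(1)[OF \<pi>]]
  have "cdf_left \<mu> t = measure \<pi> {z. fst z < t}" "cdf_left \<nu> t = measure \<pi> {z. snd z < t}"
    using MargD(4,5)[OF \<pi>, of "{..<t}"] by (auto simp: cdf_left_def measure_def)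
  moreover have "measure \<pi> {z. fst z < t} = measure \<pi> ({z. fst z < t} \<inter> {z. snd z \<ge> t} \<union> {z. fst z < t} \<inter> {z. snd z < t})"
    by (rule arg_cong[where f="measure \<pi>"]) auto
  moreover have "\<dots> = measure \<pi> ({z. fst z < t} \<inter> {z. snd z \<ge> t}) + measure \<pi> ({z. fst z < t} \<inter> {z. snd z < t})"
    by (rule finite_measure_Union) auto
  moreover have "measure \<pi> {z. snd z < t} = measure \<pi> ({z. snd z < t} \<inter> {z. fst z \<ge> t} \<union> {z. fst z < t} \<inter> {z. snd z < t})"
    by (rule arg_cong[where f="measure \<pi>"]) auto
  moreover have "\<dots> = measure \<pi> ({z. snd z < t} \<inter> {z. fst z \<ge> t}) + measure \<pi> ({z. fst z < t} \<inter> {z. snd z < t})"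
    by (rule finite_measure_Union) auto
  moreover have eq: "{z. fst z < t \<and> t \<le> snd z} = {z. fst z < t} \<inter> {z. snd z \<ge> t}"
    "{z. snd z < t \<and> t \<le> fst z} = {z. snd z < t} \<inter> {z. fst z \<ge> t}" by auto
  ultimately show "measure \<pi> {z. fst z < t \<and> t \<le> snd z} = max 0 (cdf_left \<mu> t - cdf_left \<nu> t)"
    "measure \<pi> {z. snd z < t \<and> t \<le> fst z} = max 0 (cdf_left \<nu> t - cdf_left \<mu> t)"
    using inner unfolding eq by linarith+
qed

end

lemma E_minus_swap: "E_minus \<mu> \<nu> = E_plus \<nu> \<mu>"
  by (auto simp: E_minus_def E_plus_def)

lemma endpoints_swap: "endpoints \<nu> \<mu> = endpoints \<mu> \<nu>"
  unfolding endpoints_def E_minus_swap by (simp add: Un_commute)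

context finite_borel_pair
begin

lemma E_minus_open: "open (E_minus \<mu> \<nu>)"
proof -
  interpret S: finite_borel_pair \<nu> \<mu> by unfold_locales (simp add: mass_eq)
  show ?thesis unfolding E_minus_swap by (rule S.E_plus_open)
qed

lemma countable_endpoints: "countable (endpoints \<mu> \<nu>)"
proof -
  let ?C = "components (E_plus \<mu> \<nu>) \<union> components (E_minus \<mu> \<nu>)"
  have "countable ?C"
    using countable_components_real E_plus_open E_minus_open by auto
  moreover have "endpoints \<mu> \<nu> \<subseteq> Inf ` ?C \<union> Sup ` ?C"
    by (auto simp: endpoints_def)
  ultimately show ?thesis by (meson countable_Un countable_image countable_subset)
qed

lemma endpoint_notin:
  assumes "e \<in> endpoints \<mu> \<nu>"
  shows "e \<notin> E_plus \<mu> \<nu>" "e \<notin> E_minus \<mu> \<nu>"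
proof -
  from assms obtain C where C: "C \<in> components (E_plus \<mu> \<nu>) \<or> C \<in> components (E_minus \<mu> \<nu>)"
    and e: "(bdd_below C \<and> e = Inf C) \<or> (bdd_above C \<and> e = Sup C)"
    unfolding endpoints_def Let_def Un_iff mem_Collect_eq by metis
  have *: "e \<notin> E'" if "C \<in> components E" "open E" "open E'" "E' = E \<or> E' \<inter> E = {}" for E E'
    using e components_endpoint[OF that(2,1,3,4)] by metis
  have D: "E_plus \<mu> \<nu> \<inter> E_minus \<mu> \<nu> = {}" "E_minus \<mu> \<nu> \<inter> E_plus \<mu> \<nu> = {}"
    using E_plus_E_minus_disjoint by auto
  note P = E_plus_open and Q = E_minus_open
  show "e \<notin> E_plus \<mu> \<nu>" using C
    by (rule disjE) (rule *[OF _ P P], simp_all, rule *[OF _ Q P], simp_all add: D)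
  show "e \<notin> E_minus \<mu> \<nu>" using C
    by (rule disjE) (rule *[OF _ P Q], simp_all add: D, rule *[OF _ Q Q], simp_all)
qed

text \<open>A point is good if it does not cross a rational or an endpoint in a direction forbidden by
  optimality; almost all points are, and the geometry of good points is deterministic.\<close>

definition good :: "real \<times> real \<Rightarrow> bool" where
  "good z \<longleftrightarrow> (\<forall>t \<in> \<rat> \<union> endpoints \<mu> \<nu>.
     (fst z < t \<and> t < snd z \<longrightarrow> t \<in> E_plus \<mu> \<nu>) \<and> (snd z < t \<and> t < fst z \<longrightarrow> t \<in> E_minus \<mu> \<nu>))"

text \<open>Outside \<open>E_plus\<close> one of the two upward crossing masses at \<open>t\<close>
  vanishes, and either event contains the strict crossing of \<open>t\<close>; downwards likewise.
  Countably many levels keep the exceptional set null.\<close>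

lemma optimal_AE_good:
  assumes opt: "optimal \<pi>"
  shows "AE z in \<pi>. good z"
proof -
  have \<pi>: "\<pi> \<in> Marg \<mu> \<nu>" using opt by (auto simp: optimal_def)
  interpret finite_measure \<pi> using MargD(3)[OF \<pi>] .
  note [measurable] = halfplane_sets[OF MargD(1)[OF \<pi>]]
  have eq: "{z. fst z \<le> t \<and> t < snd z} = {z. fst z \<le> t} \<inter> {z. t < snd z}"
    "{z. snd z \<le> t \<and> t < fst z} = {z. snd z \<le> t} \<inter> {z. t < fst z}"
    "{z. fst z < t \<and> t \<le> snd z} = {z. fst z < t} \<inter> {z. t \<le> snd z}"
    "{z. snd z < t \<and> t \<le> fst z} = {z. snd z < t} \<inter> {z. t \<le> fst z}" for t :: real
    by auto
  have sets: "{z. fst z \<le> t \<and> t < snd z} \<in> sets \<pi>" "{z. snd z \<le> t \<and> t < fst z} \<in> sets \<pi>"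
    "{z. fst z < t \<and> t \<le> snd z} \<in> sets \<pi>" "{z. snd z < t \<and> t \<le> fst z} \<in> sets \<pi>" for t
    unfolding eq by measurable
  have null: "AE z in \<pi>. z \<notin> A" if "A \<in> sets \<pi>" "measure \<pi> A = 0" for A
    using that by (intro AE_not_in) (auto simp: null_sets_def emeasure_eq_measure)
  have 1: "AE z in \<pi>. fst z < t \<and> t < snd z \<longrightarrow> t \<in> E_plus \<mu> \<nu>" for t
  proof (cases "t \<in> E_plus \<mu> \<nu>")
    case False
    then have "measure \<pi> {z. fst z \<le> t \<and> t < snd z} = 0 \<or> measure \<pi> {z. fst z < t \<and> t \<le> snd z} = 0"
      unfolding optimal_crossings[OF opt] by (auto simp: E_plus_def max_def)
    then show ?thesis
    proof
      assume "measure \<pi> {z. fst z \<le> t \<and> t < snd z} = 0"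
      from null[OF sets(1) this] show ?thesis by eventually_elim auto
    next
      assume "measure \<pi> {z. fst z < t \<and> t \<le> snd z} = 0"
      from null[OF sets(3) this] show ?thesis by eventually_elim auto
    qed
  qed auto
  have 2: "AE z in \<pi>. snd z < t \<and> t < fst z \<longrightarrow> t \<in> E_minus \<mu> \<nu>" for t
  proof (cases "t \<in> E_minus \<mu> \<nu>")
    case False
    then have "measure \<pi> {z. snd z \<le> t \<and> t < fst z} = 0 \<or> measure \<pi> {z. snd z < t \<and> t \<le> fst z} = 0"
      unfolding optimal_crossings[OF opt] by (auto simp: E_minus_def max_def)
    then show ?thesis
    proof
      assume "measure \<pi> {z. snd z \<le> t \<and> t < fst z} = 0"
      from null[OF sets(2) this] show ?thesis by eventually_elim auto
    next
      assume "measure \<pi> {z. snd z < t \<and> t \<le> fst z} = 0"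
      from null[OF sets(4) this] show ?thesis by eventually_elim auto
    qed
  qed auto
  have "countable (\<rat> \<union> endpoints \<mu> \<nu>)" using countable_endpoints by (simp add: countable_rat)
  moreover have "AE z in \<pi>. (fst z < t \<and> t < snd z \<longrightarrow> t \<in> E_plus \<mu> \<nu>) \<and> (snd z < t \<and> t < fst z \<longrightarrow> t \<in> E_minus \<mu> \<nu>)" for t
    using 1[of t] 2[of t] by eventually_elim auto
  ultimately show ?thesis
    unfolding good_def by (subst AE_ball_countable) auto
qed

lemma components_interval:
  assumes "C \<in> components (E_plus \<mu> \<nu>) \<or> C \<in> components (E_minus \<mu> \<nu>)"
  shows "open_interval C"
  using assms components_open_interval E_plus_open E_minus_open by blast

lemma components_Int:
  assumes "C \<in> components (E_plus \<mu> \<nu>) \<or> C \<in> components (E_minus \<mu> \<nu>)"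
    "C' \<in> components (E_plus \<mu> \<nu>) \<or> C' \<in> components (E_minus \<mu> \<nu>)" "C \<inter> C' \<noteq> {}"
  shows "C = C'" "C \<in> components (E_plus \<mu> \<nu>) \<longleftrightarrow> C' \<in> components (E_plus \<mu> \<nu>)"
proof -
  have d: "\<not> (C \<in> components (E_plus \<mu> \<nu>) \<and> C' \<in> components (E_minus \<mu> \<nu>) \<and> C \<inter> C' \<noteq> {})" for C C'
    using E_plus_E_minus_disjoint in_components_subset by blast
  show "C = C'" 
    using assms d[of C C'] d[of C' C] components_nonoverlap by (metis inf_commute)
  then show "C \<in> components (E_plus \<mu> \<nu>) \<longleftrightarrow> C' \<in> components (E_plus \<mu> \<nu>)" by simp
qed

lemma good_less_strip:
  assumes good: "good z" and less: "fst z < snd z"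
  obtains C where "C \<in> components (E_plus \<mu> \<nu>)" "z \<in> strip C"
proof -
  \<comment> \<open>A rational level between the coordinates finds the component. The endpoints of
    that component are tested levels too and lie outside \<open>E_plus\<close>, so neither separates
    the coordinates.\<close>
  obtain q where q: "q \<in> \<rat>" "fst z < q" "q < snd z" using Rats_dense_in_real[OF less] by blast
  then have "q \<in> E_plus \<mu> \<nu>" using good by (auto simp: good_def)
  then obtain C where C: "C \<in> components (E_plus \<mu> \<nu>)" "q \<in> C" using Union_components[of "E_plus \<mu> \<nu>"] by blast
  have I: "open_interval C" using components_interval C(1) by blast
  have qC: "(bdd_below C \<longrightarrow> Inf C < q) \<and> (bdd_above C \<longrightarrow> q < Sup C)"
    using C(2) mem_open_interval[OF I] by auto
  have "Inf C \<le> fst z" if b: "bdd_below C"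
  proof (rule ccontr)
    assume "\<not> ?thesis"
    then have "fst z < Inf C" "Inf C < snd z" using qC b q by auto
    moreover have "Inf C \<in> endpoints \<mu> \<nu>" using C(1) b by (auto simp: endpoints_def)
    ultimately show False using good endpoint_notin(1)[of "Inf C"] by (auto simp: good_def)
  qed
  moreover have "snd z \<le> Sup C" if b: "bdd_above C"
  proof (rule ccontr)
    assume "\<not> ?thesis"
    then have "fst z < Sup C" "Sup C < snd z" using qC b q by auto
    moreover have "Sup C \<in> endpoints \<mu> \<nu>" using C(1) b by (auto simp: endpoints_def)
    ultimately show False using good endpoint_notin(1)[of "Sup C"] by (auto simp: good_def)
  qed
  ultimately have "z \<in> strip C"
    using qC q less by (auto simp: strip_def from_set_def to_set_def)
  then show ?thesis using that C(1) by blast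
qed

end

context finite_borel_pair
begin

text \<open>Exchange of the marginals. The components of \<open>E_minus\<close> are those of
  \<open>E_plus\<close> for the exchanged pair, so each statement about the latter has its mirror
  image under the prefix \<open>S\<close>.\<close>

sublocale S: finite_borel_pair \<nu> \<mu>
  by unfold_locales (simp add: mass_eq)

lemma good_swap: "S.good (snd z, fst z) \<longleftrightarrow> good z"
  unfolding good_def S.good_def endpoints_swap[of \<nu> \<mu>] E_minus_swap fst_conv snd_conv by (simp only: conj_commute)

lemma good_greater_strip:
  assumes good: "good z" and less: "snd z < fst z"
  obtains C where "C \<in> components (E_minus \<mu> \<nu>)" "(snd z, fst z) \<in> strip C"
  using S.good_less_strip[of "(snd z, fst z)"] assms unfolding good_swap E_minus_swap by auto

text \<open>A good point that touches \<open>C\<close> lies in its strip, since any other component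
  that it could use would have to meet \<open>C\<close>. At the endpoints this holds only off the
  diagonal: mass resting there is counted in \<open>mu_eq\<close>.\<close>

lemma good_component:
  assumes good: "good z" and C: "C \<in> components (E_plus \<mu> \<nu>)"
  shows "fst z \<in> C \<Longrightarrow> z \<in> strip C" "snd z \<in> C \<Longrightarrow> z \<in> strip C"
    "fst z < snd z \<Longrightarrow> fst z \<in> from_set C \<Longrightarrow> z \<in> strip C"
    "fst z < snd z \<Longrightarrow> snd z \<in> to_set C \<Longrightarrow> z \<in> strip C"
proof -
  have I: "open_interval C" using components_interval C by blast
  have sub: "C \<subseteq> from_set C" "C \<subseteq> to_set C" using open_interval_eq[OF I] by auto
  show 3: "z \<in> strip C" if z: "fst z < snd z" "fst z \<in> from_set C"
  proof -
    obtain C' where C': "C' \<in> components (E_plus \<mu> \<nu>)" "z \<in> strip C'"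
      using good_less_strip[OF good z(1)] .
    have "C \<inter> C' \<noteq> {}"
      by (rule from_set_Int[OF I]) (use z C' components_interval in \<open>auto simp: strip_def\<close>)
    then show ?thesis using components_Int(1)[of C C'] C C' by auto
  qed
  show 4: "z \<in> strip C" if z: "fst z < snd z" "snd z \<in> to_set C"
  proof -
    obtain C' where C': "C' \<in> components (E_plus \<mu> \<nu>)" "z \<in> strip C'"
      using good_less_strip[OF good z(1)] .
    have "C \<inter> C' \<noteq> {}"
      by (rule to_set_Int[OF I]) (use z C' components_interval in \<open>auto simp: strip_def\<close>)
    then show ?thesis using components_Int(1)[of C C'] C C' by auto
  qed
  \<comment> \<open>A point moving left lies in the mirrored strip of a component of
    \<open>E_minus\<close>, which would meet \<open>C\<close>.\<close>
  have neg: False if z: "snd z < fst z" "fst z \<in> to_set C \<or> snd z \<in> from_set C"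
  proof -
    obtain C' where C': "C' \<in> components (E_minus \<mu> \<nu>)" "(snd z, fst z) \<in> strip C'"
      using good_greater_strip[OF good z(1)] .
    have I': "open_interval C'" using components_interval C' by blast
    have "C \<inter> C' \<noteq> {}"
      using to_set_Int[OF I I', of "fst z"] from_set_Int[OF I I', of "snd z"] z C' by (auto simp: strip_def)
    then have "C' \<in> components (E_plus \<mu> \<nu>)" "C' \<subseteq> E_minus \<mu> \<nu>"
      using components_Int(2)[of C C'] C C' in_components_subset by auto
    then show False
      using E_plus_E_minus_disjoint in_components_subset in_components_nonempty by blast
  qed
  have diag: "z \<in> strip C" if "fst z = snd z" "snd z \<in> C"
    using that sub unfolding strip_def by auto
  show "z \<in> strip C" if "fst z \<in> C"
  proof (cases "fst z" "snd z" rule: linorder_cases)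
    case less
    then show ?thesis using 3 that sub(1) by blast
  next
    case equal
    then show ?thesis using diag that by simp
  next
    case greater
    then show ?thesis using neg that sub(2) by blast
  qed
  show "z \<in> strip C" if "snd z \<in> C"
  proof (cases "fst z" "snd z" rule: linorder_cases)
    case less
    then show ?thesis using 4 that sub(2) by blast
  next
    case equal
    then show ?thesis using diag that by simp
  next
    case greater
    then show ?thesis using neg that sub(1) by blast
  qed
qed

end

section \<open>Decomposition of optimal plans\<close>

lemma emeasure_restr:
  assumes "A \<in> sets M" "B \<in> sets M"
  shows "emeasure (restr M A) B = emeasure M (A \<inter> B)"
  unfolding restr_def by (rule emeasure_restricted[OF assms])

lemma sets_restr [simp]: "sets (restr M A) = sets M"
  by (simp add: restr_def)

lemma emeasure_dirac_left:
  assumes "U \<in> sets borel"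
  shows "emeasure (dirac_left C c) U = (if bdd_below C \<and> Inf C \<in> U then ennreal (c (Inf C)) else 0)"
  using assms by (auto simp: dirac_left_def split: split_indicator)

lemma emeasure_dirac_right:
  assumes "U \<in> sets borel"
  shows "emeasure (dirac_right C c) U = (if bdd_above C \<and> Sup C \<in> U then ennreal (c (Sup C)) else 0)"
  using assms by (auto simp: dirac_right_def split: split_indicator)

lemma sets_dirac [simp]: "sets (dirac_left C c) = sets borel" "sets (dirac_right C c) = sets borel"
  by (auto simp: dirac_left_def dirac_right_def)

lemma sets_plus_comp [simp]: "sets (mu_plus_comp \<mu> \<nu> C) = sets borel" "sets (nu_plus_comp \<mu> \<nu> C) = sets borel"
  by (auto simp: mu_plus_comp_def nu_plus_comp_def)

lemma minus_comp_eq: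
  assumes "sets \<mu> = sets borel" "sets \<nu> = sets borel"
  shows "nu_minus_comp \<mu> \<nu> C = mu_plus_comp \<nu> \<mu> C" "mu_minus_comp \<mu> \<nu> C = nu_plus_comp \<nu> \<mu> C"
  by (simp_all add: nu_minus_comp_def mu_plus_comp_def mu_minus_comp_def nu_plus_comp_def)

abbreviation swap_plan :: "(real \<times> real) measure \<Rightarrow> (real \<times> real) measure" where
  "swap_plan \<pi> \<equiv> distr \<pi> borel (\<lambda>(x, y). (y, x))"

lemma measurable_swap: "(\<lambda>(x, y). (y, x)) \<in> (borel :: (real \<times> real) measure) \<rightarrow>\<^sub>M (borel :: (real \<times> real) measure)"
  unfolding borel_prod[symmetric] by measurable

lemma measurable_swap':
  fixes \<pi> :: "(real \<times> real) measure"
  assumes "sets \<pi> = sets borel"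
  shows "(\<lambda>(x, y). (y, x)) \<in> \<pi> \<rightarrow>\<^sub>M (borel :: (real \<times> real) measure)"
  unfolding measurable_cong_sets[OF assms refl] by (rule measurable_swap)

lemma swap_sets:
  fixes A :: "(real \<times> real) set"
  assumes "A \<in> sets borel"
  shows "{z. (snd z, fst z) \<in> A} \<in> sets borel"
  using measurable_sets[OF measurable_swap assms] by (simp add: vimage_def split_beta)

lemma emeasure_swap_plan:
  assumes "sets \<pi> = sets borel" "A \<in> sets borel"
  shows "emeasure (swap_plan \<pi>) A = emeasure \<pi> {z. (snd z, fst z) \<in> A}"
  using emeasure_distr[OF measurable_swap'[OF assms(1)] assms(2)] sets_eq_imp_space_eq[OF assms(1)]
  by (simp add: vimage_def split_beta)

lemma strip_borel [measurable]: "strip C \<in> sets borel"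
  using strip_sets[of C] sets_borel_pair by simp

context finite_borel_pair
begin

lemma swap_plan_Marg:
  assumes "\<pi> \<in> Marg \<mu> \<nu>"
  shows "swap_plan \<pi> \<in> Marg \<nu> \<mu>"
proof (rule MargI)
  interpret finite_measure \<pi> using MargD(3)[OF assms] .
  show "finite_measure (swap_plan \<pi>)"
    by (rule finite_measure_distr[OF measurable_swap'[OF MargD(1)[OF assms]]])
  fix U :: "real set" assume U: "U \<in> sets borel"
  note m = vimage_fst_snd_borel[OF U]
  show "emeasure (swap_plan \<pi>) {z. fst z \<in> U} = emeasure \<nu> U"
    using emeasure_swap_plan[OF MargD(1)[OF assms] m(1)] MargD(5)[OF assms U] by simp
  show "emeasure (swap_plan \<pi>) {z. snd z \<in> U} = emeasure \<mu> U"
    using emeasure_swap_plan[OF MargD(1)[OF assms] m(2)] MargD(4)[OF assms U] by simp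
qed (use M.M_is_borel N.M_is_borel in auto)

lemma swap_plan_optimal:
  assumes "optimal \<pi>"
  shows "S.optimal (swap_plan \<pi>)"
proof -
  have \<pi>: "\<pi> \<in> Marg \<mu> \<nu>" using assms by (simp add: optimal_def)
  have "inner_cdf (swap_plan \<pi>) t = inner_cdf \<pi> t" for t
  proof -
    have "{z::real \<times> real. fst z \<le> t \<and> snd z \<le> t} \<in> sets borel"
      by (rule borel_pred_sets) (auto, measurable)
    from emeasure_swap_plan[OF MargD(1)[OF \<pi>] this] show ?thesis
      by (simp add: inner_cdf_def measure_def conj_commute)
  qed
  then show ?thesis
    using assms swap_plan_Marg[OF \<pi>] by (simp add: optimal_def S.optimal_def min.commute)
qed

text \<open>A good point in the strip starts in \<open>C\<close> or at its left endpoint. In the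
  latter case it crosses the endpoint, and by optimality the mass of these points is the difference
  of distribution functions in \<open>mu_plus_comp\<close>. At the right endpoint the targets play
  this role, with the left-continuous distribution functions.\<close>

lemma strip_marginals:
  assumes opt: "optimal \<pi>" and C: "C \<in> components (E_plus \<mu> \<nu>)"
  shows "restr \<pi> (strip C) \<in> Marg (mu_plus_comp \<mu> \<nu> C) (nu_plus_comp \<mu> \<nu> C)"
proof (rule MargI)
  have \<pi>: "\<pi> \<in> Marg \<mu> \<nu>" using opt by (simp add: optimal_def)
  interpret finite_measure \<pi> using MargD(3)[OF \<pi>] .
  note sets = MargD(1)[OF \<pi>] and space = MargD(2)[OF \<pi>]
  have strip: "strip C \<in> sets \<pi>" using strip_borel sets by simp
  have I: "open_interval C" using components_interval C by blast
  have [measurable]: "C \<in> sets borel" using I by (simp add: open_interval_def)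
  have cross: "{z. fst z \<le> t \<and> t < snd z} \<in> sets \<pi>" "{z. fst z < t \<and> t \<le> snd z} \<in> sets \<pi>" for t
    by (rule borel_pred_sets[OF sets]; measurable)+
  show "sets (restr \<pi> (strip C)) = sets borel" using sets by simp
  show "finite_measure (restr \<pi> (strip C))"
  proof (rule finite_measureI)
    have "emeasure (restr \<pi> (strip C)) (space (restr \<pi> (strip C))) = emeasure \<pi> (strip C \<inter> space \<pi>)"
      using emeasure_restr[OF strip sets.top] by (simp add: restr_def)
    then show "emeasure (restr \<pi> (strip C)) (space (restr \<pi> (strip C))) \<noteq> \<infinity>" by simp
  qed
  have ends: "bdd_below C \<Longrightarrow> Inf C \<in> endpoints \<mu> \<nu>" "bdd_above C \<Longrightarrow> Sup C \<in> endpoints \<mu> \<nu>"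
    using C by (auto simp: endpoints_def)
  fix U :: "real set" assume U [measurable]: "U \<in> sets borel"
  have m: "{z. fst z \<in> V} \<in> sets \<pi>" "{z. snd z \<in> V} \<in> sets \<pi>" if "V \<in> sets borel" for V
    using vimage_fst_snd_borel[OF that] sets by simp_all
  show "emeasure (restr \<pi> (strip C)) {z. fst z \<in> U} = emeasure (mu_plus_comp \<mu> \<nu> C) U"
  proof -
    \<comment> \<open>All points crossing the left endpoint upwards: as the endpoint is not in
      \<open>E_plus\<close>, almost all of them start exactly there.\<close>
    define A where "A = (if bdd_below C \<and> Inf C \<in> U then {z :: real \<times> real. fst z \<le> Inf C \<and> Inf C < snd z} else {})"
    have A: "A \<in> sets \<pi>" using cross by (simp add: A_def)
    have "emeasure (restr \<pi> (strip C)) {z. fst z \<in> U} = emeasure \<pi> (strip C \<inter> {z. fst z \<in> U})"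
      by (rule emeasure_restr[OF strip m(1)]) simp
    also have "\<dots> = emeasure \<pi> ({z. fst z \<in> U \<inter> C} \<union> A)"
    proof (rule emeasure_eq_AE)
      show "AE z in \<pi>. z \<in> strip C \<inter> {z. fst z \<in> U} \<longleftrightarrow> z \<in> {z. fst z \<in> U \<inter> C} \<union> A"
        using optimal_AE_good[OF opt]
      proof eventually_elim
        case (elim z)
        show ?case
        proof
          assume z: "z \<in> strip C \<inter> {z. fst z \<in> U}"
          then consider "fst z \<in> C" | "bdd_below C" "fst z = Inf C"
            using from_set_cases[OF I, of "fst z"] by (auto simp: strip_def)
          then show "z \<in> {z. fst z \<in> U \<inter> C} \<union> A"
          proof cases
            case 2
            then have "Inf C < snd z" using z by (auto simp: strip_def to_set_def)
            then show ?thesis using 2 z by (auto simp: A_def)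
          qed (use z in auto)
        next
          assume "z \<in> {z. fst z \<in> U \<inter> C} \<union> A"
          then show "z \<in> strip C \<inter> {z. fst z \<in> U}"
          proof
            assume "z \<in> {z. fst z \<in> U \<inter> C}"
            then show ?thesis using good_component(1)[OF elim C] by auto
          next
            assume z: "z \<in> A"
            then have b: "bdd_below C" "Inf C \<in> U" and le: "fst z \<le> Inf C" "Inf C < snd z"
              by (auto simp: A_def split: if_splits)
            have "\<not> fst z < Inf C"
              using elim le(2) ends(1)[OF b(1)] endpoint_notin(1)[OF ends(1)[OF b(1)]] by (auto simp: good_def)
            then have "fst z = Inf C" using le by simp
            then show ?thesis
              using good_component(3)[OF elim C] from_set_cases[OF I, of "fst z"] b le by auto
          qed
        qed
      qed
    qed (use strip m(1)[of U] m(1)[of "U \<inter> C"] A in auto)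
    also have "\<dots> = emeasure \<pi> {z. fst z \<in> U \<inter> C} + emeasure \<pi> A"
    proof (rule plus_emeasure[symmetric])
      show "{z. fst z \<in> U \<inter> C} \<inter> A = {}"
        using mem_open_interval[OF I] by (fastforce simp: A_def split: if_splits)
    qed (use m(1)[of "U \<inter> C"] A in auto)
    also have "emeasure \<pi> {z. fst z \<in> U \<inter> C} = emeasure \<mu> (U \<inter> C)"
      by (rule MargD(4)[OF \<pi>]) simp
    \<comment> \<open>The \<open>max\<close> with 0 is absorbed by \<open>ennreal\<close>, which is
      0 on negative numbers.\<close>
    also have "emeasure \<pi> A = emeasure (dirac_left C (\<lambda>a. cdf \<mu> a - cdf \<nu> a)) U"
      by (simp add: A_def emeasure_dirac_left emeasure_eq_measure optimal_crossings[OF opt] max.commute ennreal_max_0 cong: if_cong)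
    finally show ?thesis
      unfolding mu_plus_comp_def using M.M_is_borel
      by (simp add: emeasure_add_measure emeasure_restr add.commute Int_commute)
  qed
  show "emeasure (restr \<pi> (strip C)) {z. snd z \<in> U} = emeasure (nu_plus_comp \<mu> \<nu> C) U"
  proof -
    \<comment> \<open>Now the inequality is strict for the source and weak for the target, because
      the points in question end at the right endpoint.\<close>
    define A where "A = (if bdd_above C \<and> Sup C \<in> U then {z :: real \<times> real. fst z < Sup C \<and> Sup C \<le> snd z} else {})"
    have A: "A \<in> sets \<pi>" using cross by (simp add: A_def)
    have "emeasure (restr \<pi> (strip C)) {z. snd z \<in> U} = emeasure \<pi> (strip C \<inter> {z. snd z \<in> U})"
      by (rule emeasure_restr[OF strip m(2)]) simp
    also have "\<dots> = emeasure \<pi> ({z. snd z \<in> U \<inter> C} \<union> A)"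
    proof (rule emeasure_eq_AE)
      show "AE z in \<pi>. z \<in> strip C \<inter> {z. snd z \<in> U} \<longleftrightarrow> z \<in> {z. snd z \<in> U \<inter> C} \<union> A"
        using optimal_AE_good[OF opt]
      proof eventually_elim
        case (elim z)
        show ?case
        proof
          assume z: "z \<in> strip C \<inter> {z. snd z \<in> U}"
          then consider "snd z \<in> C" | "bdd_above C" "snd z = Sup C"
            using to_set_cases[OF I, of "snd z"] by (auto simp: strip_def)
          then show "z \<in> {z. snd z \<in> U \<inter> C} \<union> A"
          proof cases
            case 2
            then have "fst z < Sup C" using z by (auto simp: strip_def from_set_def)
            then show ?thesis using 2 z by (auto simp: A_def)
          qed (use z in auto)
        next
          assume "z \<in> {z. snd z \<in> U \<inter> C} \<union> A"
          then show "z \<in> strip C \<inter> {z. snd z \<in> U}"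
          proof
            assume "z \<in> {z. snd z \<in> U \<inter> C}"
            then show ?thesis using good_component(2)[OF elim C] by auto
          next
            assume z: "z \<in> A"
            then have b: "bdd_above C" "Sup C \<in> U" and le: "fst z < Sup C" "Sup C \<le> snd z"
              by (auto simp: A_def split: if_splits)
            have "\<not> Sup C < snd z"
              using elim le(1) ends(2)[OF b(1)] endpoint_notin(1)[OF ends(2)[OF b(1)]] by (auto simp: good_def)
            then have "snd z = Sup C" using le by simp
            then show ?thesis
              using good_component(4)[OF elim C] to_set_cases[OF I, of "snd z"] b le by auto
          qed
        qed
      qed
    qed (use strip m(2)[of U] m(2)[of "U \<inter> C"] A in auto)
    also have "\<dots> = emeasure \<pi> {z. snd z \<in> U \<inter> C} + emeasure \<pi> A"
    proof (rule plus_emeasure[symmetric])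
      show "{z. snd z \<in> U \<inter> C} \<inter> A = {}"
        using mem_open_interval[OF I] by (fastforce simp: A_def split: if_splits)
    qed (use m(2)[of "U \<inter> C"] A in auto)
    also have "emeasure \<pi> {z. snd z \<in> U \<inter> C} = emeasure \<nu> (U \<inter> C)"
      by (rule MargD(5)[OF \<pi>]) simp
    also have "emeasure \<pi> A = emeasure (dirac_right C (\<lambda>b. cdf_left \<mu> b - cdf_left \<nu> b)) U"
      by (simp add: A_def emeasure_dirac_right emeasure_eq_measure optimal_crossings[OF opt] max.commute ennreal_max_0 cong: if_cong)
    finally show ?thesis
      unfolding nu_plus_comp_def using N.M_is_borel
      by (simp add: emeasure_add_measure emeasure_restr Int_commute)
  qed
qed simp_all

end

section \<open>The resting mass and the reassembly of a plan\<close>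

context finite_borel_pair
begin

text \<open>Diagonal points over the open components belong to the strips. What remains is, up to a
  null set of an optimal plan, the diagonal over the complement of \<open>E_plus\<close> and
  \<open>E_minus\<close>.\<close>

definition stay_set :: "(real \<times> real) set" where
  "stay_set = - (\<Union> (strip ` components (E_plus \<mu> \<nu>)) \<union>
     \<Union> ((\<lambda>C. {z. (snd z, fst z) \<in> strip C}) ` components (E_minus \<mu> \<nu>)))"

lemma stay_set_borel: "stay_set \<in> sets borel"
proof -
  have "(\<Union>C\<in>components (E_plus \<mu> \<nu>). strip C) \<in> sets borel"
    by (rule sets.countable_UN'[OF countable_components_real[OF E_plus_open]]) (use strip_borel in blast)
  moreover have "(\<Union>C\<in>components (E_minus \<mu> \<nu>). {z. (snd z, fst z) \<in> strip C}) \<in> sets borel"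
    by (rule sets.countable_UN'[OF countable_components_real[OF E_minus_open]]) (use swap_sets[OF strip_borel] in blast)
  ultimately show ?thesis
    unfolding stay_set_def by (intro borel_comp sets.Un)
qed

lemma good_stay:
  assumes "good z" "z \<in> stay_set"
  shows "fst z = snd z" "fst z \<notin> E_plus \<mu> \<nu>" "fst z \<notin> E_minus \<mu> \<nu>"
proof -
  have n: "C \<in> components (E_plus \<mu> \<nu>) \<Longrightarrow> z \<notin> strip C" "C \<in> components (E_minus \<mu> \<nu>) \<Longrightarrow> (snd z, fst z) \<notin> strip C" for C
    using assms(2) unfolding stay_set_def by blast+
  show "fst z = snd z"
    using good_less_strip[OF assms(1)] good_greater_strip[OF assms(1)] n by (metis linorder_cases)
  show "fst z \<notin> E_plus \<mu> \<nu>"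
    using good_component(1)[OF assms(1)] n(1) Union_components[of "E_plus \<mu> \<nu>"] by blast
  have "S.good (snd z, fst z)" using assms(1) good_swap by simp
  note S.good_component(2)[OF this]
  then show "fst z \<notin> E_minus \<mu> \<nu>"
    using n(2) Union_components[of "E_minus \<mu> \<nu>"] unfolding E_minus_swap by fastforce
qed

lemma optimal_split:
  assumes opt: "optimal \<pi>" and A: "A \<in> sets borel"
  shows "emeasure \<pi> A = (\<integral>\<^sup>+C. emeasure \<pi> (strip C \<inter> A) \<partial>count_space (components (E_plus \<mu> \<nu>)))
    + (\<integral>\<^sup>+C. emeasure (swap_plan \<pi>) (strip C \<inter> {z. (snd z, fst z) \<in> A}) \<partial>count_space (components (E_minus \<mu> \<nu>)))
    + emeasure \<pi> (stay_set \<inter> A)"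
proof -
  have \<pi>: "\<pi> \<in> Marg \<mu> \<nu>" using opt by (simp add: optimal_def)
  note sets = MargD(1)[OF \<pi>]
  have A' [measurable]: "A \<in> sets \<pi>" using A sets by simp
  let ?P = "\<Union>C\<in>components (E_plus \<mu> \<nu>). strip C \<inter> A"
  let ?m = "\<lambda>C. {z. (snd z, fst z) \<in> strip C} \<inter> A"
  let ?M = "\<Union>C\<in>components (E_minus \<mu> \<nu>). ?m C"
  note cP = countable_components_real[OF E_plus_open] and cM = countable_components_real[OF E_minus_open]
  have s1: "strip C \<inter> A \<in> sets \<pi>" for C using strip_borel A sets by auto
  have s2: "?m C \<in> sets \<pi>" for C using swap_sets[OF strip_borel] A sets by auto
  have s3: "stay_set \<inter> A \<in> sets \<pi>" using stay_set_borel A sets by auto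
  have P: "?P \<in> sets \<pi>" by (rule sets.countable_UN'[OF cP]) (use s1 in auto)
  have Mi: "?M \<in> sets \<pi>" by (rule sets.countable_UN'[OF cM]) (use s2 in auto)
  have swap_disj: "z \<notin> ?m C'" if "C \<in> components (E_plus \<mu> \<nu>)" "C' \<in> components (E_minus \<mu> \<nu>)" "z \<in> strip C" for C C' z
  proof -
    have "C \<inter> C' = {}" using that E_plus_E_minus_disjoint in_components_subset by blast
    then show ?thesis
      using strip_swap_disjoint[of C C' "fst z" "snd z"] components_interval that by auto
  qed
  have "A = (?P \<union> ?M) \<union> (stay_set \<inter> A)" by (auto simp: stay_set_def)
  then have "emeasure \<pi> A = emeasure \<pi> ((?P \<union> ?M) \<union> (stay_set \<inter> A))" by simp
  also have "\<dots> = emeasure \<pi> (?P \<union> ?M) + emeasure \<pi> (stay_set \<inter> A)"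
    by (rule plus_emeasure[symmetric]) (use P Mi s3 in \<open>auto simp: stay_set_def\<close>)
  also have "emeasure \<pi> (?P \<union> ?M) = emeasure \<pi> ?P + emeasure \<pi> ?M"
    by (rule plus_emeasure[symmetric]) (use P Mi swap_disj in blast)+
  also have "emeasure \<pi> ?P = (\<integral>\<^sup>+C. emeasure \<pi> (strip C \<inter> A) \<partial>count_space (components (E_plus \<mu> \<nu>)))"
  proof (rule emeasure_UN_countable[OF s1 cP])
    show "disjoint_family_on (\<lambda>C. strip C \<inter> A) (components (E_plus \<mu> \<nu>))"
      using strip_disjoint components_interval components_nonoverlap
      unfolding disjoint_family_on_def by blast
  qed
  also have "emeasure \<pi> ?M = (\<integral>\<^sup>+C. emeasure \<pi> (?m C) \<partial>count_space (components (E_minus \<mu> \<nu>)))"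
  proof (rule emeasure_UN_countable[OF s2 cM])
    show "disjoint_family_on ?m (components (E_minus \<mu> \<nu>))"
      using strip_disjoint components_interval components_nonoverlap
      unfolding disjoint_family_on_def by blast
  qed
  also have "(\<lambda>C. emeasure \<pi> (?m C)) = (\<lambda>C. emeasure (swap_plan \<pi>) (strip C \<inter> {z. (snd z, fst z) \<in> A}))"
    using emeasure_swap_plan[OF sets] swap_sets[OF A] strip_borel
    by (auto simp: fun_eq_iff Collect_conj_eq intro!: arg_cong[where f="emeasure \<pi>"])
  finally show ?thesis .
qed

lemma sets_minus_comp [simp]: "sets (mu_minus_comp \<mu> \<nu> C) = sets borel" "sets (nu_minus_comp \<mu> \<nu> C) = sets borel"
  by (simp_all add: minus_comp_eq M.M_is_borel N.M_is_borel)

lemma stay_marginal: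
  assumes opt: "optimal \<pi>" and U: "U \<in> sets borel"
  shows "emeasure \<mu> U = emeasure (mu_plus \<mu> \<nu>) U + emeasure (mu_minus \<mu> \<nu>) U
    + emeasure \<pi> (stay_set \<inter> {z. fst z \<in> U})"
proof -
  have \<pi>: "\<pi> \<in> Marg \<mu> \<nu>" using opt by (simp add: optimal_def)
  note sets = MargD(1)[OF \<pi>]
  note m = vimage_fst_snd_borel[OF U]
  have 1: "emeasure \<pi> (strip C \<inter> {z. fst z \<in> U}) = emeasure (mu_plus_comp \<mu> \<nu> C) U"
    if "C \<in> components (E_plus \<mu> \<nu>)" for C
    using MargD(4)[OF strip_marginals[OF opt that] U] m strip_borel sets by (simp add: emeasure_restr)
  have 2: "emeasure (swap_plan \<pi>) (strip C \<inter> {z. (snd z, fst z) \<in> {z. fst z \<in> U}}) = emeasure (mu_minus_comp \<mu> \<nu> C) U"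
    if "C \<in> components (E_minus \<mu> \<nu>)" for C
    using MargD(5)[OF S.strip_marginals[OF swap_plan_optimal[OF opt]] U] that m strip_borel
    by (simp add: emeasure_restr E_minus_swap minus_comp_eq M.M_is_borel N.M_is_borel)
  have "emeasure \<mu> U = emeasure \<pi> {z. fst z \<in> U}" using MargD(4)[OF \<pi> U] by simp
  also have "\<dots> = (\<integral>\<^sup>+C. emeasure (mu_plus_comp \<mu> \<nu> C) U \<partial>count_space (components (E_plus \<mu> \<nu>)))
    + (\<integral>\<^sup>+C. emeasure (mu_minus_comp \<mu> \<nu> C) U \<partial>count_space (components (E_minus \<mu> \<nu>)))
    + emeasure \<pi> (stay_set \<inter> {z. fst z \<in> U})"
    unfolding optimal_split[OF opt m(1)] using 1 2
    by (intro arg_cong2[where f="(+)"] nn_integral_cong) auto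
  finally show ?thesis
    using U by (simp add: mu_plus_def mu_minus_def emeasure_sum_measures)
qed

text \<open>The identity \<open>stay_marginal\<close> determines the resting mass once the
  components are subtracted. Off the endpoints the components put no mass on \<open>E_eq\<close>, so
  it is \<mu> itself there; the countably many endpoints are treated one atom at a time.\<close>

lemma mu_eq_stay:
  assumes opt: "optimal \<pi>" and U: "U \<in> sets borel"
  shows "emeasure (mu_eq \<mu> \<nu>) U = emeasure \<pi> (stay_set \<inter> {z. fst z \<in> U})"
proof -
  have \<pi>: "\<pi> \<in> Marg \<mu> \<nu>" using opt by (simp add: optimal_def)
  note sets = MargD(1)[OF \<pi>]
  interpret finite_measure \<pi> using MargD(3)[OF \<pi>] .
  define B where "B = endpoints \<mu> \<nu>"
  define W where "W = - B \<inter> E_eq \<mu> \<nu>"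
  define \<rho> where "\<rho> = distr (restr \<pi> stay_set) borel fst"
  have fst_m: "fst \<in> measurable (restr \<pi> stay_set) borel"
    using sets_borel_fst_snd(1)[of "restr \<pi> stay_set"] sets by simp
  have stay: "stay_set \<in> sets \<pi>" using stay_set_borel sets by simp
  have m: "{z. fst z \<in> V} \<in> sets \<pi>" if "V \<in> sets borel" for V
    using vimage_fst_snd_borel(1)[OF that] sets by simp
  have \<rho>: "emeasure \<rho> V = emeasure \<pi> (stay_set \<inter> {z. fst z \<in> V})" if "V \<in> sets borel" for V
    using emeasure_distr[OF fst_m that] emeasure_restr[OF stay m[OF that]] MargD(2)[OF \<pi>]
    by (simp add: \<rho>_def vimage_def restr_def)
  have \<rho>_sets: "sets \<rho> = sets borel" by (simp add: \<rho>_def)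
  have marg: "emeasure \<mu> V = emeasure (mu_plus \<mu> \<nu>) V + emeasure (mu_minus \<mu> \<nu>) V + emeasure \<rho> V" if "V \<in> sets borel" for V
    using stay_marginal[OF opt that] \<rho>[OF that] by simp
  have cB: "countable B" unfolding B_def by (rule countable_endpoints)
  have B: "B \<in> sets borel" by (rule sets.countable[OF _ cB]) simp
  have E: "E_plus \<mu> \<nu> \<in> sets borel" "E_minus \<mu> \<nu> \<in> sets borel" using E_plus_open E_minus_open by auto
  have W: "W \<in> sets borel" using B E by (auto simp: W_def E_eq_def)
  \<comment> \<open>All three summands are finite, so the identity in extended reals can be solved
    for the last one by subtracting real numbers.\<close>
  have \<rho>_atom: "emeasure \<rho> {x} = ennreal (measure \<mu> {x} - measure (mu_plus \<mu> \<nu>) {x} - measure (mu_minus \<mu> \<nu>) {x})" for x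
  proof -
    have "emeasure \<mu> {x} < \<infinity>" by (simp add: M.emeasure_eq_measure)
    then obtain a b c where abc: "emeasure (mu_plus \<mu> \<nu>) {x} = ennreal a" "emeasure (mu_minus \<mu> \<nu>) {x} = ennreal b"
      "emeasure \<rho> {x} = ennreal c" "0 \<le> a" "0 \<le> b" "0 \<le> c"
      using marg[of "{x}"] unfolding infinity_ennreal_def 
      by (metis borel_singleton ennreal_add_eq_top ennreal_cases less_irrefl sets.empty_sets)
    then have "emeasure \<mu> {x} = ennreal (a + b + c)" using marg[of "{x}"] by simp
    then have "measure \<mu> {x} = a + b + c"
      unfolding measure_def using abc(4-6) by (metis add_nonneg_nonneg enn2real_ennreal)
    then show ?thesis using abc by (simp add: measure_def)
  qed
  have comp0: "emeasure (mu_plus \<mu> \<nu>) (U \<inter> W) = 0"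
  proof -
    have "emeasure (mu_plus_comp \<mu> \<nu> C) (U \<inter> W) = 0" if C: "C \<in> components (E_plus \<mu> \<nu>)" for C
    proof -
      have "C \<inter> (U \<inter> W) = {}" using in_components_subset[OF C] by (auto simp: W_def E_eq_def)
      moreover have "\<not> (bdd_below C \<and> Inf C \<in> U \<inter> W)" using C by (auto simp: W_def B_def endpoints_def)
      moreover have "C \<in> sets borel" using components_interval C by (auto simp: open_interval_def)
      ultimately show ?thesis using U W M.M_is_borel
        by (auto simp: mu_plus_comp_def emeasure_add_measure emeasure_dirac_left emeasure_restr)
    qed
    then show ?thesis using U W by (simp add: mu_plus_def emeasure_sum_measures nn_integral_0_iff_AE AE_count_space)
  qed
  have comp1: "emeasure (mu_minus \<mu> \<nu>) (U \<inter> W) = 0"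
  proof -
    have "emeasure (mu_minus_comp \<mu> \<nu> C) (U \<inter> W) = 0" if C: "C \<in> components (E_minus \<mu> \<nu>)" for C
    proof -
      have "C \<inter> (U \<inter> W) = {}" using in_components_subset[OF C] by (auto simp: W_def E_eq_def)
      moreover have "\<not> (bdd_above C \<and> Sup C \<in> U \<inter> W)" using C by (auto simp: W_def B_def endpoints_def)
      moreover have "C \<in> sets borel" using components_interval C by (auto simp: open_interval_def)
      ultimately show ?thesis using U W M.M_is_borel
        by (auto simp: mu_minus_comp_def emeasure_add_measure emeasure_dirac_right emeasure_restr)
    qed
    then show ?thesis using U W by (simp add: mu_minus_def emeasure_sum_measures nn_integral_0_iff_AE AE_count_space)
  qed
  \<comment> \<open>This set is contained in the union of \<open>E_plus\<close> and
    \<open>E_minus\<close>, where no good point of \<open>stay_set\<close> has its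
    coordinate.\<close>
  have "emeasure \<rho> (U - B - W) = 0"
  proof -
    have "AE z in \<pi>. z \<notin> stay_set \<inter> {z. fst z \<in> U - B - W}"
      using optimal_AE_good[OF opt]
    proof eventually_elim
      case (elim z)
      then show ?case using good_stay[OF elim] by (auto simp: W_def E_eq_def)
    qed
    then have AE: "AE z in \<pi>. z \<in> stay_set \<inter> {z. fst z \<in> U - B - W} \<longleftrightarrow> z \<in> {}"
      by eventually_elim blast
    have s: "U - B - W \<in> sets borel" using U B W by auto
    have "emeasure \<rho> (U - B - W) = emeasure \<pi> {}"
      unfolding \<rho>[OF s] by (rule emeasure_eq_AE[OF AE]) (use stay m[OF s] in blast)+
    then show ?thesis by simp
  qed
  moreover have "U = (U \<inter> W) \<union> (U \<inter> B) \<union> (U - B - W)" by blast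
  moreover have "emeasure \<rho> ((U \<inter> W) \<union> (U \<inter> B) \<union> (U - B - W)) = emeasure \<rho> (U \<inter> W) + emeasure \<rho> (U \<inter> B) + emeasure \<rho> (U - B - W)"
  proof -
    have d: "(U \<inter> W) \<inter> (U \<inter> B) = {}" "(U \<inter> W \<union> U \<inter> B) \<inter> (U - B - W) = {}" by (auto simp: W_def)
    have s: "U \<inter> W \<in> sets \<rho>" "U \<inter> B \<in> sets \<rho>" "U - B - W \<in> sets \<rho>" using U B W by (auto simp: \<rho>_sets)
    show ?thesis
      using plus_emeasure[OF s(1,2) d(1)] plus_emeasure[OF sets.Un[OF s(1,2)] s(3) d(2)] by simp
  qed
  ultimately have "emeasure \<rho> U = emeasure \<rho> (U \<inter> W) + emeasure \<rho> (U \<inter> B)" by simp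
  also have "emeasure \<rho> (U \<inter> W) = emeasure \<mu> (U \<inter> W)"
    using marg[of "U \<inter> W"] U W comp0 comp1 by simp
  also have "emeasure \<rho> (U \<inter> B) = (\<integral>\<^sup>+x. emeasure \<rho> (U \<inter> {x}) \<partial>count_space B)"
  proof -
    have "U \<inter> B = (\<Union>x\<in>B. U \<inter> {x})" by auto
    moreover have "emeasure \<rho> (\<Union>x\<in>B. U \<inter> {x}) = (\<integral>\<^sup>+x. emeasure \<rho> (U \<inter> {x}) \<partial>count_space B)"
      by (rule emeasure_UN_countable) (use U cB in \<open>auto simp: \<rho>_sets disjoint_family_on_def\<close>)
    ultimately show ?thesis by simp
  qed
  also have "\<dots> = (\<integral>\<^sup>+x. emeasure (scale_measure
                 (ennreal (measure \<mu> {x} - measure (mu_plus \<mu> \<nu>) {x} - measure (mu_minus \<mu> \<nu>) {x}))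
                 (return borel x)) U \<partial>count_space B)"
    using U by (intro nn_integral_cong) (auto simp: \<rho>_atom[symmetric] split: split_indicator)
  finally show ?thesis
    unfolding mu_eq_def B_def[symmetric] W_def[symmetric] \<rho>[OF U, symmetric]
    using U W M.M_is_borel
    by (simp add: emeasure_add_measure emeasure_restr emeasure_sum_measures Int_commute)
qed

text \<open>The three terms of \<open>optimal_split\<close> are those of
  \<open>Kellerer_plan\<close>: strips, mirrored strips, and the diagonal copy of
  \<open>mu_eq\<close>, which is the resting mass by \<open>mu_eq_stay\<close>.\<close>

theorem Kellerer_plan_eq:
  assumes opt: "optimal \<pi>"
    and plus: "\<And>C. C \<in> components (E_plus \<mu> \<nu>) \<Longrightarrow>
      Kellerer_F (mu_plus_comp \<mu> \<nu> C) (nu_plus_comp \<mu> \<nu> C) = restr \<pi> (strip C)"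
    and minus: "\<And>C. C \<in> components (E_plus \<nu> \<mu>) \<Longrightarrow>
      Kellerer_F (mu_plus_comp \<nu> \<mu> C) (nu_plus_comp \<nu> \<mu> C) = restr (swap_plan \<pi>) (strip C)"
  shows "Kellerer_plan \<mu> \<nu> = \<pi>"
proof (rule measure_eqI)
  have \<pi>: "\<pi> \<in> Marg \<mu> \<nu>" using opt by (simp add: optimal_def)
  note sets = MargD(1)[OF \<pi>]
  show "sets (Kellerer_plan \<mu> \<nu>) = sets \<pi>" by (simp add: Kellerer_plan_def sets)
  fix A assume "A \<in> sets (Kellerer_plan \<mu> \<nu>)"
  then have A: "A \<in> sets borel" by (simp add: Kellerer_plan_def)
  have strip: "strip C \<in> sets \<pi>" "strip C \<in> sets (swap_plan \<pi>)" for C using strip_borel sets by auto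
  have 1: "emeasure (sum_measures (components (E_plus \<mu> \<nu>))
       (\<lambda>C. Kellerer_F (mu_plus_comp \<mu> \<nu> C) (nu_plus_comp \<mu> \<nu> C))) A
     = (\<integral>\<^sup>+C. emeasure \<pi> (strip C \<inter> A) \<partial>count_space (components (E_plus \<mu> \<nu>)))"
    using A strip by (subst emeasure_sum_measures) (auto simp: plus sets emeasure_restr intro!: nn_integral_cong)
  have 2: "emeasure (sum_measures (components (E_minus \<mu> \<nu>))
       (\<lambda>C. Kellerer_F_tilde (mu_minus_comp \<mu> \<nu> C) (nu_minus_comp \<mu> \<nu> C))) A
     = (\<integral>\<^sup>+C. emeasure (swap_plan \<pi>) (strip C \<inter> {z. (snd z, fst z) \<in> A}) \<partial>count_space (components (E_minus \<mu> \<nu>)))"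
    using A strip swap_sets[OF A] 
    by (subst emeasure_sum_measures)
       (auto simp: Kellerer_F_tilde_def minus_comp_eq M.M_is_borel N.M_is_borel minus E_minus_swap
          emeasure_swap_plan emeasure_restr intro!: nn_integral_cong)
  have 3: "emeasure (distr (mu_eq \<mu> \<nu>) borel (\<lambda>x. (x, x))) A = emeasure \<pi> (stay_set \<inter> A)"
  proof -
    have "(\<lambda>x. (x, x)) \<in> (borel :: real measure) \<rightarrow>\<^sub>M (borel :: (real \<times> real) measure)"
      unfolding borel_prod[symmetric] by measurable
    moreover have sb: "sets (mu_eq \<mu> \<nu>) = sets borel" by (simp add: mu_eq_def)
    ultimately have m: "(\<lambda>x. (x, x)) \<in> mu_eq \<mu> \<nu> \<rightarrow>\<^sub>M (borel :: (real \<times> real) measure)"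
      using measurable_cong_sets[OF sb refl] by blast
    have sp: "space (mu_eq \<mu> \<nu>) = UNIV"
      using sets_eq_imp_space_eq[OF sb] by simp
    have D: "{x. (x, x) \<in> A} \<in> sets borel"
      using measurable_sets[OF m A] sp by (simp add: vimage_def sb)
    have mD: "{z. fst z \<in> {x. (x, x) \<in> A}} \<in> sets \<pi>"
      using vimage_fst_snd_borel(1)[OF D] sets by simp
    have "emeasure (distr (mu_eq \<mu> \<nu>) borel (\<lambda>x. (x, x))) A = emeasure (mu_eq \<mu> \<nu>) {x. (x, x) \<in> A}"
      using emeasure_distr[OF m A] sp by (simp add: vimage_def)
    also have "\<dots> = emeasure \<pi> (stay_set \<inter> {z. fst z \<in> {x. (x, x) \<in> A}})"
      by (rule mu_eq_stay[OF opt D])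
    also have "\<dots> = emeasure \<pi> (stay_set \<inter> A)"
    proof (rule emeasure_eq_AE)
      show "AE z in \<pi>. z \<in> stay_set \<inter> {z. fst z \<in> {x. (x, x) \<in> A}} \<longleftrightarrow> z \<in> stay_set \<inter> A"
        using optimal_AE_good[OF opt]
      proof eventually_elim
        case (elim z)
        then show ?case using good_stay(1)[OF elim] by (cases z) auto
      qed
    qed (use mD stay_set_borel A sets in auto)
    finally show ?thesis .
  qed
  show "emeasure (Kellerer_plan \<mu> \<nu>) A = emeasure \<pi> A"
    unfolding Kellerer_plan_def optimal_split[OF opt A] using A 1 2 3 by (simp add: emeasure_add_measure)
qed

end

section \<open>Existence of Kellerer plans\<close>

lemma from_set_greater: "open_interval C \<Longrightarrow> c \<in> C \<Longrightarrow> x \<in> from_set C \<Longrightarrow> c < x \<Longrightarrow> x \<in> C"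
  by (metis cInf_lower from_set_cases not_le)

lemma to_set_less: "open_interval C \<Longrightarrow> c \<in> C \<Longrightarrow> x \<in> to_set C \<Longrightarrow> x < c \<Longrightarrow> x \<in> C"
  by (metis cSup_upper to_set_cases not_le)

lemma F_set_borel: "F_set \<in> sets borel"
proof -
  have "{z \<in> space (borel \<Otimes>\<^sub>M borel :: (real \<times> real) measure). fst z \<le> snd z} \<in> sets (borel \<Otimes>\<^sub>M borel)"
    by measurable
  moreover have "F_set = {z. fst z \<le> snd z}" by (auto simp: F_set_def)
  ultimately show ?thesis using sets_borel_pair by (simp add: space_pair_measure)
qed

lemma Times_borel:
  fixes U V :: "real set"
  assumes "U \<in> sets borel" "V \<in> sets borel"
  shows "U \<times> V \<in> sets (borel :: (real \<times> real) measure)"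
  using pair_measureI[OF assms] sets_borel_pair by simp

lemma emeasure_UN_eq_0:
  fixes A :: "nat \<Rightarrow> 'a set"
  assumes "\<And>n. A n \<in> sets M" "\<And>n. emeasure M (A n) = 0"
  shows "emeasure M (\<Union>n. A n) = 0"
  using null_sets_UN[of A M] assms by (auto simp: null_sets_def)

text \<open>By Fubini's theorem only atoms of \<open>M1\<close> can give mass to the
  diagonal.\<close>

lemma AE_diagonal_atom:
  fixes M1 M2 :: "real measure"
  assumes "sigma_finite_measure M1" "sigma_finite_measure M2"
    and sets: "sets M1 = sets borel" "sets M2 = sets borel"
    and N: "countable N" "\<And>x. x \<notin> N \<Longrightarrow> emeasure M1 {x} = 0"
  shows "AE z in M1 \<Otimes>\<^sub>M M2. fst z = snd z \<longrightarrow> fst z \<in> N"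
proof -
  interpret M1: sigma_finite_measure M1 by fact
  interpret M2: sigma_finite_measure M2 by fact
  interpret pair_sigma_finite M1 M2 ..
  define Z :: "(real \<times> real) set" where "Z = {z. fst z = snd z \<and> fst z \<notin> N}"
  have "N \<in> sets borel" by (rule sets.countable[OF _ N(1)]) simp
  then have "{z \<in> space (borel \<Otimes>\<^sub>M borel). fst z = snd z \<and> fst z \<notin> N} \<in> sets (borel \<Otimes>\<^sub>M borel :: (real \<times> real) measure)"
    by measurable
  then have Z: "Z \<in> sets (M1 \<Otimes>\<^sub>M M2)"
    using sets_pair_borel[OF sets] sets_borel_pair by (simp add: Z_def space_pair_measure)
  have "emeasure (M1 \<Otimes>\<^sub>M M2) Z = (\<integral>\<^sup>+y. emeasure M1 ((\<lambda>x. (x, y)) -` Z) \<partial>M2)"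
    by (rule emeasure_pair_measure_alt2[OF Z])
  also have "\<dots> = (\<integral>\<^sup>+y. 0 \<partial>M2)"
  proof (rule nn_integral_cong)
    fix y
    have "(\<lambda>x. (x, y)) -` Z = (if y \<in> N then {} else {y})" by (auto simp: Z_def)
    then show "emeasure M1 ((\<lambda>x. (x, y)) -` Z) = 0" using N(2) by simp
  qed
  finally have "Z \<in> null_sets (M1 \<Otimes>\<^sub>M M2)" using Z by (simp add: null_sets_def)
  from AE_not_in[OF this] show ?thesis by eventually_elim (auto simp: Z_def)
qed

text \<open>The product property on quadrants makes the quotient of the masses of \<open>]-\<infinity>, s] \<times> [t, \<infinity>[\<close> and
  \<open>]-\<infinity>, s] \<times> [s, \<infinity>[\<close> a multiplicative cocycle in \<open>s \<le> t\<close>, which is \<open>B t / B s\<close> for the tail function \<open>B\<close> of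
  the second factor.\<close>

locale quadrant_product = finite_measure \<kappa> for \<kappa> :: "(real \<times> real) measure" +
  fixes C :: "real set" and N :: "real set"
  assumes sets_kappa: "sets \<kappa> = sets borel"
    and C: "open_interval C"
    and supp: "AE z in \<kappa>. z \<in> strip C"
    and product: "\<And>t U V. \<lbrakk>t \<in> C; U \<in> sets borel; V \<in> sets borel; U \<subseteq> {..t}; V \<subseteq> {t..}\<rbrakk> \<Longrightarrow>
      emeasure \<kappa> (U \<times> V) * emeasure \<kappa> ({..t} \<times> {t..}) = emeasure \<kappa> (U \<times> {t..}) * emeasure \<kappa> ({..t} \<times> V)"
    and right_pos: "\<And>t. t \<in> C \<Longrightarrow> emeasure \<kappa> ({..t} \<times> {t<..}) > 0"
    and left_pos: "\<And>t. t \<in> C \<Longrightarrow> emeasure \<kappa> ({..<t} \<times> {t..}) > 0"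
    and N: "countable N" "\<And>x. x \<notin> N \<Longrightarrow> emeasure \<kappa> ({x} \<times> UNIV) = 0"
    and diag: "AE z in \<kappa>. fst z = snd z \<longrightarrow> fst z \<in> N"
begin

definition k :: "real set \<Rightarrow> real set \<Rightarrow> real" where
  "k U V = measure \<kappa> (U \<times> V)"

lemma Times_sets [simp]: "U \<in> sets borel \<Longrightarrow> V \<in> sets borel \<Longrightarrow> U \<times> V \<in> sets \<kappa>"
  using Times_borel sets_kappa by simp

lemma k_product:
  assumes "t \<in> C" "U \<in> sets borel" "V \<in> sets borel" "U \<subseteq> {..t}" "V \<subseteq> {t..}"
  shows "k U V * k {..t} {t..} = k U {t..} * k {..t} V"
  using product[OF assms] by (simp add: emeasure_eq_measure k_def flip: ennreal_mult)

lemma k_mono: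
  assumes "U \<subseteq> U'" "V \<subseteq> V'" "U' \<in> sets borel" "V' \<in> sets borel"
  shows "k U V \<le> k U' V'"
  unfolding k_def by (rule finite_measure_mono) (use assms in auto)

lemma k_nonneg [simp]: "0 \<le> k U V" by (simp add: k_def)

lemma C_between: "s \<in> C \<Longrightarrow> t \<in> C \<Longrightarrow> s \<le> r \<Longrightarrow> r \<le> t \<Longrightarrow> r \<in> C"
  using C connectedD_interval unfolding open_interval_def by blast

text \<open>Positivity is assumed for crossings of a single level and spreads to pairs of levels by
  the product property. At the first level \<open>T\<close> where the mass from \<open>{..s}\<close>
  to \<open>{r..}\<close> dies out, the product property at \<open>T\<close> or just below it would
  equate 0 with a positive product.\<close>

lemma k_pos:
  assumes s: "s \<in> C" and t: "t \<in> C" and st: "s \<le> t"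
  shows "0 < k {..s} {t..}"
proof (rule ccontr)
  assume "\<not> ?thesis"
  then have zero: "k {..s} {t..} = 0" using k_nonneg[of "{..s}" "{t..}"] by linarith
  define Z where "Z = {r. s \<le> r \<and> r \<le> t \<and> k {..s} {r..} = 0}"
  define T where "T = Inf Z"
  have tZ: "t \<in> Z" using zero st by (simp add: Z_def)
  have bdd: "bdd_below Z" by (auto simp: Z_def)
  have T: "s \<le> T" "T \<le> t"
    using tZ bdd by (auto simp: T_def Z_def intro!: cInf_lower cInf_greatest)
  have TC: "T \<in> C" using C_between s t T by blast
  have below: "0 < k {..s} {r..}" if "s \<le> r" "r < T" for r
  proof -
    have "r \<notin> Z" using that cInf_lower[OF _ bdd] by (force simp: T_def)
    then have "k {..s} {r..} \<noteq> 0" using that T by (auto simp: Z_def)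
    then show ?thesis using k_nonneg[of "{..s}" "{r..}"] by linarith
  qed
  have above: "k {..s} {r..} = 0" if r: "T < r" for r
  proof -
    obtain z where "z \<in> Z" "z < r" using cInf_lessD[of Z r] tZ r unfolding T_def by blast
    then have "{r..} \<subseteq> {z..}" and z0: "k {..s} {z..} = 0" by (auto simp: Z_def)
    then have "k {..s} {r..} \<le> k {..s} {z..}" by (intro k_mono) auto
    then show ?thesis using z0 k_nonneg[of "{..s}" "{r..}"] by linarith
  qed
  show False
  proof (cases "k {..s} {T..} > 0")
    \<comment> \<open>The mass survives at \<open>T\<close> but not beyond: \<open>right_pos\<close>
      provides a target beyond \<open>T\<close>, and the product property at \<open>T\<close> is
      violated.\<close>
    case True
    have "\<exists>r>T. 0 < k {..T} {r..}"
    proof (rule ccontr)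
      assume "\<not> ?thesis"
      then have "k {..T} {r..} = 0" if "r > T" for r
        using that k_nonneg[of "{..T}" "{r..}"] by (metis order_le_less)
      then have "emeasure \<kappa> ({..T} \<times> {T + 1 / Suc n..}) = 0" for n
        by (simp add: k_def emeasure_eq_measure)
      then have "emeasure \<kappa> (\<Union>n. {..T} \<times> {T + 1 / Suc n..}) = 0"
        by (intro emeasure_UN_eq_0) auto
      moreover have "(\<Union>n. {..T} \<times> {T + 1 / Suc n..}) = {..T} \<times> {T<..}"
      proof (rule set_eqI, rule iffI)
        fix z assume "z \<in> {..T} \<times> {T<..}"
        then have z: "fst z \<le> T" "0 < snd z - T" by auto
        then obtain n :: nat where "1 / Suc n < snd z - T"
          using reals_Archimedean unfolding inverse_eq_divide by blast
        then show "z \<in> (\<Union>n. {..T} \<times> {T + 1 / Suc n..})"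
          using z by (intro UN_I[of n]) (auto simp: mem_Times_iff)
      next
        fix z assume "z \<in> (\<Union>n. {..T} \<times> {T + 1 / Suc n..})"
        then obtain n :: nat where z: "fst z \<le> T" "T + 1 / real (Suc n) \<le> snd z" by auto
        have "T < T + 1 / real (Suc n)" by simp
        also have "\<dots> \<le> snd z" by (rule z)
        finally show "z \<in> {..T} \<times> {T<..}" using z by (simp add: mem_Times_iff)
      qed
      ultimately show False using right_pos[OF TC] by simp
    qed
    then obtain r where r: "r > T" "0 < k {..T} {r..}" by blast
    have "k {..s} {r..} * k {..T} {T..} = k {..s} {T..} * k {..T} {r..}"
      by (rule k_product[OF TC]) (use r T in auto)
    then show False using True r above[OF r(1)] by simp
  next
    \<comment> \<open>The mass is gone at \<open>T\<close> but not before: \<open>left_pos\<close>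
      provides a source before \<open>T\<close>, and the product property at \<open>r\<close> is
      violated.\<close>
    case False
    then have T0: "k {..s} {T..} = 0" using k_nonneg[of "{..s}" "{T..}"] by linarith
    have sT: "s < T"
    proof (rule ccontr)
      assume "\<not> ?thesis"
      then have "s = T" using T by simp
      moreover have "{T<..} \<subseteq> {T..}" by auto
      ultimately have "k {..T} {T<..} \<le> 0" using k_mono[of "{..T}" "{..T}" "{T<..}" "{T..}"] T0 by simp
      then show False using right_pos[OF TC] by (simp add: k_def emeasure_eq_measure)
    qed
    have "\<exists>r<T. 0 < k {..r} {T..}"
    proof (rule ccontr)
      assume "\<not> ?thesis"
      then have "k {..r} {T..} = 0" if "r < T" for r
        using that k_nonneg[of "{..r}" "{T..}"] by (metis order_le_less)
      then have "emeasure \<kappa> ({..T - 1 / Suc n} \<times> {T..}) = 0" for n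
        by (simp add: k_def emeasure_eq_measure)
      then have "emeasure \<kappa> (\<Union>n. {..T - 1 / Suc n} \<times> {T..}) = 0"
        by (intro emeasure_UN_eq_0) auto
      moreover have "(\<Union>n. {..T - 1 / Suc n} \<times> {T..}) = {..<T} \<times> {T..}"
      proof (rule set_eqI, rule iffI)
        fix z assume "z \<in> {..<T} \<times> {T..}"
        then have z: "0 < T - fst z" "T \<le> snd z" by auto
        then obtain n :: nat where "1 / Suc n < T - fst z"
          using reals_Archimedean unfolding inverse_eq_divide by blast
        then show "z \<in> (\<Union>n. {..T - 1 / Suc n} \<times> {T..})"
          using z by (intro UN_I[of n]) (auto simp: mem_Times_iff)
      next
        fix z assume "z \<in> (\<Union>n. {..T - 1 / Suc n} \<times> {T..})"
        then obtain n :: nat where z: "fst z \<le> T - 1 / real (Suc n)" "T \<le> snd z" by auto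
        note z(1)
        also have "T - 1 / real (Suc n) < T" by simp
        finally show "z \<in> {..<T} \<times> {T..}" using z by (simp add: mem_Times_iff)
      qed
      ultimately show False using left_pos[OF TC] by simp
    qed
    then obtain r' where r': "r' < T" "0 < k {..r'} {T..}" by blast
    define r where "r = max r' s"
    have r: "s \<le> r" "r < T" "0 < k {..r} {T..}"
    proof -
      show "s \<le> r" "r < T" using r' sT by (auto simp: r_def)
      have "k {..r'} {T..} \<le> k {..r} {T..}" by (rule k_mono) (auto simp: r_def)
      then show "0 < k {..r} {T..}" using r' by simp
    qed
    have rC: "r \<in> C" using C_between[OF s TC] r by simp
    have "k {..s} {T..} * k {..r} {r..} = k {..s} {r..} * k {..r} {T..}"
      by (rule k_product[OF rC]) (use r in auto)
    then show False using T0 below[OF r(1,2)] r(3) by simp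
  qed
qed

section \<open>The distribution functions of the two factors\<close>

definition cocycle :: "real \<Rightarrow> real \<Rightarrow> real" where
  "cocycle s t = k {..s} {t..} / k {..s} {s..}"

lemma cocycle_pos: "s \<in> C \<Longrightarrow> t \<in> C \<Longrightarrow> s \<le> t \<Longrightarrow> 0 < cocycle s t"
  by (simp add: cocycle_def k_pos)

lemma cocycle_mult:
  assumes "s \<in> C" "t \<in> C" "u \<in> C" "s \<le> t" "t \<le> u"
  shows "cocycle s u = cocycle s t * cocycle t u"
proof -
  have "k {..s} {u..} * k {..t} {t..} = k {..s} {t..} * k {..t} {u..}"
    by (rule k_product) (use assms in auto)
  moreover have "0 < k {..t} {t..}" "0 < k {..s} {s..}" using k_pos assms by auto
  ultimately show ?thesis by (simp add: cocycle_def field_simps)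
qed

definition base :: real where "base = (SOME x. x \<in> C)"

lemma base: "base \<in> C"
  using C unfolding base_def open_interval_def by (meson ex_in_conv someI_ex)

text \<open>The potential of the cocycle, normalized to 1 at \<open>base\<close>. Below
  \<open>base\<close> the inverse is taken, as multiplicativity is available for ordered
  levels.\<close>

definition B :: "real \<Rightarrow> real" where
  "B t = (if base \<le> t then cocycle base t else 1 / cocycle t base)"

lemma B_pos: "t \<in> C \<Longrightarrow> 0 < B t"
  using cocycle_pos base by (auto simp: B_def)

lemma B_cocycle:
  assumes "s \<in> C" "t \<in> C" "s \<le> t"
  shows "B t = B s * cocycle s t"
proof -
  consider "base \<le> s" | "s < base" "base \<le> t" | "t < base" by linarith
  then show ?thesis
  proof cases
    case 1
    then show ?thesis using cocycle_mult[OF base assms(1,2) 1 assms(3)] assms by (simp add: B_def)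
  next
    case 2
    then show ?thesis
      using cocycle_mult[OF assms(1) base assms(2)] cocycle_pos[OF assms(1) base] by (simp add: B_def)
  next
    case 3
    then show ?thesis
      using cocycle_mult[OF assms(1,2) base assms(3)] cocycle_pos[OF assms(1) base] cocycle_pos[OF assms(2) base]
        cocycle_pos[OF assms] assms
      by (simp add: B_def)
  qed
qed

text \<open>Chosen so that \<open>A t * B t\<close> is the mass of the quadrant at \<open>t\<close>.
  By \<open>eta1_eq\<close> and \<open>eta2_eq\<close>, for \<open>t\<close> in \<open>C\<close>,
  these numbers become the mass of \<open>{..t}\<close> under \<open>\<eta>1\<close> and that of
  \<open>{t..}\<close> under \<open>\<eta>2\<close>.\<close>

definition A :: "real \<Rightarrow> real" where "A t = k {..t} {t..} / B t"

lemma A_pos: "t \<in> C \<Longrightarrow> 0 < A t"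
  by (simp add: A_def B_pos k_pos)

text \<open>The marginals of the quadrants at two levels differ by a constant factor on their common
  domain. Division by \<open>B\<close> or \<open>A\<close> removes it, which makes them pieces of a
  single measure.\<close>

lemma consistent_le:
  assumes "s \<in> C" "t \<in> C" "s \<le> t"
  shows "U \<in> sets borel \<Longrightarrow> U \<subseteq> {..s} \<Longrightarrow> k U {t..} / B t = k U {s..} / B s"
    "V \<in> sets borel \<Longrightarrow> V \<subseteq> {t..} \<Longrightarrow> k {..s} V / A s = k {..t} V / A t"
proof -
  have pos: "0 < k {..s} {s..}" "0 < k {..t} {t..}" "0 < B s" "0 < B t" "0 < k {..s} {t..}"
    using k_pos B_pos assms by auto
  have Bt: "B t * k {..s} {s..} = B s * k {..s} {t..}"
    using B_cocycle[OF assms] pos by (simp add: cocycle_def)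
  show "k U {t..} / B t = k U {s..} / B s" if "U \<in> sets borel" "U \<subseteq> {..s}"
  proof -
    have "k U {t..} * k {..s} {s..} = k U {s..} * k {..s} {t..}"
      by (rule k_product[OF assms(1)]) (use that assms in auto)
    then have "k U {t..} * (B t * k {..s} {s..}) * B s = k U {s..} * (B s * k {..s} {t..}) * B t"
      by (simp add: mult_ac)
    then have "(k U {t..} * B s) * (B s * k {..s} {t..}) = (k U {s..} * B t) * (B s * k {..s} {t..})"
      unfolding Bt by (simp add: mult_ac)
    then have "k U {t..} * B s = k U {s..} * B t" using pos by simp
    then show ?thesis using pos by (simp add: frac_eq_eq)
  qed
  show "k {..s} V / A s = k {..t} V / A t" if "V \<in> sets borel" "V \<subseteq> {t..}"
  proof -
    have "k {..s} V * k {..t} {t..} = k {..s} {t..} * k {..t} V"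
      by (rule k_product[OF assms(2)]) (use that assms in auto)
    then have "k {..s} V = k {..s} {t..} * k {..t} V / k {..t} {t..}" using pos by (simp add: eq_divide_eq)
    then have "k {..s} V * B s / k {..s} {s..} = (B s * k {..s} {t..}) * k {..t} V / k {..t} {t..} / k {..s} {s..}"
      by (simp add: mult_ac)
    also have "\<dots> = k {..t} V * B t / k {..t} {t..}"
      unfolding Bt[symmetric] using pos by simp
    finally show ?thesis by (simp add: A_def)
  qed
qed

lemma consistent:
  assumes "s \<in> C" "t \<in> C"
  shows "U \<in> sets borel \<Longrightarrow> U \<subseteq> {..s} \<Longrightarrow> U \<subseteq> {..t} \<Longrightarrow> k U {t..} / B t = k U {s..} / B s"
    "V \<in> sets borel \<Longrightarrow> V \<subseteq> {s..} \<Longrightarrow> V \<subseteq> {t..} \<Longrightarrow> k {..s} V / A s = k {..t} V / A t"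
  using consistent_le[of s t] consistent_le[of t s] assms by (metis linear)+

text \<open>The countably many levels used for gluing. Rationals separate the coordinates of points
  off the diagonal; the points of \<open>N\<close> are levels themselves so that the atoms on the
  diagonal are covered.\<close>

definition T :: "real set" where "T = C \<inter> (\<rat> \<union> N)"

definition t :: "nat \<Rightarrow> real" where "t = from_nat_into T"

lemma countable_T: "countable T" using N(1) countable_rat by (auto simp: T_def intro: countable_Int2)

lemma C_open: "open C" using C by (simp add: open_interval_def)

lemma rational_between:
  assumes "x \<in> from_set C" "y \<in> to_set C" "x < y"
  obtains n where "x < t n" "t n < y"
proof -
  obtain q where q: "q \<in> \<rat>" "x < q" "q < y" using Rats_dense_in_real[OF assms(3)] by blast
  have "q \<in> C" using mem_open_interval[OF C, of q] assms q by (auto simp: from_set_def to_set_def)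
  then have "q \<in> T" using q by (simp add: T_def)
  then obtain n where "t n = q" using from_nat_into_surj[OF countable_T] by (auto simp: t_def)
  then show ?thesis using that q by blast
qed

lemma T_nonempty: "T \<noteq> {}"
proof -
  obtain e where "e > 0" "ball base e \<subseteq> C" using C_open base by (meson open_contains_ball)
  moreover obtain q where "q \<in> \<rat>" "base < q" "q < base + e" using Rats_dense_in_real[of base "base + e"] \<open>e > 0\<close> by auto
  ultimately have "q \<in> C" by (auto simp: dist_real_def)
  then show ?thesis using \<open>q \<in> \<rat>\<close> by (auto simp: T_def)
qed

lemma t_in_C: "t n \<in> C"
  using from_nat_into[OF T_nonempty, of n] by (simp add: t_def T_def)

lemma t_surj: "x \<in> C \<Longrightarrow> x \<in> N \<Longrightarrow> \<exists>n. t n = x"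
  using from_nat_into_surj[OF countable_T, of x] by (auto simp: t_def T_def)

lemma t_cofinal:
  assumes x: "x \<in> C"
  shows "\<exists>n. x \<le> t n" "\<exists>n. t n \<le> x"
proof -
  obtain e where e: "e > 0" "ball x e \<subseteq> C" using C_open x by (meson open_contains_ball)
  have "x + e / 2 \<in> ball x e" "x - e / 2 \<in> ball x e" using e(1) by (auto simp: dist_real_def)
  then have "x + e / 2 \<in> C" "x - e / 2 \<in> C" using e(2) by auto
  then have m: "x \<in> from_set C" "x \<in> to_set C" "x + e / 2 \<in> to_set C" "x - e / 2 \<in> from_set C"
    using open_interval_eq[OF C] x by auto
  show "\<exists>n. x \<le> t n" using rational_between[OF m(1,3)] e(1) by (metis less_add_same_cancel1 half_gt_zero less_imp_le)
  show "\<exists>n. t n \<le> x"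
    using rational_between[OF m(4,2)] e(1) by (metis diff_less_eq less_add_same_cancel1 half_gt_zero less_imp_le)
qed

text \<open>The pieces at the levels \<open>t n\<close> overlap, so each one is used only on the
  part of \<open>{..t n}\<close> that its predecessors leave uncovered. Written as the projection of
  a density on \<open>\<kappa>\<close>, the sum of the pieces is a measure by construction.\<close>

definition \<eta>1 :: "real measure" where
  "\<eta>1 = distr (density \<kappa> (\<lambda>z. \<Sum>n. ennreal (1 / B (t n)) *
     indicator (disjointed (\<lambda>n. {..t n}) n \<times> {t n..}) z)) borel fst"

definition \<eta>2 :: "real measure" where
  "\<eta>2 = distr (density \<kappa> (\<lambda>z. \<Sum>n. ennreal (1 / A (t n)) *
     indicator ({..t n} \<times> disjointed (\<lambda>n. {t n..}) n) z)) borel snd"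

lemma disjointed_borel [simp]:
  "disjointed (\<lambda>n. {..t n}) n \<in> sets borel" "disjointed (\<lambda>n. {t n..}) n \<in> sets borel"
  by (auto simp: disjointed_def)

lemma fst_snd_m: "fst \<in> measurable \<kappa> borel" "snd \<in> measurable \<kappa> borel"
  using sets_borel_fst_snd[OF sets_kappa] .

lemma space_kappa: "space \<kappa> = UNIV"
  using sets_eq_imp_space_eq[OF sets_kappa] by simp

lemma emeasure_eta1:
  assumes U: "U \<in> sets borel"
  shows "emeasure \<eta>1 U = (\<Sum>n. ennreal (k (U \<inter> disjointed (\<lambda>n. {..t n}) n) {t n..} / B (t n)))"
proof -
  let ?D = "disjointed (\<lambda>n. {..t n})"
  note [measurable] = fst_snd_m
  have vU: "{z. fst z \<in> U} \<in> sets \<kappa>"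
    using measurable_sets[OF fst_snd_m(1) U] by (simp add: vimage_def space_kappa)
  have "emeasure \<eta>1 U = emeasure (density \<kappa> (\<lambda>z. \<Sum>n. ennreal (1 / B (t n)) * indicator (?D n \<times> {t n..}) z)) {z. fst z \<in> U}"
    unfolding \<eta>1_def using U fst_snd_m(1) by (subst emeasure_distr) (auto simp: vimage_def space_kappa)
  also have "\<dots> = (\<integral>\<^sup>+z. (\<Sum>n. ennreal (1 / B (t n)) * indicator (?D n \<times> {t n..}) z) * indicator {z. fst z \<in> U} z \<partial>\<kappa>)"
  proof (intro emeasure_density vU borel_measurable_suminf_order)
    fix n
    have "?D n \<times> {t n..} \<in> sets \<kappa>" by simp
    then show "(\<lambda>z. ennreal (1 / B (t n)) * indicator (?D n \<times> {t n..}) z) \<in> borel_measurable \<kappa>"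
      by (intro borel_measurable_times_ennreal borel_measurable_indicator borel_measurable_const)
  qed
  also have "\<dots> = (\<integral>\<^sup>+z. (\<Sum>n. ennreal (1 / B (t n)) * indicator ((U \<inter> ?D n) \<times> {t n..}) z) \<partial>\<kappa>)"
    by (rule nn_integral_cong) (auto simp: indicator_def)
  also have "\<dots> = (\<Sum>n. \<integral>\<^sup>+z. ennreal (1 / B (t n)) * indicator ((U \<inter> ?D n) \<times> {t n..}) z \<partial>\<kappa>)"
  proof (rule nn_integral_suminf)
    fix n
    have "(U \<inter> ?D n) \<times> {t n..} \<in> sets \<kappa>" using U by (intro Times_sets sets.Int) auto
    then show "(\<lambda>z. ennreal (1 / B (t n)) * indicator ((U \<inter> ?D n) \<times> {t n..}) z) \<in> borel_measurable \<kappa>"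
      by (intro borel_measurable_times_ennreal borel_measurable_indicator borel_measurable_const)
  qed
  also have "(\<lambda>n. \<integral>\<^sup>+z. ennreal (1 / B (t n)) * indicator ((U \<inter> ?D n) \<times> {t n..}) z \<partial>\<kappa>)
    = (\<lambda>n. ennreal (k (U \<inter> ?D n) {t n..} / B (t n)))"
  proof
    fix n
    have "0 < B (t n)" by (rule B_pos[OF t_in_C])
    then show "(\<integral>\<^sup>+z. ennreal (1 / B (t n)) * indicator ((U \<inter> ?D n) \<times> {t n..}) z \<partial>\<kappa>) = ennreal (k (U \<inter> ?D n) {t n..} / B (t n))"
    proof -
      have "(U \<inter> ?D n) \<times> {t n..} \<in> sets \<kappa>" using U by (intro Times_sets sets.Int) auto
      then show ?thesis
        using \<open>0 < B (t n)\<close> by (simp add: nn_integral_cmult_indicator emeasure_eq_measure k_def flip: ennreal_mult)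
    qed
  qed
  finally show ?thesis .
qed

lemma emeasure_eta2:
  assumes V: "V \<in> sets borel"
  shows "emeasure \<eta>2 V = (\<Sum>n. ennreal (k {..t n} (V \<inter> disjointed (\<lambda>n. {t n..}) n) / A (t n)))"
proof -
  let ?D = "disjointed (\<lambda>n. {t n..})"
  note [measurable] = fst_snd_m
  have vV: "{z. snd z \<in> V} \<in> sets \<kappa>"
    using measurable_sets[OF fst_snd_m(2) V] by (simp add: vimage_def space_kappa)
  have "emeasure \<eta>2 V = emeasure (density \<kappa> (\<lambda>z. \<Sum>n. ennreal (1 / A (t n)) * indicator ({..t n} \<times> ?D n) z)) {z. snd z \<in> V}"
    unfolding \<eta>2_def using V fst_snd_m(2) by (subst emeasure_distr) (auto simp: vimage_def space_kappa)
  also have "\<dots> = (\<integral>\<^sup>+z. (\<Sum>n. ennreal (1 / A (t n)) * indicator ({..t n} \<times> ?D n) z) * indicator {z. snd z \<in> V} z \<partial>\<kappa>)"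
  proof (intro emeasure_density vV borel_measurable_suminf_order)
    fix n
    have "{..t n} \<times> ?D n \<in> sets \<kappa>" by simp
    then show "(\<lambda>z. ennreal (1 / A (t n)) * indicator ({..t n} \<times> ?D n) z) \<in> borel_measurable \<kappa>"
      by (intro borel_measurable_times_ennreal borel_measurable_indicator borel_measurable_const)
  qed
  also have "\<dots> = (\<integral>\<^sup>+z. (\<Sum>n. ennreal (1 / A (t n)) * indicator ({..t n} \<times> (V \<inter> ?D n)) z) \<partial>\<kappa>)"
    by (rule nn_integral_cong) (auto simp: indicator_def)
  also have "\<dots> = (\<Sum>n. \<integral>\<^sup>+z. ennreal (1 / A (t n)) * indicator ({..t n} \<times> (V \<inter> ?D n)) z \<partial>\<kappa>)"
  proof (rule nn_integral_suminf)
    fix n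
    have "{..t n} \<times> (V \<inter> ?D n) \<in> sets \<kappa>" using V by (intro Times_sets sets.Int) auto
    then show "(\<lambda>z. ennreal (1 / A (t n)) * indicator ({..t n} \<times> (V \<inter> ?D n)) z) \<in> borel_measurable \<kappa>"
      by (intro borel_measurable_times_ennreal borel_measurable_indicator borel_measurable_const)
  qed
  also have "(\<lambda>n. \<integral>\<^sup>+z. ennreal (1 / A (t n)) * indicator ({..t n} \<times> (V \<inter> ?D n)) z \<partial>\<kappa>)
    = (\<lambda>n. ennreal (k {..t n} (V \<inter> ?D n) / A (t n)))"
  proof
    fix n
    have "0 < A (t n)" by (rule A_pos[OF t_in_C])
    then show "(\<integral>\<^sup>+z. ennreal (1 / A (t n)) * indicator ({..t n} \<times> (V \<inter> ?D n)) z \<partial>\<kappa>) = ennreal (k {..t n} (V \<inter> ?D n) / A (t n))"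
    proof -
      have "{..t n} \<times> (V \<inter> ?D n) \<in> sets \<kappa>" using V by (intro Times_sets sets.Int) auto
      then show ?thesis
        using \<open>0 < A (t n)\<close> by (simp add: nn_integral_cmult_indicator emeasure_eq_measure k_def flip: ennreal_mult)
    qed
  qed
  finally show ?thesis .
qed

text \<open>By consistency each piece can be evaluated at the level \<open>s\<close> instead of
  \<open>t n\<close>; by countable additivity the pieces then add up to the whole of
  \<open>U\<close>.\<close>

lemma eta1_eq:
  assumes s: "s \<in> C" and U: "U \<in> sets borel" "U \<subseteq> {..s}"
  shows "emeasure \<eta>1 U = ennreal (k U {s..} / B s)"
proof -
  let ?D = "disjointed (\<lambda>n. {..t n})"
  have "emeasure \<eta>1 U = (\<Sum>n. ennreal (k (U \<inter> ?D n) {s..} / B s))"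
    unfolding emeasure_eta1[OF U(1)]
  proof (intro suminf_cong arg_cong[where f=ennreal])
    fix n
    have "?D n \<subseteq> {..t n}" by (rule disjointed_subset)
    then show "k (U \<inter> ?D n) {t n..} / B (t n) = k (U \<inter> ?D n) {s..} / B s"
      by (intro consistent(1)[OF s t_in_C]) (use U in auto)
  qed
  also have "\<dots> = (\<Sum>n. emeasure \<kappa> ((U \<inter> ?D n) \<times> {s..})) * ennreal (1 / B s)"
    using B_pos[OF s]
    by (subst ennreal_suminf_multc[symmetric]) (auto simp: emeasure_eq_measure k_def simp flip: ennreal_mult)
  also have "(\<Sum>n. emeasure \<kappa> ((U \<inter> ?D n) \<times> {s..})) = emeasure \<kappa> (\<Union>n. (U \<inter> ?D n) \<times> {s..})"
  proof (rule suminf_emeasure)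
    show "range (\<lambda>n. (U \<inter> ?D n) \<times> {s..}) \<subseteq> sets \<kappa>" using U by (intro image_subsetI Times_sets sets.Int) auto
    show "disjoint_family (\<lambda>n. (U \<inter> ?D n) \<times> {s..})"
      using disjoint_family_disjointed[of "\<lambda>n. {..t n}"] unfolding disjoint_family_on_def by blast
  qed
  also have "(\<Union>n. (U \<inter> ?D n) \<times> {s..}) = U \<times> {s..}"
  proof -
    obtain m where "s \<le> t m" using t_cofinal(1)[OF s] by blast
    then have "{..s} \<subseteq> {..t m}" by simp
    moreover have "{..t m} \<subseteq> (\<Union>n. {..t n})" by (rule UN_upper) simp
    ultimately have "U \<subseteq> (\<Union>n. ?D n)" unfolding UN_disjointed_eq using U(2) by (meson order_trans)
    then have "U \<inter> (\<Union>n. ?D n) = U" by (rule Int_absorb2)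
    moreover have "(\<Union>n. (U \<inter> ?D n) \<times> {s..}) = (U \<inter> (\<Union>n. ?D n)) \<times> {s..}" by blast
    ultimately show ?thesis by simp
  qed
  finally show ?thesis
    using B_pos[OF s] by (simp add: emeasure_eq_measure k_def flip: ennreal_mult)
qed

lemma eta2_eq:
  assumes s: "s \<in> C" and V: "V \<in> sets borel" "V \<subseteq> {s..}"
  shows "emeasure \<eta>2 V = ennreal (k {..s} V / A s)"
proof -
  let ?D = "disjointed (\<lambda>n. {t n..})"
  have "emeasure \<eta>2 V = (\<Sum>n. ennreal (k {..s} (V \<inter> ?D n) / A s))"
    unfolding emeasure_eta2[OF V(1)]
  proof (intro suminf_cong arg_cong[where f=ennreal])
    fix n
    have "?D n \<subseteq> {t n..}" by (rule disjointed_subset)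
    then show "k {..t n} (V \<inter> ?D n) / A (t n) = k {..s} (V \<inter> ?D n) / A s"
      by (intro consistent(2)[OF t_in_C s]) (use V in auto)
  qed
  also have "\<dots> = (\<Sum>n. emeasure \<kappa> ({..s} \<times> (V \<inter> ?D n))) * ennreal (1 / A s)"
    using A_pos[OF s]
    by (subst ennreal_suminf_multc[symmetric]) (auto simp: emeasure_eq_measure k_def simp flip: ennreal_mult)
  also have "(\<Sum>n. emeasure \<kappa> ({..s} \<times> (V \<inter> ?D n))) = emeasure \<kappa> (\<Union>n. {..s} \<times> (V \<inter> ?D n))"
  proof (rule suminf_emeasure)
    show "range (\<lambda>n. {..s} \<times> (V \<inter> ?D n)) \<subseteq> sets \<kappa>" using V by (intro image_subsetI Times_sets sets.Int) auto
    show "disjoint_family (\<lambda>n. {..s} \<times> (V \<inter> ?D n))"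
      using disjoint_family_disjointed[of "\<lambda>n. {t n..}"] unfolding disjoint_family_on_def by blast
  qed
  also have "(\<Union>n. {..s} \<times> (V \<inter> ?D n)) = {..s} \<times> V"
  proof -
    obtain m where "t m \<le> s" using t_cofinal(2)[OF s] by blast
    then have "{s..} \<subseteq> {t m..}" by simp
    moreover have "{t m..} \<subseteq> (\<Union>n. {t n..})" by (rule UN_upper) simp
    ultimately have "V \<subseteq> (\<Union>n. ?D n)" unfolding UN_disjointed_eq using V(2) by (meson order_trans)
    then have "V \<inter> (\<Union>n. ?D n) = V" by (rule Int_absorb2)
    moreover have "(\<Union>n. {..s} \<times> (V \<inter> ?D n)) = {..s} \<times> (V \<inter> (\<Union>n. ?D n))" by blast
    ultimately show ?thesis by simp
  qed
  finally show ?thesis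
    using A_pos[OF s] by (simp add: emeasure_eq_measure k_def flip: ennreal_mult)
qed

lemma eta_sets [simp]: "sets \<eta>1 = sets borel" "sets \<eta>2 = sets borel" "space \<eta>1 = UNIV" "space \<eta>2 = UNIV"
  by (simp_all add: \<eta>1_def \<eta>2_def)

lemma k_eq_0:
  assumes "U \<in> sets borel" "V \<in> sets borel" "U \<inter> from_set C = {} \<or> V \<inter> to_set C = {}"
  shows "k U V = 0"
proof -
  have "emeasure \<kappa> (U \<times> V) = emeasure \<kappa> {}"
  proof (rule emeasure_eq_AE)
    show "AE z in \<kappa>. z \<in> U \<times> V \<longleftrightarrow> z \<in> {}"
      using supp by eventually_elim (use assms(3) in \<open>auto simp: strip_def\<close>)
  qed (use assms in auto)
  then show ?thesis by (simp add: k_def measure_def)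
qed

lemma eta_null:
  assumes "U \<in> sets borel"
  shows "U \<inter> from_set C = {} \<Longrightarrow> emeasure \<eta>1 U = 0" "U \<inter> to_set C = {} \<Longrightarrow> emeasure \<eta>2 U = 0"
  unfolding emeasure_eta1[OF assms] emeasure_eta2[OF assms]
  using assms by (subst k_eq_0; force)+

lemma sigma_finite_eta: "sigma_finite_measure \<eta>1" "sigma_finite_measure \<eta>2"
proof -
  show "sigma_finite_measure \<eta>1"
  proof
    \<comment> \<open>The total mass of \<open>\<eta>1\<close> may be infinite, but it is finite on
      each \<open>{..t n}\<close>, and these sets exhaust \<open>from_set C\<close>.\<close>
    let ?A = "insert (- from_set C) (range (\<lambda>n. {..t n}))"
    have "\<exists>n. x \<le> t n" if "x \<in> from_set C" for x
    proof -
      obtain n where "base \<le> t n" using t_cofinal(1)[OF base] by blast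
      then show ?thesis
      proof (cases "x \<le> base")
        case False
        then have "x \<in> C"
          using from_set_greater[OF C base that] by simp
        then show ?thesis using t_cofinal by blast
      qed (meson order_trans)
    qed
    then have "\<Union> ?A = space \<eta>1" by auto
    moreover have "emeasure \<eta>1 (- from_set C) \<noteq> \<infinity>" by (subst eta_null) auto
    moreover have "emeasure \<eta>1 {..t n} \<noteq> \<infinity>" for n by (subst eta1_eq[OF t_in_C]) auto
    ultimately show "\<exists>A. countable A \<and> A \<subseteq> sets \<eta>1 \<and> \<Union> A = space \<eta>1 \<and> (\<forall>a\<in>A. emeasure \<eta>1 a \<noteq> \<infinity>)"
      by (intro exI[of _ ?A]) auto
  qed
  show "sigma_finite_measure \<eta>2"
  proof
    let ?A = "insert (- to_set C) (range (\<lambda>n. {t n..}))"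
    have "\<exists>n. t n \<le> x" if "x \<in> to_set C" for x
    proof -
      obtain n where "t n \<le> base" using t_cofinal(2)[OF base] by blast
      then show ?thesis
      proof (cases "base \<le> x")
        case False
        then have "x \<in> C"
          using to_set_less[OF C base that] by simp
        then show ?thesis using t_cofinal by blast
      qed (meson order_trans)
    qed
    then have "\<Union> ?A = space \<eta>2" by auto
    moreover have "emeasure \<eta>2 (- to_set C) \<noteq> \<infinity>" by (subst eta_null) auto
    moreover have "emeasure \<eta>2 {t n..} \<noteq> \<infinity>" for n by (subst eta2_eq[OF t_in_C]) auto
    ultimately show "\<exists>A. countable A \<and> A \<subseteq> sets \<eta>2 \<and> \<Union> A = space \<eta>2 \<and> (\<forall>a\<in>A. emeasure \<eta>2 a \<noteq> \<infinity>)"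
      by (intro exI[of _ ?A]) auto
  qed
qed

text \<open>Restricted to the quadrant, both measures equal the product of the restricted finite
  factors, which is determined by its values on rectangles.\<close>

lemma eta_product_eq:
  assumes s: "s \<in> C" and X: "X \<in> sets borel" "X \<subseteq> {..s} \<times> {s..}"
  shows "emeasure \<kappa> X = emeasure (\<eta>1 \<Otimes>\<^sub>M \<eta>2) X"
proof -
  interpret E2: sigma_finite_measure \<eta>2 by (rule sigma_finite_eta)
  let ?M1 = "restr \<eta>1 {..s}" and ?M2 = "restr \<eta>2 {s..}" and ?Q = "{..s} \<times> {s..}"
  have sp: "sets (\<eta>1 \<Otimes>\<^sub>M \<eta>2) = sets borel" and sp': "sets (?M1 \<Otimes>\<^sub>M ?M2) = sets borel"
    by (rule sets_pair_borel; simp)+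
  have Q: "?Q \<in> sets borel" by (rule Times_borel) auto
  have e1: "emeasure ?M1 U = emeasure \<eta>1 ({..s} \<inter> U)" if "U \<in> sets borel" for U
    using emeasure_restr[of "{..s}" \<eta>1 U] that by simp
  have e2: "emeasure ?M2 U = emeasure \<eta>2 ({s..} \<inter> U)" if "U \<in> sets borel" for U
    using emeasure_restr[of "{s..}" \<eta>2 U] that by simp
  have fin1: "finite_measure ?M1"
    using e1[of UNIV] eta1_eq[OF s, of "{..s}"] by (intro finite_measureI) (simp add: restr_def)
  have fin2: "finite_measure ?M2"
    using e2[of UNIV] eta2_eq[OF s, of "{s..}"] by (intro finite_measureI) (simp add: restr_def)
  have sf: "sigma_finite_measure ?M1" "sigma_finite_measure ?M2"
    using fin1 fin2 by (auto simp: finite_measure_def)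
  have 1: "?M1 \<Otimes>\<^sub>M ?M2 = restr \<kappa> ?Q"
  proof (rule pair_measure_eqI[OF sf])
    show "sets (?M1 \<Otimes>\<^sub>M ?M2) = sets (restr \<kappa> ?Q)" using sp' sets_kappa by simp
    fix U V assume "U \<in> sets ?M1" "V \<in> sets ?M2"
    then have U: "U \<in> sets borel" and V: "V \<in> sets borel" by auto
    let ?U = "{..s} \<inter> U" and ?V = "{s..} \<inter> V"
    have "k ?U ?V * k {..s} {s..} = k ?U {s..} * k {..s} ?V"
      by (rule k_product[OF s]) (use U V in auto)
    then have *: "k ?U {s..} / B s * (k {..s} ?V / A s) = k ?U ?V"
      using B_pos[OF s] k_pos[OF s s] by (simp add: A_def divide_simps)
    have "emeasure ?M1 U * emeasure ?M2 V = ennreal (k ?U {s..} / B s) * ennreal (k {..s} ?V / A s)"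
      unfolding e1[OF U] e2[OF V] using eta1_eq[OF s, of ?U] eta2_eq[OF s, of ?V] U V by simp
    also have "\<dots> = ennreal (k ?U ?V)"
      unfolding *[symmetric] using B_pos[OF s] A_pos[OF s] by (intro ennreal_mult[symmetric]) auto
    also have "\<dots> = emeasure \<kappa> (?Q \<inter> U \<times> V)"
      by (simp add: k_def emeasure_eq_measure Times_Int_Times)
    also have "\<dots> = emeasure (restr \<kappa> ?Q) (U \<times> V)"
      by (rule emeasure_restr[symmetric]) (use U V in auto)
    finally show "emeasure ?M1 U * emeasure ?M2 V = emeasure (restr \<kappa> ?Q) (U \<times> V)" .
  qed
  have 2: "?M1 \<Otimes>\<^sub>M ?M2 = restr (\<eta>1 \<Otimes>\<^sub>M \<eta>2) ?Q"
  proof (rule pair_measure_eqI[OF sf])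
    show "sets (?M1 \<Otimes>\<^sub>M ?M2) = sets (restr (\<eta>1 \<Otimes>\<^sub>M \<eta>2) ?Q)" using sp' sp by simp
    fix U V assume "U \<in> sets ?M1" "V \<in> sets ?M2"
    then have U: "U \<in> sets borel" and V: "V \<in> sets borel" by auto
    have "emeasure (restr (\<eta>1 \<Otimes>\<^sub>M \<eta>2) ?Q) (U \<times> V) = emeasure (\<eta>1 \<Otimes>\<^sub>M \<eta>2) (?Q \<inter> U \<times> V)"
      by (rule emeasure_restr) (use U V Q Times_borel sp in auto)
    also have "?Q \<inter> U \<times> V = ({..s} \<inter> U) \<times> ({s..} \<inter> V)" by (rule Times_Int_Times)
    also have "emeasure (\<eta>1 \<Otimes>\<^sub>M \<eta>2) (({..s} \<inter> U) \<times> ({s..} \<inter> V)) = emeasure \<eta>1 ({..s} \<inter> U) * emeasure \<eta>2 ({s..} \<inter> V)"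
      by (rule E2.emeasure_pair_measure_Times) (use U V in auto)
    finally show "emeasure ?M1 U * emeasure ?M2 V = emeasure (restr (\<eta>1 \<Otimes>\<^sub>M \<eta>2) ?Q) (U \<times> V)"
      unfolding e1[OF U] e2[OF V] by simp
  qed
  have "emeasure (restr \<kappa> ?Q) X = emeasure (restr (\<eta>1 \<Otimes>\<^sub>M \<eta>2) ?Q) X" using 1 2 by simp
  moreover have "?Q \<inter> X = X" using X by auto
  ultimately show ?thesis
    using emeasure_restr[of ?Q \<kappa> X] emeasure_restr[of ?Q "\<eta>1 \<Otimes>\<^sub>M \<eta>2" X] Q X sp sets_kappa by simp
qed

text \<open>The quadrants at the levels \<open>t n\<close> cover the strip except for diagonal
  points outside \<open>N\<close>, which neither measure charges. Made disjoint, they allow a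
  comparison piece by piece.\<close>

theorem Kellerer_form: "\<kappa> = restr (\<eta>1 \<Otimes>\<^sub>M \<eta>2) F_set"
proof (rule measure_eqI)
  interpret E1: sigma_finite_measure \<eta>1 by (rule sigma_finite_eta)
  interpret E2: sigma_finite_measure \<eta>2 by (rule sigma_finite_eta)
  interpret E: pair_sigma_finite \<eta>1 \<eta>2 ..
  let ?E = "\<eta>1 \<Otimes>\<^sub>M \<eta>2"
  have sp: "sets ?E = sets borel" by (rule sets_pair_borel) simp_all
  show "sets \<kappa> = sets (restr ?E F_set)" using sp sets_kappa by simp
  fix X assume "X \<in> sets \<kappa>"
  then have X: "X \<in> sets borel" using sets_kappa by simp
  let ?Q = "\<lambda>n. {..t n} \<times> {t n..}"
  let ?D = "disjointed ?Q"
  let ?W = "\<Union>n. ?Q n"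
  have Q: "?Q n \<in> sets borel" for n by (rule Times_borel) auto
  have D: "?D n \<in> sets borel" for n using Q by (auto simp: disjointed_def)
  have W: "?W \<in> sets borel" using Q by blast
  have cover: "z \<in> ?W" if z: "z \<in> strip C" "fst z = snd z \<longrightarrow> fst z \<in> N" for z
  proof (cases "fst z = snd z")
    case True
    then have "fst z \<in> C" using z open_interval_eq[OF C] by (auto simp: strip_def)
    then obtain n where "t n = fst z" using t_surj z True by blast
    then show ?thesis using True by (intro UN_I[of n]) (auto simp: mem_Times_iff)
  next
    case False
    then have "fst z < snd z" using z by (auto simp: strip_def)
    then obtain n where "fst z < t n" "t n < snd z"
      using rational_between[of "fst z" "snd z"] z by (auto simp: strip_def)
    then show ?thesis by (intro UN_I[of n]) (auto simp: mem_Times_iff)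
  qed
  have "emeasure \<kappa> X = emeasure \<kappa> (X \<inter> ?W)"
  proof (rule emeasure_eq_AE)
    show "AE z in \<kappa>. z \<in> X \<longleftrightarrow> z \<in> X \<inter> ?W"
      using supp diag by eventually_elim (use cover in blast)
  qed (use X W sets_kappa in auto)
  also have XW: "X \<inter> ?W = (\<Union>n. X \<inter> ?D n)" using UN_disjointed_eq[of ?Q] by blast
  finally have *: "emeasure \<kappa> X = emeasure \<kappa> (\<Union>n. X \<inter> ?D n)" .
  have disj: "disjoint_family (\<lambda>n. X \<inter> ?D n)"
    using disjoint_family_disjointed[of ?Q] unfolding disjoint_family_on_def by blast
  have XD: "X \<inter> ?D n \<in> sets borel" for n using X D by auto
  note *
  also have "emeasure \<kappa> (\<Union>n. X \<inter> ?D n) = (\<Sum>n. emeasure \<kappa> (X \<inter> ?D n))"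
    by (rule suminf_emeasure[symmetric]) (use XD sets_kappa disj in auto)
  also have "\<dots> = (\<Sum>n. emeasure ?E (X \<inter> ?D n))"
  proof (intro suminf_cong)
    fix n
    have "?D n \<subseteq> ?Q n" by (rule disjointed_subset)
    then show "emeasure \<kappa> (X \<inter> ?D n) = emeasure ?E (X \<inter> ?D n)"
      by (intro eta_product_eq[OF t_in_C]) (use X D in auto)
  qed
  also have "\<dots> = emeasure ?E (\<Union>n. X \<inter> ?D n)"
    by (rule suminf_emeasure) (use XD sp disj in auto)
  also have "(\<Union>n. X \<inter> ?D n) = X \<inter> ?W" using UN_disjointed_eq[of ?Q] by blast
  also have "emeasure ?E (X \<inter> ?W) = emeasure ?E (F_set \<inter> X)"
  proof (rule emeasure_eq_AE)
    have "(- from_set C) \<times> UNIV \<in> null_sets ?E" "UNIV \<times> (- to_set C) \<in> null_sets ?E"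
      using E2.emeasure_pair_measure_Times[of "- from_set C" \<eta>1 UNIV] E2.emeasure_pair_measure_Times[of UNIV \<eta>1 "- to_set C"]
        eta_null[of "- from_set C"] eta_null[of "- to_set C"] Times_borel sp
      by (auto simp: null_sets_def)
    then have 1: "AE z in ?E. z \<notin> (- from_set C) \<times> UNIV" "AE z in ?E. z \<notin> UNIV \<times> (- to_set C)"
      by (auto intro: AE_not_in)
    \<comment> \<open>\<open>\<eta>1\<close> inherits the absence of atoms outside \<open>N\<close>
      from \<open>\<kappa>\<close>, so the product gives no mass to the rest of the
      diagonal.\<close>
    have "emeasure \<eta>1 {y} = 0" if "y \<notin> N" for y
    proof -
      have "k ({y} \<inter> D) V = 0" if "D \<in> sets borel" "V \<in> sets borel" for D V
      proof -
        have "k ({y} \<inter> D) V \<le> k {y} UNIV" by (rule k_mono) auto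
        also have "\<dots> = 0" using N(2)[OF \<open>y \<notin> N\<close>] by (simp add: k_def measure_def)
        finally show ?thesis using k_nonneg[of "{y} \<inter> D" V] by linarith
      qed
      then show ?thesis by (subst emeasure_eta1) auto
    qed
    then have 2: "AE z in ?E. fst z = snd z \<longrightarrow> fst z \<in> N"
      by (intro AE_diagonal_atom sigma_finite_eta N(1)) auto
    show "AE z in ?E. z \<in> X \<inter> ?W \<longleftrightarrow> z \<in> F_set \<inter> X"
      using 1 2
    proof eventually_elim
      case (elim z)
      have "z \<in> F_set" if "z \<in> ?W" using that by (auto simp: F_set_def)
      moreover have "z \<in> ?W" if "z \<in> F_set"
        by (rule cover) (use that elim in \<open>auto simp: F_set_def strip_def mem_Times_iff\<close>)
      ultimately show ?case by blast
    qed
  qed (use X W F_set_borel sp in auto)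
  also have "\<dots> = emeasure (restr ?E F_set) X"
    by (rule emeasure_restr[symmetric]) (use F_set_borel X sp in auto)
  finally show "emeasure \<kappa> X = emeasure (restr ?E F_set) X" .
qed

end

section \<open>Uniqueness of Kellerer plans\<close>

text \<open>The first marginal of the restricted product has density
  \<open>emeasure \<eta>2 {x..}\<close> with respect to \<open>\<eta>1\<close>, the second
  \<open>emeasure \<eta>1 {..y}\<close> with respect to \<open>\<eta>2\<close>. Dividing by both
  expresses the plan through its marginals, with the two densities as the only unknowns.\<close>

lemma Kellerer_density:
  assumes \<kappa>: "\<kappa> \<in> Marg \<gamma>1 \<gamma>2" and form: "\<kappa> = restr (\<eta>1 \<Otimes>\<^sub>M \<eta>2) F_set"
    and \<eta>: "\<eta>1 \<in> sigma_fin_measures" "\<eta>2 \<in> sigma_fin_measures"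
    and C: "open_interval C"
    and null: "emeasure \<gamma>1 (- from_set C) = 0" "emeasure \<gamma>2 (- to_set C) = 0"
    and pos: "\<And>t. t \<in> C \<Longrightarrow> emeasure \<kappa> ({..t} \<times> {t..}) > 0"
  obtains b a :: "real \<Rightarrow> real" where "b \<in> borel_measurable borel" "a \<in> borel_measurable borel"
    "AE x in \<gamma>1. x \<in> from_set C \<and> b x > 0" "AE y in \<gamma>2. y \<in> to_set C \<and> a y > 0"
    "\<kappa> = density (\<gamma>1 \<Otimes>\<^sub>M \<gamma>2) (\<lambda>z. ennreal (indicator F_set z / (b (fst z) * a (snd z))))"
    "\<forall>t\<in>C. 0 < b t \<and> 0 < a t \<and> a t * b t = measure \<kappa> ({..t} \<times> {t..})"
proof -
  have s1 [measurable_cong]: "sets \<eta>1 = sets borel" and s2 [measurable_cong]: "sets \<eta>2 = sets borel"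
    and sf: "sigma_finite_measure \<eta>1" "sigma_finite_measure \<eta>2"
    using \<eta> by (auto simp: sigma_fin_measures_def)
  have sp: "space \<eta>1 = UNIV" "space \<eta>2 = UNIV"
    using sets_eq_imp_space_eq[OF s1] sets_eq_imp_space_eq[OF s2] by auto
  interpret E1: sigma_finite_measure \<eta>1 by fact
  interpret E2: sigma_finite_measure \<eta>2 by fact
  interpret E: pair_sigma_finite \<eta>1 \<eta>2 ..
  interpret K: finite_measure \<kappa> using MargD(3)[OF \<kappa>] .
  let ?E = "\<eta>1 \<Otimes>\<^sub>M \<eta>2"
  have sE: "sets ?E = sets borel"
    by (rule sets_pair_borel[OF s1 s2])
  have F: "F_set \<in> sets ?E" using F_set_borel sE by simp
  have sg: "sets \<gamma>1 = sets borel" "sets \<gamma>2 = sets borel" using MargD(6,7)[OF \<kappa>] .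
  have em: "emeasure \<kappa> X = emeasure ?E (F_set \<inter> X)" if "X \<in> sets borel" for X
    using emeasure_restr[OF F] that sE unfolding form by simp
  note m = vimage_fst_snd_borel
  define B where "B x = emeasure \<eta>2 {x..}" for x
  define A where "A y = emeasure \<eta>1 {..y}" for y
  have B_eq: "B = (\<lambda>x. emeasure \<eta>2 (Pair x -` F_set))"
    by (auto simp: B_def F_set_def fun_eq_iff intro!: arg_cong2[where f=emeasure])
  have A_eq: "A = (\<lambda>y. emeasure \<eta>1 ((\<lambda>x. (x, y)) -` F_set))"
    by (auto simp: A_def F_set_def fun_eq_iff intro!: arg_cong2[where f=emeasure])
  have B_m [measurable]: "B \<in> borel_measurable \<eta>1"
    unfolding B_eq by (rule E2.measurable_emeasure_Pair[OF F])
  have A_m [measurable]: "A \<in> borel_measurable \<eta>2"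
    unfolding A_eq by (rule E.measurable_emeasure_Pair2[OF F])
  have B_b [measurable]: "B \<in> borel_measurable borel" and A_b [measurable]: "A \<in> borel_measurable borel"
    using B_m A_m unfolding measurable_cong_sets[OF s1 refl] measurable_cong_sets[OF s2 refl] .
  have g1: "\<gamma>1 = density \<eta>1 B"
  proof (rule measure_eqI)
    fix U assume "U \<in> sets \<gamma>1"
    then have U: "U \<in> sets borel" using sg by simp
    have "emeasure \<gamma>1 U = emeasure ?E (F_set \<inter> {z. fst z \<in> U})"
      using MargD(4)[OF \<kappa> U] em[OF m(1)[OF U]] by simp
    also have "\<dots> = (\<integral>\<^sup>+x. emeasure \<eta>2 (Pair x -` (F_set \<inter> {z. fst z \<in> U})) \<partial>\<eta>1)"
      by (rule E2.emeasure_pair_measure_alt) (use F m(1)[OF U] sE in auto)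
    also have "\<dots> = (\<integral>\<^sup>+x. B x * indicator U x \<partial>\<eta>1)"
      by (rule nn_integral_cong) (auto simp: B_def F_set_def vimage_def atLeast_def split: split_indicator)
    also have "\<dots> = emeasure (density \<eta>1 B) U"
      by (rule emeasure_density[symmetric]) (use U s1 in auto)
    finally show "emeasure \<gamma>1 U = emeasure (density \<eta>1 B) U" .
  qed (simp add: sg s1)
  have g2: "\<gamma>2 = density \<eta>2 A"
  proof (rule measure_eqI)
    fix U assume "U \<in> sets \<gamma>2"
    then have U: "U \<in> sets borel" using sg by simp
    have "emeasure \<gamma>2 U = emeasure ?E (F_set \<inter> {z. snd z \<in> U})"
      using MargD(5)[OF \<kappa> U] em[OF m(2)[OF U]] by simp
    also have "\<dots> = (\<integral>\<^sup>+y. emeasure \<eta>1 ((\<lambda>x. (x, y)) -` (F_set \<inter> {z. snd z \<in> U})) \<partial>\<eta>2)"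
      by (rule E.emeasure_pair_measure_alt2) (use F m(2)[OF U] sE in auto)
    also have "\<dots> = (\<integral>\<^sup>+y. A y * indicator U y \<partial>\<eta>2)"
      by (rule nn_integral_cong) (auto simp: A_def F_set_def vimage_def atMost_def split: split_indicator)
    also have "\<dots> = emeasure (density \<eta>2 A) U"
      by (rule emeasure_density[symmetric]) (use U s2 in auto)
    finally show "emeasure \<gamma>2 U = emeasure (density \<eta>2 A) U" .
  qed (simp add: sg s2)
  have Q: "emeasure \<kappa> ({..t} \<times> {t..}) = A t * B t" for t
  proof -
    have "F_set \<inter> {..t} \<times> {t..} = {..t} \<times> {t..}" by (auto simp: F_set_def)
    then show ?thesis
      using em[OF Times_borel, of "{..t}" "{t..}"] E2.emeasure_pair_measure_Times[of "{..t}" \<eta>1 "{t..}"] s1 s2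
      by (simp add: A_def B_def)
  qed
  have AB: "0 < A t" "0 < B t" "A t < \<infinity>" "B t < \<infinity>" if "t \<in> C" for t
  proof -
    have "A t * B t \<noteq> 0" "A t * B t \<noteq> \<infinity>" using pos[OF that] Q[of t] by (auto simp: K.emeasure_eq_measure)
    then show "0 < A t" "0 < B t" "A t < \<infinity>" "B t < \<infinity>"
      by (auto simp: ennreal_mult_eq_top_iff less_top zero_less_iff_neq_zero)
  qed
  define N1 N2 where "N1 = {x. \<not> (x \<in> from_set C \<and> 0 < B x \<and> B x < \<infinity>)}"
    and "N2 = {y. \<not> (y \<in> to_set C \<and> 0 < A y \<and> A y < \<infinity>)}"
  have "{x \<in> space borel. \<not> (x \<in> from_set C \<and> 0 < B x \<and> B x < \<infinity>)} \<in> sets borel"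
    "{x \<in> space borel. \<not> (x \<in> to_set C \<and> 0 < A x \<and> A x < \<infinity>)} \<in> sets borel" by measurable
  then have N: "N1 \<in> sets borel" "N2 \<in> sets borel" by (simp_all add: N1_def N2_def)
  obtain c where c: "c \<in> C" using C by (auto simp: open_interval_def)
  \<comment> \<open>The mass of a tail increases towards the left, so positivity at one level of
    \<open>C\<close> to the right of \<open>x\<close> suffices.\<close>
  have B_pos: "0 < B x" if x: "x \<in> from_set C" for x
  proof -
    obtain t where "t \<in> C" "x \<le> t"
      using from_set_greater[OF C c x] c by (metis linear order_le_less)
    then have "B t \<le> B x" "0 < B t" using AB s2 by (auto simp: B_def intro!: emeasure_mono)
    then show ?thesis by (simp add: order_less_le_trans)
  qed
  have A_pos: "0 < A y" if y: "y \<in> to_set C" for y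
  proof -
    obtain t where "t \<in> C" "t \<le> y"
      using to_set_less[OF C c y] c by (metis linear order_le_less)
    then have "A t \<le> A y" "0 < A t" using AB s1 by (auto simp: A_def intro!: emeasure_mono)
    then show ?thesis by (simp add: order_less_le_trans)
  qed
  have UN: "emeasure \<gamma>1 UNIV \<noteq> \<infinity>" "emeasure \<gamma>2 UNIV \<noteq> \<infinity>"
    using MargD(4)[OF \<kappa>, of UNIV, symmetric] MargD(5)[OF \<kappa>, of UNIV, symmetric] by simp_all
  have g1N: "AE x in \<gamma>1. x \<in> from_set C \<and> 0 < B x \<and> B x < \<infinity>"
  proof -
    have "(\<integral>\<^sup>+x. B x \<partial>\<eta>1) = emeasure \<gamma>1 UNIV" 
      unfolding g1 using s1 by (subst emeasure_density) auto
    then have "AE x in \<eta>1. B x \<noteq> \<infinity>"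
      using UN by (intro nn_integral_noteq_infinite) auto
    then have "AE x in \<gamma>1. B x \<noteq> \<infinity>"
      unfolding g1 by (subst AE_density) (auto elim: eventually_mono)
    moreover have "AE x in \<gamma>1. x \<notin> - from_set C"
      using null(1) sg by (intro AE_not_in) (auto simp: null_sets_def)
    ultimately show ?thesis
      by eventually_elim (use B_pos in \<open>auto simp: less_top\<close>)
  qed
  have g2N: "AE x in \<gamma>2. x \<in> to_set C \<and> 0 < A x \<and> A x < \<infinity>"
  proof -
    have "(\<integral>\<^sup>+x. A x \<partial>\<eta>2) = emeasure \<gamma>2 UNIV" 
      unfolding g2 using s2 by (subst emeasure_density) auto
    then have "AE x in \<eta>2. A x \<noteq> \<infinity>"
      using UN by (intro nn_integral_noteq_infinite) auto
    then have "AE x in \<gamma>2. A x \<noteq> \<infinity>"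
      unfolding g2 by (subst AE_density) (auto elim: eventually_mono)
    moreover have "AE x in \<gamma>2. x \<notin> - to_set C"
      using null(2) sg by (intro AE_not_in) (auto simp: null_sets_def)
    ultimately show ?thesis
      by eventually_elim (use A_pos in \<open>auto simp: less_top\<close>)
  qed
  have null1: "emeasure \<gamma>1 N1 = 0"
  proof -
    have "emeasure \<gamma>1 N1 = emeasure \<gamma>1 {}"
      by (rule emeasure_eq_AE) (use g1N N sg in \<open>auto simp: N1_def elim: eventually_mono\<close>)
    then show ?thesis by simp
  qed
  have null2: "emeasure \<gamma>2 N2 = 0"
  proof -
    have "emeasure \<gamma>2 N2 = emeasure \<gamma>2 {}"
      by (rule emeasure_eq_AE) (use g2N N sg in \<open>auto simp: N2_def elim: eventually_mono\<close>)
    then show ?thesis by simp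
  qed
  \<comment> \<open>The exceptional sets are null for the marginals but may be charged by
    \<open>\<eta>1\<close> and \<open>\<eta>2\<close>; it is their part over \<open>F_set\<close>
    that is null for the product.\<close>
  have "F_set \<inter> {z. fst z \<in> N1} \<in> null_sets ?E" "F_set \<inter> {z. snd z \<in> N2} \<in> null_sets ?E"
    using MargD(4)[OF \<kappa> N(1)] MargD(5)[OF \<kappa> N(2)] em m N null1 null2 F sE by (auto simp: null_sets_def)
  then have AE_E: "AE z in ?E. z \<notin> F_set \<inter> {z. fst z \<in> N1}" "AE z in ?E. z \<notin> F_set \<inter> {z. snd z \<in> N2}"
    using AE_not_in by blast+
  define b a where "b x = enn2real (B x)" and "a x = enn2real (A x)" for x
  have b_b [measurable]: "b \<in> borel_measurable borel" and a_b [measurable]: "a \<in> borel_measurable borel"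
    unfolding b_def[abs_def] a_def[abs_def] by measurable
  have real: "0 < b x \<and> B x = ennreal (b x)" if "0 < B x" "B x < \<infinity>" for x
    using that by (auto simp: b_def enn2real_positive_iff less_top)
  have real': "0 < a x \<and> A x = ennreal (a x)" if "0 < A x" "A x < \<infinity>" for x
    using that by (auto simp: a_def enn2real_positive_iff less_top)
  define kk where "kk z = ennreal (indicator F_set z / (b (fst z) * a (snd z)))" for z
  have [measurable]: "F_set \<in> sets (borel \<Otimes>\<^sub>M borel)" using F_set_borel sets_borel_pair by simp
  have kk_m [measurable]: "kk \<in> borel_measurable ?E" unfolding kk_def[abs_def] by measurable
  interpret G1: finite_measure \<gamma>1
    using UN sets_eq_imp_space_eq[OF sg(1)] by (intro finite_measureI) simp
  interpret G2: finite_measure \<gamma>2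
    using UN sets_eq_imp_space_eq[OF sg(2)] by (intro finite_measureI) simp
  have "density (\<gamma>1 \<Otimes>\<^sub>M \<gamma>2) kk = density (density ?E (\<lambda>(x, y). B x * A y)) kk"
  proof -
    have "density \<eta>1 B \<Otimes>\<^sub>M density \<eta>2 A = density ?E (\<lambda>(x, y). B x * A y)"
      by (rule pair_measure_density) (use g2 G2.sigma_finite_measure_axioms in \<open>auto intro: E2.sigma_finite_measure_axioms\<close>)
    then show ?thesis using g1 g2 by simp
  qed
  also have "\<dots> = density ?E (\<lambda>z. (case z of (x, y) \<Rightarrow> B x * A y) * kk z)"
    by (rule density_density_eq) measurable
  also have "\<dots> = density ?E (indicator F_set)"
  proof (rule density_cong)
    show "AE z in ?E. (case z of (x, y) \<Rightarrow> B x * A y) * kk z = indicator F_set z"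
      using AE_E
    proof eventually_elim
      case (elim z)
      obtain x y where z: "z = (x, y)" by (cases z)
      show ?case
      proof (cases "z \<in> F_set")
        case True
        then have "x \<notin> N1" "y \<notin> N2" using elim by (auto simp: z)
        then have "0 < B x" "B x < \<infinity>" "0 < A y" "A y < \<infinity>" unfolding N1_def N2_def by blast+
        then have "0 < b x" "B x = ennreal (b x)" "0 < a y" "A y = ennreal (a y)"
          using real real' by blast+
        then show ?thesis using True by (simp add: z kk_def flip: ennreal_mult ennreal_1)
      qed (simp add: z kk_def)
    qed
    show "(\<lambda>z. (case z of (x, y) \<Rightarrow> B x * A y) * kk z) \<in> borel_measurable ?E" by measurable
    show "indicator F_set \<in> borel_measurable ?E" using F by measurable
  qed
  finally have K: "\<kappa> = density (\<gamma>1 \<Otimes>\<^sub>M \<gamma>2) kk" using form by (simp add: restr_def)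
  show ?thesis
  proof (rule that[OF b_b a_b _ _ K[unfolded kk_def[abs_def]]])
    show "AE x in \<gamma>1. x \<in> from_set C \<and> b x > 0" using g1N by eventually_elim (use real in blast)
    show "AE x in \<gamma>2. x \<in> to_set C \<and> a x > 0" using g2N by eventually_elim (use real' in blast)
    show "\<forall>t\<in>C. 0 < b t \<and> 0 < a t \<and> a t * b t = measure \<kappa> ({..t} \<times> {t..})"
    proof
      fix t assume t: "t \<in> C"
      note R = real[OF AB(2,4)[OF t]] real'[OF AB(1,3)[OF t]]
      then have "emeasure \<kappa> ({..t} \<times> {t..}) = ennreal (a t * b t)" by (simp add: Q ennreal_mult)
      then show "0 < b t \<and> 0 < a t \<and> a t * b t = measure \<kappa> ({..t} \<times> {t..})"
        using R by (simp add: measure_def)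
    qed
  qed
qed

lemma AE_pair_fst_snd:
  assumes "sigma_finite_measure M2" "AE x in M1. P x" "AE y in M2. Q y"
  shows "AE z in M1 \<Otimes>\<^sub>M M2. P (fst z) \<and> Q (snd z)"
proof -
  interpret sigma_finite_measure M2 by fact
  obtain N1 N2 where N: "N1 \<in> null_sets M1" "{x \<in> space M1. \<not> P x} \<subseteq> N1"
    "N2 \<in> null_sets M2" "{x \<in> space M2. \<not> Q x} \<subseteq> N2"
    using assms(2,3) by (auto simp: eventually_ae_filter)
  have "N1 \<times> space M2 \<in> null_sets (M1 \<Otimes>\<^sub>M M2)" "space M1 \<times> N2 \<in> null_sets (M1 \<Otimes>\<^sub>M M2)"
    using N by (auto simp: null_sets_def emeasure_pair_measure_Times)
  then have "AE z in M1 \<Otimes>\<^sub>M M2. z \<notin> N1 \<times> space M2" "AE z in M1 \<Otimes>\<^sub>M M2. z \<notin> space M1 \<times> N2"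
    by (auto intro: AE_not_in)
  with AE_space show ?thesis
    by eventually_elim (use N in \<open>auto simp: space_pair_measure mem_Times_iff\<close>)
qed

text \<open>Two plans of Kellerer form with densities \<open>1 / (b1 a1)\<close> and \<open>1 / (b2 a2)\<close> on \<open>F\<close> have density quotient
  \<open>exp (u y - u x)\<close> for a single function \<open>u\<close>, because \<open>a t b t\<close> is the mass of a quadrant, which depends on
  the marginals only. Testing the difference of the plans against the bounded function
  \<open>arctan (u y) - arctan (u x)\<close>, whose integral depends on the marginals only, gives uniqueness.\<close>

theorem Kellerer_unique:
  assumes \<kappa>: "\<kappa>1 \<in> Marg \<gamma>1 \<gamma>2" "\<kappa>2 \<in> Marg \<gamma>1 \<gamma>2"
    and form1: "\<kappa>1 = restr (\<eta>1 \<Otimes>\<^sub>M \<eta>2) F_set" "\<eta>1 \<in> sigma_fin_measures" "\<eta>2 \<in> sigma_fin_measures"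
    and form2: "\<kappa>2 = restr (\<eta>3 \<Otimes>\<^sub>M \<eta>4) F_set" "\<eta>3 \<in> sigma_fin_measures" "\<eta>4 \<in> sigma_fin_measures"
    and C: "open_interval C"
    and null: "emeasure \<gamma>1 (- from_set C) = 0" "emeasure \<gamma>2 (- to_set C) = 0"
    and pos: "\<And>t. t \<in> C \<Longrightarrow> emeasure \<kappa>1 ({..t} \<times> {t..}) > 0"
  shows "\<kappa>1 = \<kappa>2"
proof -
  \<comment> \<open>On \<open>F_set\<close> a target below \<open>t\<close> has its source there
    too, so the quadrant mass is what starts at or below \<open>t\<close> minus what ends below
    \<open>t\<close>.\<close>
  have quadrant: "measure \<kappa> ({..t} \<times> {t..}) = measure \<gamma>1 {..t} - measure \<gamma>2 {..<t}"
    if \<kappa>: "\<kappa> \<in> Marg \<gamma>1 \<gamma>2" and form: "\<kappa> = restr (\<eta> \<Otimes>\<^sub>M \<eta>') F_set"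
      and \<eta>: "\<eta> \<in> sigma_fin_measures" "\<eta>' \<in> sigma_fin_measures" for \<kappa> \<eta> \<eta>' t
  proof -
    interpret K: finite_measure \<kappa> using MargD(3)[OF \<kappa>] .
    have sE: "sets (\<eta> \<Otimes>\<^sub>M \<eta>') = sets borel"
      using \<eta> by (intro sets_pair_borel) (auto simp: sigma_fin_measures_def)
    then have AE: "AE z in \<kappa>. z \<in> F_set"
    proof -
      have "indicator F_set \<in> borel_measurable (\<eta> \<Otimes>\<^sub>M \<eta>')"
        by (rule borel_measurable_indicator) (simp only: sE F_set_borel)
      then show ?thesis unfolding form restr_def by (subst AE_density) (auto simp: indicator_def)
    qed
    note hs = halfplane_sets[OF MargD(1)[OF \<kappa>]]
    have T: "{..t} \<times> {t..} \<in> sets \<kappa>" using Times_borel[of "{..t}" "{t..}"] MargD(1)[OF \<kappa>] by simp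
    have "measure \<gamma>1 {..t} = measure \<kappa> {z. fst z \<le> t}"
      using MargD(4)[OF \<kappa>, of "{..t}"] by (simp add: measure_def)
    also have "\<dots> = measure \<kappa> ({..t} \<times> {t..} \<union> {z. snd z < t})"
      by (rule measure_eq_AE) (use AE hs T in \<open>auto simp: F_set_def elim!: eventually_mono\<close>)
    also have "\<dots> = measure \<kappa> ({..t} \<times> {t..}) + measure \<kappa> {z. snd z < t}"
      by (rule K.finite_measure_Union) (use hs T in auto)
    also have "measure \<kappa> {z. snd z < t} = measure \<gamma>2 {..<t}"
      using MargD(5)[OF \<kappa>, of "{..<t}"] by (simp add: measure_def)
    finally show ?thesis by simp
  qed
  interpret K1: finite_measure \<kappa>1 using MargD(3)[OF \<kappa>(1)] .
  interpret K2: finite_measure \<kappa>2 using MargD(3)[OF \<kappa>(2)] .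
  have same: "measure \<kappa>2 ({..t} \<times> {t..}) = measure \<kappa>1 ({..t} \<times> {t..})" for t
    using quadrant[OF \<kappa>(1) form1] quadrant[OF \<kappa>(2) form2] by simp
  then have pos2: "emeasure \<kappa>2 ({..t} \<times> {t..}) > 0" if "t \<in> C" for t
    using pos[OF that] by (simp add: K1.emeasure_eq_measure K2.emeasure_eq_measure)
  obtain b1 a1 where 1: "b1 \<in> borel_measurable borel" "a1 \<in> borel_measurable borel"
    "AE x in \<gamma>1. x \<in> from_set C \<and> b1 x > 0" "AE y in \<gamma>2. y \<in> to_set C \<and> a1 y > 0"
    "\<kappa>1 = density (\<gamma>1 \<Otimes>\<^sub>M \<gamma>2) (\<lambda>z. ennreal (indicator F_set z / (b1 (fst z) * a1 (snd z))))"
    "\<forall>t\<in>C. 0 < b1 t \<and> 0 < a1 t \<and> a1 t * b1 t = measure \<kappa>1 ({..t} \<times> {t..})"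
    by (rule Kellerer_density[OF \<kappa>(1) form1 C null pos])
  obtain b2 a2 where 2: "b2 \<in> borel_measurable borel" "a2 \<in> borel_measurable borel"
    "AE x in \<gamma>1. x \<in> from_set C \<and> b2 x > 0" "AE y in \<gamma>2. y \<in> to_set C \<and> a2 y > 0"
    "\<kappa>2 = density (\<gamma>1 \<Otimes>\<^sub>M \<gamma>2) (\<lambda>z. ennreal (indicator F_set z / (b2 (fst z) * a2 (snd z))))"
    "\<forall>t\<in>C. 0 < b2 t \<and> 0 < a2 t \<and> a2 t * b2 t = measure \<kappa>2 ({..t} \<times> {t..})"
    by (rule Kellerer_density[OF \<kappa>(2) form2 C null pos2])
  note [measurable] = 1(1,2) 2(1,2)
  have sg [measurable_cong]: "sets \<gamma>1 = sets borel" "sets \<gamma>2 = sets borel" using MargD(6,7)[OF \<kappa>(1)] .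
  interpret G1: finite_measure \<gamma>1
    using MargD(4)[OF \<kappa>(1), of UNIV, symmetric] sets_eq_imp_space_eq[OF sg(1)]
    by (intro finite_measureI) simp
  interpret G2: finite_measure \<gamma>2
    using MargD(5)[OF \<kappa>(1), of UNIV, symmetric] sets_eq_imp_space_eq[OF sg(2)]
    by (intro finite_measureI) simp
  let ?P = "\<gamma>1 \<Otimes>\<^sub>M \<gamma>2"
  have [measurable]: "F_set \<in> sets (borel \<Otimes>\<^sub>M borel)" using F_set_borel sets_borel_pair by simp
  define k1 where "k1 z = indicator F_set z / (b1 (fst z) * a1 (snd z))" for z
  define k2 where "k2 z = indicator F_set z / (b2 (fst z) * a2 (snd z))" for z
  have k_m [measurable]: "k1 \<in> borel_measurable ?P" "k2 \<in> borel_measurable ?P"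
    unfolding k1_def[abs_def] k2_def[abs_def] by measurable
  have d: "\<kappa>1 = density ?P k1" "\<kappa>2 = density ?P k2"
    using 1(5) 2(5) by (simp_all add: k1_def k2_def)
  have good: "AE z in ?P. (fst z \<in> from_set C \<and> b1 (fst z) > 0 \<and> b2 (fst z) > 0) \<and>
      (snd z \<in> to_set C \<and> a1 (snd z) > 0 \<and> a2 (snd z) > 0)"
  proof (rule AE_pair_fst_snd[OF G2.sigma_finite_measure_axioms])
    show "AE x in \<gamma>1. x \<in> from_set C \<and> b1 x > 0 \<and> b2 x > 0" using 1(3) 2(3) by eventually_elim simp
    show "AE y in \<gamma>2. y \<in> to_set C \<and> a1 y > 0 \<and> a2 y > 0" using 1(4) 2(4) by eventually_elim simp
  qed
  have nonneg: "AE z in ?P. 0 \<le> k1 z" "AE z in ?P. 0 \<le> k2 z"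
    using good by (eventually_elim, simp add: k1_def k2_def)+
  \<comment> \<open>The two expressions agree on \<open>C\<close> because
    \<open>a1 t * b1 t = a2 t * b2 t\<close> there. The second serves the right endpoint, which
    belongs to \<open>to_set C\<close> but not to \<open>from_set C\<close>.\<close>
  define u where "u x = (if x \<in> from_set C then ln (b1 x / b2 x) else ln (a2 x / a1 x))" for x
  have u_m [measurable]: "u \<in> borel_measurable borel" unfolding u_def[abs_def] by measurable
  \<comment> \<open>\<open>arctan\<close> preserves the order and is bounded, so
    \<open>\<phi>\<close> is integrable against every finite plan although \<open>u\<close> need not
    be.\<close>
  define \<phi> where "\<phi> z = arctan (u (snd z)) - arctan (u (fst z))" for z
  have phi_m [measurable]: "\<phi> \<in> borel_measurable ?P" unfolding \<phi>_def[abs_def] by measurable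
  have bnd: "\<bar>arctan v\<bar> \<le> 2" for v :: real
    using arctan_bounded[of v] pi_less_4 by (auto simp: abs_le_iff)
  have phi_bnd: "\<bar>\<phi> z\<bar> \<le> 4" for z
    using bnd[of "u (snd z)"] bnd[of "u (fst z)"] by (simp add: \<phi>_def)
  have phi_int: "(\<integral>z. \<phi> z \<partial>\<kappa>) = (\<integral>y. arctan (u y) \<partial>\<gamma>2) - (\<integral>x. arctan (u x) \<partial>\<gamma>1)" if \<kappa>: "\<kappa> \<in> Marg \<gamma>1 \<gamma>2" for \<kappa>
  proof -
    interpret K: finite_measure \<kappa> using MargD(3)[OF \<kappa>] .
    note [measurable] = sets_borel_fst_snd[OF MargD(1)[OF \<kappa>]]
    have "integrable \<kappa> (\<lambda>z. arctan (u (fst z)))" "integrable \<kappa> (\<lambda>z. arctan (u (snd z)))"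
      by (rule K.integrable_const_bound[where B=2]; use bnd in \<open>auto\<close>)+
    moreover have "(\<integral>x. arctan (u x) \<partial>\<gamma>1) = (\<integral>z. arctan (u (fst z)) \<partial>\<kappa>)"
      using \<kappa> by (subst integral_distr[symmetric, of fst \<kappa> borel]) (auto simp: Marg_def)
    moreover have "(\<integral>x. arctan (u x) \<partial>\<gamma>2) = (\<integral>z. arctan (u (snd z)) \<partial>\<kappa>)"
      using \<kappa> by (subst integral_distr[symmetric, of snd \<kappa> borel]) (auto simp: Marg_def)
    ultimately show ?thesis by (simp add: \<phi>_def)
  qed
  have k_int: "integrable ?P k1" "integrable ?P k2"
  proof -
    have "(\<integral>\<^sup>+z. ennreal (k1 z) \<partial>?P) = emeasure \<kappa>1 (space \<kappa>1)" "(\<integral>\<^sup>+z. ennreal (k2 z) \<partial>?P) = emeasure \<kappa>2 (space \<kappa>2)"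
      unfolding d by (subst emeasure_density; auto intro!: nn_integral_cong split: split_indicator)+
    then show "integrable ?P k1" "integrable ?P k2"
      using nonneg K1.emeasure_eq_measure K2.emeasure_eq_measure by (auto intro!: integrableI_nonneg)
  qed
  have int: "integrable ?P (\<lambda>z. k z * \<phi> z)" if k: "integrable ?P k" for k
  proof (rule Bochner_Integration.integrable_bound)
    show "integrable ?P (\<lambda>z. k z * 4)" using k by simp
    show "(\<lambda>z. k z * \<phi> z) \<in> borel_measurable ?P" using borel_measurable_integrable[OF k] by measurable
    show "AE z in ?P. norm (k z * \<phi> z) \<le> norm (k z * 4)"
      using phi_bnd by (intro AE_I2) (auto simp: abs_mult intro!: mult_left_mono)
  qed
  have "(\<integral>z. \<phi> z \<partial>\<kappa>1) = (\<integral>z. k1 z * \<phi> z \<partial>?P)" "(\<integral>z. \<phi> z \<partial>\<kappa>2) = (\<integral>z. k2 z * \<phi> z \<partial>?P)"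
    unfolding d using nonneg by (subst integral_density; simp)+
  then have zero: "(\<integral>z. k1 z * \<phi> z - k2 z * \<phi> z \<partial>?P) = 0"
    using phi_int[OF \<kappa>(1)] phi_int[OF \<kappa>(2)] int[OF k_int(1)] int[OF k_int(2)] by simp
  \<comment> \<open>\<open>ln (k1 z) - ln (k2 z) = u (snd z) - u (fst z)\<close> has the sign of
    \<open>\<phi> z\<close> on \<open>F_set\<close>, so the integrand is nonnegative and vanishes
    only where the densities agree.\<close>
  have key: "0 \<le> k1 z * \<phi> z - k2 z * \<phi> z \<and> (k1 z * \<phi> z - k2 z * \<phi> z = 0 \<longrightarrow> k1 z = k2 z)"
    if z: "(fst z \<in> from_set C \<and> b1 (fst z) > 0 \<and> b2 (fst z) > 0) \<and>
      (snd z \<in> to_set C \<and> a1 (snd z) > 0 \<and> a2 (snd z) > 0)" for z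
  proof (cases "z \<in> F_set")
    case True
    have ufst: "u (fst z) = ln (b1 (fst z)) - ln (b2 (fst z))"
      using z by (simp add: u_def ln_div)
    have usnd: "u (snd z) = ln (a2 (snd z)) - ln (a1 (snd z))"
    proof (cases "snd z \<in> from_set C")
      case True
      then have "snd z \<in> C" using z open_interval_eq[OF C] by blast
      then have ab: "a1 (snd z) * b1 (snd z) = a2 (snd z) * b2 (snd z)" "b1 (snd z) > 0" "b2 (snd z) > 0"
        using 1(6) 2(6) same by auto
      then have "ln (a1 (snd z)) + ln (b1 (snd z)) = ln (a2 (snd z)) + ln (b2 (snd z))"
        using z ab by (metis ln_mult_pos)
      then show ?thesis using True z \<open>b1 (snd z) > 0\<close> \<open>b2 (snd z) > 0\<close> by (simp add: u_def ln_div)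
    qed (use z in \<open>simp add: u_def ln_div\<close>)
    have pos: "0 < b1 (fst z) * a1 (snd z)" "0 < b2 (fst z) * a2 (snd z)" using z by auto
    then have kp: "0 < k1 z" "0 < k2 z" using True by (auto simp: k1_def k2_def)
    have "ln (k1 z) = - ln (b1 (fst z)) - ln (a1 (snd z))" "ln (k2 z) = - ln (b2 (fst z)) - ln (a2 (snd z))"
      using z pos True by (simp_all add: k1_def k2_def ln_div ln_mult)
    then have lnk: "ln (k1 z) - ln (k2 z) = u (snd z) - u (fst z)" using ufst usnd by simp
    consider "k1 z = k2 z" | "k1 z < k2 z" | "k2 z < k1 z" by linarith
    then show ?thesis
    proof cases
      case 2
      then have "ln (k1 z) < ln (k2 z)" using kp by simp
      then have "\<phi> z < 0" using lnk by (simp add: \<phi>_def arctan_less_iff)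
      then have "0 < (k1 z - k2 z) * \<phi> z" using 2 by (intro mult_neg_neg) auto
      then have "0 < k1 z * \<phi> z - k2 z * \<phi> z" by (simp only: left_diff_distrib)
      then show ?thesis by (metis less_imp_le less_irrefl)
    next
      case 3
      then have "ln (k2 z) < ln (k1 z)" using kp by simp
      then have "0 < \<phi> z" using lnk by (simp add: \<phi>_def arctan_less_iff)
      then have "0 < (k1 z - k2 z) * \<phi> z" using 3 by (intro mult_pos_pos) auto
      then have "0 < k1 z * \<phi> z - k2 z * \<phi> z" by (simp only: left_diff_distrib)
      then show ?thesis by (metis less_imp_le less_irrefl)
    qed simp
  qed (simp add: k1_def k2_def)
  have "AE z in ?P. 0 \<le> k1 z * \<phi> z - k2 z * \<phi> z" using good by eventually_elim (use key in blast)
  from integral_nonneg_eq_0_iff_AE[OF Bochner_Integration.integrable_diff[OF int[OF k_int(1)] int[OF k_int(2)]] this]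
  have "AE z in ?P. k1 z * \<phi> z - k2 z * \<phi> z = 0"
    using zero by simp
  with good have "AE z in ?P. ennreal (k1 z) = ennreal (k2 z)"
    by eventually_elim (use key in metis)
  then show ?thesis unfolding d by (intro density_cong) auto
qed

section \<open>Identification of the limit\<close>

context finite_borel_pair
begin

lemma plus_comp_null:
  assumes C: "C \<in> components (E_plus \<mu> \<nu>)"
  shows "emeasure (mu_plus_comp \<mu> \<nu> C) (- from_set C) = 0" "emeasure (nu_plus_comp \<mu> \<nu> C) (- to_set C) = 0"
proof -
  have I: "open_interval C" using components_interval C by blast
  have Cb: "C \<in> sets borel" using I by (simp add: open_interval_def)
  have sub: "C \<inter> - from_set C = {}" "C \<inter> - to_set C = {}" using open_interval_eq[OF I] by blast+
  have ends: "bdd_below C \<Longrightarrow> Inf C \<in> from_set C" "bdd_above C \<Longrightarrow> Sup C \<in> to_set C"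
    using from_set_cases[OF I] to_set_cases[OF I] by auto
  show "emeasure (mu_plus_comp \<mu> \<nu> C) (- from_set C) = 0"
    using Cb sub ends M.M_is_borel
    by (auto simp: mu_plus_comp_def emeasure_add_measure emeasure_dirac_left emeasure_restr)
  show "emeasure (nu_plus_comp \<mu> \<nu> C) (- to_set C) = 0"
    using Cb sub ends N.M_is_borel
    by (auto simp: nu_plus_comp_def emeasure_add_measure emeasure_dirac_right emeasure_restr)
qed

text \<open>Absolute continuity with respect to the product excludes diffuse mass on the
  diagonal.\<close>

lemma density_diagonal_atoms:
  assumes p: "plan_density p"
  shows "AE z in density R p. fst z = snd z \<longrightarrow> fst z \<in> {x. measure \<mu> {x} \<noteq> 0}"
proof -
  have "AE z in R. fst z = snd z \<longrightarrow> fst z \<in> {x. measure \<mu> {x} \<noteq> 0}"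
    by (rule AE_diagonal_atom[OF M.sigma_finite_measure_axioms N.sigma_finite_measure_axioms M.M_is_borel N.M_is_borel M.countable_support])
       (simp add: M.emeasure_eq_measure)
  then show ?thesis
    using plan_densityD[OF p] by (subst AE_density) (auto elim: eventually_mono)
qed

text \<open>The part of the limit in the strip satisfies the assumptions of
  \<open>quadrant_product\<close>, so it has Kellerer's form; \<open>Kellerer_unique\<close> then
  makes it the value of the definite description.\<close>

theorem entropy_minimal_Kellerer:
  assumes p: "entropy_minimal p" and C: "C \<in> components (E_plus \<mu> \<nu>)"
  shows "Kellerer_F (mu_plus_comp \<mu> \<nu> C) (nu_plus_comp \<mu> \<nu> C) = restr (density R p) (strip C)"
proof -
  define \<pi> where "\<pi> = density R p"
  define \<kappa> where "\<kappa> = restr \<pi> (strip C)"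
  have opt: "optimal \<pi>" using p by (simp add: entropy_minimal_def \<pi>_def)
  have pd: "plan_density p" using p by (simp add: entropy_minimal_def admissible_def)
  have \<pi>: "\<pi> \<in> Marg \<mu> \<nu>" using opt by (simp add: optimal_def)
  have I: "open_interval C" using components_interval C by blast
  have marg: "\<kappa> \<in> Marg (mu_plus_comp \<mu> \<nu> C) (nu_plus_comp \<mu> \<nu> C)"
    unfolding \<kappa>_def by (rule strip_marginals[OF opt C])
  interpret P: finite_measure \<pi> using MargD(3)[OF \<pi>] .
  have sets\<pi>: "sets \<pi> = sets borel" and strip: "strip C \<in> sets \<pi>"
    using MargD(1)[OF \<pi>] strip_borel by auto
  have TS: "U \<times> V \<in> sets \<pi>" if "U \<in> sets borel" "V \<in> sets borel" for U V
    using Times_borel[OF that] sets\<pi> by simp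
  \<comment> \<open>Restriction to the strip loses nothing on the quadrants at levels of
    \<open>C\<close>, so the product property of the whole plan passes to the piece.\<close>
  have rect: "emeasure \<kappa> (U \<times> V) = emeasure \<pi> (U \<times> V)"
    if t: "t \<in> C" and UV: "U \<in> sets borel" "V \<in> sets borel" "U \<subseteq> {..t}" "V \<subseteq> {t..}" for t U V
  proof -
    have "emeasure \<kappa> (U \<times> V) = emeasure \<pi> (strip C \<inter> U \<times> V)"
      unfolding \<kappa>_def by (rule emeasure_restr[OF strip]) (use TS UV in auto)
    also have "\<dots> = emeasure \<pi> (U \<times> V)"
    proof (rule emeasure_eq_AE)
      show "AE z in \<pi>. z \<in> strip C \<inter> U \<times> V \<longleftrightarrow> z \<in> U \<times> V"
        using optimal_AE_good[OF opt]
      proof eventually_elim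
        case (elim z)
        have "z \<in> strip C" if z: "z \<in> U \<times> V"
        proof -
          have le: "fst z \<le> t" "t \<le> snd z" using z UV by auto
          consider "fst z = t" | "snd z = t" | "fst z < t" "t < snd z" using le by linarith
          then show ?thesis
          proof cases
            case 1
            then show ?thesis using good_component(1)[OF elim C] t by simp
          next
            case 2
            then show ?thesis using good_component(2)[OF elim C] t by simp
          next
            \<comment> \<open>The point crosses \<open>t\<close> strictly and lies in the strip of
              some component; that component contains \<open>t\<close> and is therefore
              \<open>C\<close>.\<close>
            case 3
            then obtain C' where C': "C' \<in> components (E_plus \<mu> \<nu>)" "z \<in> strip C'"
              using good_less_strip[OF elim] by (metis order_less_trans)
            have I': "open_interval C'" using components_interval C' by blast
            have "t \<in> C'"
              using C'(2) 3 mem_open_interval[OF I', of t] by (auto simp: strip_def from_set_def to_set_def)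
            then show ?thesis using components_Int(1)[of C C'] C C' t by blast
          qed
        qed
        then show ?case by blast
      qed
    qed (use TS UV strip in auto)
    finally show ?thesis .
  qed
  have CE: "t \<in> E_plus \<mu> \<nu>" if "t \<in> C" for t using that in_components_subset[OF C] by blast
  interpret Q: quadrant_product \<kappa> C "{x. measure \<mu> {x} \<noteq> 0}"
  proof (intro quadrant_product.intro quadrant_product_axioms.intro)
    show "finite_measure \<kappa>" "sets \<kappa> = sets borel" using MargD[OF marg] by auto
    show "open_interval C" by fact
    show "countable {x. measure \<mu> {x} \<noteq> 0}" by (rule M.countable_support)
    have ind: "indicator (strip C) \<in> borel_measurable \<pi>" using strip by (rule borel_measurable_indicator)
    show "AE z in \<kappa>. z \<in> strip C"
      unfolding \<kappa>_def restr_def using ind by (subst AE_density) (auto simp: indicator_def)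
    show "AE z in \<kappa>. fst z = snd z \<longrightarrow> fst z \<in> {x. measure \<mu> {x} \<noteq> 0}"
      unfolding \<kappa>_def restr_def using ind density_diagonal_atoms[OF pd, folded \<pi>_def]
      by (subst AE_density) (auto elim: eventually_mono)
  next
    fix t U V assume t: "t \<in> C" and UV: "U \<in> sets borel" "V \<in> sets borel" "U \<subseteq> {..t}" "V \<subseteq> {t..}"
    show "emeasure \<kappa> (U \<times> V) * emeasure \<kappa> ({..t} \<times> {t..}) = emeasure \<kappa> (U \<times> {t..}) * emeasure \<kappa> ({..t} \<times> V)"
      using entropy_minimal_product[OF p UV] rect[OF t UV] rect[OF t UV(1) _ UV(3), of "{t..}"]
        rect[OF t _ UV(2) _ UV(4), of "{..t}"] rect[OF t, of "{..t}" "{t..}"]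
      by (simp add: \<pi>_def)
  next
    \<comment> \<open>The two conditions that define \<open>E_plus\<close> are precisely the
      positivity of these two crossing masses.\<close>
    fix t assume t: "t \<in> C"
    have "emeasure \<kappa> ({..t} \<times> {t<..}) = emeasure \<pi> ({..t} \<times> {t<..})"
      by (rule rect[OF t]) auto
    also have "emeasure \<pi> ({..t} \<times> {t<..}) = emeasure \<pi> {z. fst z \<le> t \<and> t < snd z}"
      by (rule arg_cong[where f="emeasure \<pi>"]) auto
    finally show "emeasure \<kappa> ({..t} \<times> {t<..}) > 0"
      using CE[OF t] by (simp add: P.emeasure_eq_measure optimal_crossings[OF opt] E_plus_def)
    have "emeasure \<kappa> ({..<t} \<times> {t..}) = emeasure \<pi> ({..<t} \<times> {t..})"
      by (rule rect[OF t]) auto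
    also have "emeasure \<pi> ({..<t} \<times> {t..}) = emeasure \<pi> {z. fst z < t \<and> t \<le> snd z}"
      by (rule arg_cong[where f="emeasure \<pi>"]) auto
    finally show "emeasure \<kappa> ({..<t} \<times> {t..}) > 0"
      using CE[OF t] by (simp add: P.emeasure_eq_measure optimal_crossings[OF opt] E_plus_def)
  next
    fix x assume "x \<notin> {x. measure \<mu> {x} \<noteq> 0}"
    then have x: "emeasure \<mu> {x} = 0" by (simp add: M.emeasure_eq_measure)
    have "emeasure \<kappa> ({x} \<times> UNIV) = emeasure \<pi> (strip C \<inter> {x} \<times> UNIV)"
      unfolding \<kappa>_def by (rule emeasure_restr[OF strip]) (use TS in auto)
    also have "\<dots> \<le> emeasure \<pi> ({x} \<times> UNIV)"
      by (rule emeasure_mono) (use TS in auto)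
    also have "emeasure \<pi> ({x} \<times> UNIV) = emeasure \<pi> {z. fst z \<in> {x}}"
      by (rule arg_cong[where f="emeasure \<pi>"]) auto
    also have "\<dots> = emeasure \<mu> {x}" by (rule MargD(4)[OF \<pi>]) simp
    finally show "emeasure \<kappa> ({x} \<times> UNIV) = 0" using x by simp
  qed
  have \<eta>: "Q.\<eta>1 \<in> sigma_fin_measures" "Q.\<eta>2 \<in> sigma_fin_measures"
    using Q.sigma_finite_eta by (auto simp: sigma_fin_measures_def)
  have pos: "emeasure \<kappa> ({..t} \<times> {t..}) > 0" if "t \<in> C" for t
    using Q.k_pos[OF that that] by (simp add: Q.k_def Q.emeasure_eq_measure)
  have "Kellerer_F (mu_plus_comp \<mu> \<nu> C) (nu_plus_comp \<mu> \<nu> C) = \<kappa>"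
    unfolding Kellerer_F_def
  proof (rule the_equality)
    show "\<kappa> \<in> Marg (mu_plus_comp \<mu> \<nu> C) (nu_plus_comp \<mu> \<nu> C) \<and>
      (\<exists>\<eta>1\<in>sigma_fin_measures. \<exists>\<eta>2\<in>sigma_fin_measures. \<kappa> = restr (\<eta>1 \<Otimes>\<^sub>M \<eta>2) F_set)"
      using marg \<eta> Q.Kellerer_form by blast
    fix \<kappa>' assume "\<kappa>' \<in> Marg (mu_plus_comp \<mu> \<nu> C) (nu_plus_comp \<mu> \<nu> C) \<and>
      (\<exists>\<eta>1\<in>sigma_fin_measures. \<exists>\<eta>2\<in>sigma_fin_measures. \<kappa>' = restr (\<eta>1 \<Otimes>\<^sub>M \<eta>2) F_set)"
    then obtain \<eta>3 \<eta>4 where \<kappa>': "\<kappa>' \<in> Marg (mu_plus_comp \<mu> \<nu> C) (nu_plus_comp \<mu> \<nu> C)"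
      "\<kappa>' = restr (\<eta>3 \<Otimes>\<^sub>M \<eta>4) F_set" "\<eta>3 \<in> sigma_fin_measures" "\<eta>4 \<in> sigma_fin_measures" by blast
    show "\<kappa>' = \<kappa>"
      by (rule Kellerer_unique[OF marg \<kappa>'(1) Q.Kellerer_form \<eta> \<kappa>'(2-4) I plus_comp_null[OF C] pos, symmetric])
  qed
  then show ?thesis by (simp add: \<kappa>_def \<pi>_def)
qed

section \<open>Exchange of the marginals for densities\<close>

abbreviation swap_density :: "(real \<times> real \<Rightarrow> real) \<Rightarrow> real \<times> real \<Rightarrow> real" where
  "swap_density p z \<equiv> p (snd z, fst z)"

lemma integral_swap:
  fixes f :: "real \<times> real \<Rightarrow> real"
  assumes "f \<in> borel_measurable R"
  shows "integrable S.R (\<lambda>z. f (snd z, fst z)) \<longleftrightarrow> integrable R f"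
    "(\<integral>z. f (snd z, fst z) \<partial>S.R) = (\<integral>z. f z \<partial>R)"
  using R.integrable_product_swap_iff[of f] R.integral_product_swap[OF assms]
  by (simp_all only: case_prod_unfold)

lemma density_swap:
  assumes p: "plan_density p"
  shows "density S.R (swap_density p) = swap_plan (density R p)"
proof (rule measure_eqI)
  note [measurable] = plan_densityD[OF p]
  have sd: "sets (density R p) = sets borel" by (simp add: sets_R)
  show "sets (density S.R (swap_density p)) = sets (swap_plan (density R p))" by (simp add: S.sets_R)
  fix X assume "X \<in> sets (density S.R (swap_density p))"
  then have X: "X \<in> sets borel" by (simp add: S.sets_R)
  have X': "{z. (snd z, fst z) \<in> X} \<in> sets R" using swap_sets[OF X] sets_R by simp
  have sw: "(\<lambda>(x, y). (y, x)) \<in> measurable R S.R" by measurable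
  have XS: "X \<in> sets S.R" using X S.sets_R by simp
  have pm: "(\<lambda>z. ennreal (swap_density p z)) \<in> borel_measurable S.R" by measurable
  have "emeasure (density S.R (swap_density p)) X = (\<integral>\<^sup>+z. ennreal (swap_density p z) * indicator X z \<partial>S.R)"
    by (rule emeasure_density[OF pm XS])
  also have "\<dots> = (\<integral>\<^sup>+z. ennreal (swap_density p z) * indicator X z \<partial>distr R S.R (\<lambda>(x, y). (y, x)))"
    by (subst S.R.distr_pair_swap) simp
  also have "\<dots> = (\<integral>\<^sup>+z. ennreal (p z) * indicator {z. (snd z, fst z) \<in> X} z \<partial>R)"
  proof (subst nn_integral_distr[OF sw])
    show "(\<lambda>z. ennreal (swap_density p z) * indicator X z) \<in> borel_measurable (distr R S.R (\<lambda>(x, y). (y, x)))"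
      unfolding measurable_distr_eq1 using pm XS by (intro borel_measurable_times_ennreal borel_measurable_indicator)
  qed (auto intro!: nn_integral_cong simp: split_beta indicator_def)
  also have "\<dots> = emeasure (density R p) {z. (snd z, fst z) \<in> X}"
    by (rule emeasure_density[symmetric, OF _ X']) measurable
  also have "\<dots> = emeasure (swap_plan (density R p)) X"
    by (rule emeasure_swap_plan[OF sd X, symmetric])
  finally show "emeasure (density S.R (swap_density p)) X = emeasure (swap_plan (density R p)) X" .
qed

lemma admissible_swap:
  assumes p: "admissible p"
  shows "S.admissible (swap_density p)" "S.entropy (swap_density p) = entropy p"
proof -
  note P = admissibleD[OF p]
  note [measurable] = plan_densityD[OF P(1)]
  have "swap_plan (density R p) \<in> Marg \<nu> \<mu>"
    using P(1) unfolding plan_density_def by (intro swap_plan_Marg) blast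
  then have "density S.R (swap_density p) \<in> Marg \<nu> \<mu>" by (simp only: density_swap[OF P(1)])
  moreover have "swap_density p \<in> borel_measurable S.R" by measurable
  ultimately have "S.plan_density (swap_density p)"
    using plan_density_nonneg[OF P(1)] unfolding S.plan_density_def by blast
  moreover have "integrable S.R (\<lambda>z. swap_density p z * ln (swap_density p z))"
    "S.entropy (swap_density p) = entropy p"
    using integral_swap[of "\<lambda>z. p z * ln (p z)"] P(2) by simp_all
  moreover have "integrable S.R (\<lambda>z. \<bar>snd z - fst z\<bar> * swap_density p z)"
    using integral_swap(1)[of "\<lambda>z. \<bar>snd z - fst z\<bar> * p z"] P(3) by (simp add: abs_minus_commute)
  ultimately show "S.admissible (swap_density p)" "S.entropy (swap_density p) = entropy p"
    by (simp_all add: S.admissible_def)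
qed

end

context finite_borel_pair
begin

text \<open>Exchange is an involution, so a competitor for the exchanged pair goes back to one for
  the original pair with the same entropy.\<close>

lemma entropy_minimal_swap:
  assumes p: "entropy_minimal p"
  shows "S.entropy_minimal (swap_density p)"
proof -
  have adm: "admissible p" and opt: "optimal (density R p)"
    and min: "\<And>g. admissible g \<Longrightarrow> optimal (density R g) \<Longrightarrow> entropy p \<le> entropy g"
    using p by (auto simp: entropy_minimal_def)
  have "S.entropy (swap_density p) \<le> S.entropy g" if g: "S.admissible g" "S.optimal (density S.R g)" for g
  proof -
    have "optimal (density R (S.swap_density g))"
      unfolding S.density_swap[OF S.admissibleD(1)[OF g(1)]] by (rule S.swap_plan_optimal[OF g(2)])
    with S.admissible_swap(1)[OF g(1)] have "entropy p \<le> entropy (S.swap_density g)" by (rule min)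
    then show ?thesis unfolding S.admissible_swap(2)[OF g(1)] admissible_swap(2)[OF adm] .
  qed
  moreover have "S.optimal (density S.R (swap_density p))"
    using swap_plan_optimal[OF opt] density_swap[OF admissibleD(1)[OF adm]] by simp
  ultimately show ?thesis using admissible_swap(1)[OF adm] by (simp add: S.entropy_minimal_def)
qed

theorem entropy_minimal_eq_Kellerer_plan:
  assumes p: "entropy_minimal p"
  shows "density R p = Kellerer_plan \<mu> \<nu>"
proof (rule Kellerer_plan_eq[symmetric])
  show "optimal (density R p)" using p by (simp add: entropy_minimal_def)
  show "Kellerer_F (mu_plus_comp \<mu> \<nu> C) (nu_plus_comp \<mu> \<nu> C) = restr (density R p) (strip C)"
    if "C \<in> components (E_plus \<mu> \<nu>)" for C
    by (rule entropy_minimal_Kellerer[OF p that])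
  show "Kellerer_F (mu_plus_comp \<nu> \<mu> C) (nu_plus_comp \<nu> \<mu> C) = restr (swap_plan (density R p)) (strip C)"
    if "C \<in> components (E_plus \<nu> \<mu>)" for C
    using S.entropy_minimal_Kellerer[OF entropy_minimal_swap[OF p] that]
      density_swap[of p] p by (simp add: entropy_minimal_def admissible_def)
qed

end

theorem theorem3p8:
  fixes \<mu> \<nu> :: "real measure"
  assumes "(\<mu>, \<nu>) \<in> marginal_pairs"
    and "W1 \<mu> \<nu> < \<infinity>"
    and "(INF \<pi>\<in>cm_plans \<mu> \<nu>. Ent \<pi> (\<mu> \<Otimes>\<^sub>M \<nu>)) < \<infinity>"
  shows "weakly_tendsto (pi_eps \<mu> \<nu>) (Kellerer_plan \<mu> \<nu>) (at_right 0)"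
proof -
  interpret finite_borel_pair \<mu> \<nu>
    using assms(1)
    by (intro finite_borel_pair.intro finite_borel_measure.intro finite_borel_measure_axioms.intro
        finite_borel_pair_axioms.intro) (auto simp: marginal_pairs_def fin_measures_def)
  \<comment> \<open>The density of this plan becomes the competitor \<open>p0\<close> that bounds
    the entropies of the minimizers.\<close>
  obtain \<pi> where \<pi>: "\<pi> \<in> cm_plans \<mu> \<nu>" "Ent \<pi> R < \<infinity>"
    using assms(3) unfolding INF_less_iff by blast
  have opt: "optimal \<pi>" by (rule cm_plan_optimal[OF \<pi>(1)])
  then have marg: "\<pi> \<in> Marg \<mu> \<nu>" by (simp add: optimal_def)
  obtain p where p: "plan_density p" "\<pi> = density R p" "integrable R (\<lambda>z. p z * ln (p z))"
    using finite_Ent_imp_density[OF marg \<pi>(2)] .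
  \<comment> \<open>Some plan has finite cost, hence \<open>min_cost\<close> is finite, and it is
    the cost of \<open>\<pi>\<close> by optimality.\<close>
  obtain \<pi>' where "\<pi>' \<in> Marg \<mu> \<nu>" "transport_cost \<pi>' < \<infinity>"
    using assms(2) unfolding W1_def INF_less_iff by blast
  then have "transport_cost \<pi> < \<infinity>"
    unfolding optimal_cost[OF opt] using min_cost_le le_less_trans by blast
  then have "admissible p"
    using p transport_cost_density[OF p(1)] by (auto simp: admissible_def split: if_splits)
  then show ?thesis
    using weakly_tendsto_entropy_minimal entropy_minimal_eq_Kellerer_plan opt p(2) by blast
qed

end
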